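(* For any $\mu\in\mathcal M^o$, when $t\to\infty$, the $\mathcal M$-valued two-sided process $(X_{t+u})_{u\in\mathbb R}$ under $\mathrm P_\mu(\cdot\mid X_t\ne\mathbf 0)$ converges to the process $(Y_u)_{u\in\mathbb R}$ in the sense of finite-dimensional distributions.
   Context: Setting. $E$ is a Polish space. For a metric space $F$, $b\mathcal B(F)$, $p\mathcal B(F)$, $bp\mathcal B(F)$ denote the bounded, the non-negative, and the bounded non-negative Borel functions on $F$. $\mathbb R_+=[0,\infty)$. $(\xi_t)_{t\in[0,\zeta)}$ is an $E$-valued Borel right process with (possibly sub-Markovian) transition semigroup $(P_t)_{t\ge0}$ and lifetime $\zeta$; $\Pi_x$ is its law started from $x\in E$. The branching mechanism is $$\psi(x,z)=-\beta(x)z+\sigma(x)^2z^2+\int_{(0,\infty)}(e^{-zu}-1+zu)\,\pi(x,du),\quad x\in E,\ z\ge0,$$ with $\beta,\sigma\in b\mathcal B(E)$ and $\pi$ a kernel from $E$ to $(0,\infty)$ with $\sup_{x\in E}\int_{(0,\infty)}(u\wedge u^2)\pi(x,du)<\infty$. For $f\in bp\mathcal B(E)$, $(t,x)\mapsto V_tf(x)$ is the unique non-negative Borel function on $\mathbb R_+\times E$ that is bounded on $[0,t_0]\times E$ for every $t_0\ge 0$ and satisfies $V_tf(x)+\int_0^t ds\int_E\psi(y,V_{t-s}f(y))P_s(x,dy)=P_tf(x)$ for all $t\ge0,x\in E$. $\mathcal M$ is the Polish space of finite Borel measures on $E$ with the topology of weak convergence, $\mathbf 0$ is the null measure, $\mathcal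 M^o=\mathcal M\setminus\{\mathbf 0\}$, and $\gamma(f)=\int f\,d\gamma$. The $(\xi,\psi)$-superprocess $X=(X_t)_{t\ge0}$ is the $\mathcal M$-valued conservative right process with transition semigroup $(Q_t)_{t\ge0}$ determined by $\int_{\mathcal M}e^{-\eta(f)}Q_t(\mu,d\eta)=e^{-\mu(V_tf)}$ for $\mu\in\mathcal M$, $t\ge0$, $f\in bp\mathcal B(E)$. It is realized as the coordinate process on the space $\Omega$ of $\mathcal M$-valued right-continuous functions on $\mathbb R_+$; $\mathcal F_t=\sigma(X_s:s\le t)$, $\mathcal F=\sigma(X_s:s\ge0)$; $\mathrm P_\mu$ is the law (and expectation) of $X$ with $X_0=\mu$. For a probability measure $\mathbf P$ on $\mathcal M$, $(\mathbf P\mathrm P)(A):=\int_{\mathcal M}\mathrm P_\mu(A)\,\mathbf P(d\mu)$, $A\in\mathcal F$. The mean semigroup is $T_tf(x)=\Pi_x[e^{\int_0^t\beta(\xi_s)ds}f(\xi_t)\mathbf 1_{\{t<\zeta\}}]$, and $L_1^+(\nu)$ is the set of $f\in p\mathcal B(E)$ with $\nu(f)<\infty$. Standing assumptions: (i) There are $\lambda\in\mathbb R$, a bounded strictly positive Borel function $\phi$ on $E$ and a probability measure $\nu$ with full support on $E$ such that $\nu(\phi)=1$ and, for all $t\ge0$, $T_t\phi=e^{\lambda t}\phi$ and $\nu T_t=e^{\lambda t}\nu$. (ii) There is a map $(t,x,f)\mapsto H_tf(x)$ from $(0,\infty)\times E\times L_1^+(\nu)$ to $\mathbb R$ with $T_tf(x)=e^{\lambda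 t}\phi(x)\nu(f)(1+H_tf(x))$ for all $t>0$, $x\in E$, $f\in L_1^+(\nu)$; $\sup_{x\in E,f\in L_1^+(\nu)}|H_tf(x)|<\infty$ for every $t>0$; and $\lim_{t\to\infty}\sup_{x\in E,f\in L_1^+(\nu)}|H_tf(x)|=0$. (iii) $\lambda<0$ (subcriticality). (iv) $\mathrm P_\nu(X_t=\mathbf 0)>0$ for all $t>0$. $\mathbf Q_{\infty,0}$ (the Yaglom limit) is the probability measure on $\mathcal M$ such that for every $\mu\in\mathcal M^o$, $\mathrm P_\mu(X_t\in\cdot\mid X_t\ne\mathbf 0)$ converges weakly to $\mathbf Q_{\infty,0}$ as $t\to\infty$ (it exists); it is known that $(\mathbf Q_{\infty,0}\mathrm P)(X_r\ne\mathbf 0)=e^{\lambda r}>0$ for $r\ge0$. Convention: $X_s:=\mathbf 0$ for $s<0$. $(Y_u)_{u\in\mathbb R}$ is a two-sided $\mathcal M$-valued process on some probability space such that for every $t>0$ the process $(X_{t+u})_{u\ge-t}$ under $(\mathbf Q_{\infty,0}\mathrm P)(\cdot\mid X_t\ne\mathbf 0)$ has the same finite-dimensional distributions as $(Y_u)_{u\ge-t}$ (such a process exists, and this determines its finite-dimensional distributions). *)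

theory Defs
  imports "HOL-Probability.Probability"
begin

section \<open>Finite Borel measures with the weak topology\<close>

typedef (overloaded) 'e fmeas =
  "{m :: 'e::topological_space measure. sets m = sets borel \<and> finite_measure m}"
  morphisms meas Abs_fmeas
  by (rule exI[of _ "null_measure borel"]) (auto intro!: finite_measureI)

instantiation fmeas :: (topological_space) zero
begin

definition zero_fmeas :: "'a fmeas" where
  "zero_fmeas = Abs_fmeas (null_measure borel)"

instance ..

end

abbreviation fmint :: "'e::topological_space fmeas \<Rightarrow> ('e \<Rightarrow> real) \<Rightarrow> real" where
  "fmint \<gamma> f \<equiv> (LINT x|meas \<gamma>. f x)"

instantiation fmeas :: (topological_space) topological_space
begin

definition open_fmeas :: "'a fmeas set \<Rightarrow> bool" where
  "open_fmeas = generate_topology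
     {(\<lambda>\<gamma>. fmint \<gamma> f) -` U | f U. continuous_on UNIV f \<and> bounded (range f) \<and> open U}"

instance
  by standard
    (auto simp: open_fmeas_def intro: generate_topology.UNIV generate_topology.Int
      generate_topology.UN)

end

text \<open>The measures \<open>Ms t\<close> and \<open>M\<close> are meant to live on the Borel sets of \<open>T\<close>. Below, \<open>T\<close> is
  a finite power of a separable metrizable space, so that these are the product sets of
  \<^term>\<open>\<lambda>J. PiM J (\<lambda>_. borel)\<close>.\<close>

definition weakly_converges ::
    "'a topology \<Rightarrow> ('t \<Rightarrow> 'a measure) \<Rightarrow> 'a measure \<Rightarrow> 't filter \<Rightarrow> bool" where
  "weakly_converges T Ms M F \<longleftrightarrow>
     (\<forall>f. continuous_map T euclideanreal f \<and> bounded (f ` topspace T) \<longrightarrow>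
        ((\<lambda>t. LINT x|Ms t. f x) \<longlongrightarrow> (LINT x|M. f x)) F)"

definition fdd :: "'w measure \<Rightarrow> ('i \<Rightarrow> 'w \<Rightarrow> 's::topological_space) \<Rightarrow> 'i set \<Rightarrow> ('i \<Rightarrow> 's) measure"
  where "fdd M X J = distr M (PiM J (\<lambda>_. borel)) (\<lambda>\<omega>. \<lambda>u\<in>J. X u \<omega>)"

definition fdd_converges ::
    "('t \<Rightarrow> 'w measure) \<Rightarrow> ('t \<Rightarrow> 'i \<Rightarrow> 'w \<Rightarrow> 's::topological_space) \<Rightarrow>
      'v measure \<Rightarrow> ('i \<Rightarrow> 'v \<Rightarrow> 's) \<Rightarrow> 't filter \<Rightarrow> bool" where
  "fdd_converges Ms Xs N Y F \<longleftrightarrow>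
     (\<forall>J. finite J \<longrightarrow>
        weakly_converges (product_topology (\<lambda>_. euclidean) J)
          (\<lambda>t. fdd (Ms t) (Xs t) J) (fdd N Y J) F)"

section \<open>Right processes\<close>

definition transition_semigroup :: "(real \<Rightarrow> 'a::topological_space \<Rightarrow> 'a measure) \<Rightarrow> bool" where
  "transition_semigroup P \<longleftrightarrow>
     (\<forall>t\<ge>0. P t \<in> borel \<rightarrow>\<^sub>M subprob_algebra borel) \<and>
     (\<forall>x. P 0 x = return borel x) \<and>
     (\<forall>s\<ge>0. \<forall>t\<ge>0. \<forall>x. \<forall>B\<in>sets borel.
        emeasure (P (s + t) x) B = (\<integral>\<^sup>+y. emeasure (P t y) B \<partial>P s x))"

definition universally_measurable :: "('a::topological_space \<Rightarrow> ennreal) \<Rightarrow> bool" where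
  "universally_measurable f \<longleftrightarrow>
     (\<forall>m. sets m = sets borel \<and> finite_measure m \<longrightarrow> f \<in> borel_measurable (completion m))"

definition excessive ::
    "(real \<Rightarrow> 'a::topological_space \<Rightarrow> 'a measure) \<Rightarrow> real \<Rightarrow> ('a \<Rightarrow> ennreal) \<Rightarrow> bool" where
  "excessive P \<alpha> f \<longleftrightarrow>
     universally_measurable f \<and>
     (\<forall>t\<ge>0. \<forall>x. ennreal (exp (- \<alpha> * t)) * (\<integral>\<^sup>+y. f y \<partial>completion (P t x)) \<le> f x) \<and>
     (\<forall>x. ((\<lambda>t. ennreal (exp (- \<alpha> * t)) * (\<integral>\<^sup>+y. f y \<partial>completion (P t x))) \<longlongrightarrow> f x) (at_right 0))"

definition natural_filtration ::
    "'w measure \<Rightarrow> (real \<Rightarrow> 'w \<Rightarrow> 'a::topological_space) \<Rightarrow> ('w \<Rightarrow> ereal) \<Rightarrow> real \<Rightarrow> 'w measure" where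
  "natural_filtration W \<xi> \<zeta> t = sigma (space W)
     {{\<omega> \<in> space W. ereal s < \<zeta> \<omega> \<and> \<xi> s \<omega> \<in> B} | s B. 0 \<le> s \<and> s \<le> t \<and> B \<in> sets borel}"

text \<open>Borel right processes in Sharpe's sense: a right-continuous realization of the Markov
  property (first right hypothesis), and right-continuity of \<open>\<alpha>\<close>-excessive functions along paths
  (second right hypothesis, which yields the strong Markov property). \<open>W\<close> is the underlying
  measurable space; the value \<open>\<xi> t \<omega>\<close> is meaningful only for \<open>0 \<le> t < \<zeta> \<omega>\<close>.\<close>

locale right_process =
  fixes P :: "real \<Rightarrow> 'a::topological_space \<Rightarrow> 'a measure"
    and W :: "'w measure" and \<P> :: "'a \<Rightarrow> 'w measure"
    and \<xi> :: "real \<Rightarrow> 'w \<Rightarrow> 'a" and \<zeta> :: "'w \<Rightarrow> ereal"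
  assumes semigroup: "transition_semigroup P"
    and laws: "\<P> \<in> borel \<rightarrow>\<^sub>M prob_algebra W"
    and measurable_process: "\<And>t B. 0 \<le> t \<Longrightarrow> B \<in> sets borel \<Longrightarrow>
      {\<omega> \<in> space W. ereal t < \<zeta> \<omega> \<and> \<xi> t \<omega> \<in> B} \<in> sets W"
    and right_continuous: "\<And>t \<omega>. \<omega> \<in> space W \<Longrightarrow> 0 \<le> t \<Longrightarrow> ereal t < \<zeta> \<omega> \<Longrightarrow>
      ((\<lambda>s. \<xi> s \<omega>) \<longlongrightarrow> \<xi> t \<omega>) (at_right t)"
    and start: "\<And>x. AE \<omega> in \<P> x. 0 < \<zeta> \<omega> \<and> \<xi> 0 \<omega> = x"
    and Markov: "\<And>x s t A B. 0 \<le> s \<Longrightarrow> 0 \<le> t \<Longrightarrow>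
      A \<in> sets (natural_filtration W \<xi> \<zeta> t) \<Longrightarrow> B \<in> sets borel \<Longrightarrow>
      emeasure (\<P> x) {\<omega> \<in> A. ereal (t + s) < \<zeta> \<omega> \<and> \<xi> (t + s) \<omega> \<in> B} =
        (\<integral>\<^sup>+\<omega>. emeasure (P s (\<xi> t \<omega>)) B * indicator {\<omega> \<in> A. ereal t < \<zeta> \<omega>} \<omega> \<partial>\<P> x)"
    and excessive_right_continuous: "\<And>m \<alpha> f. m \<in> space (prob_algebra borel) \<Longrightarrow> 0 < \<alpha> \<Longrightarrow>
      excessive P \<alpha> f \<Longrightarrow>
      AE \<omega> in m \<bind> \<P>. \<forall>t\<ge>0. ereal t < \<zeta> \<omega> \<longrightarrow> ((\<lambda>s. f (\<xi> s \<omega>)) \<longlongrightarrow> f (\<xi> t \<omega>)) (at_right t)"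

section \<open>Branching mechanism, cumulant semigroup, mean semigroup\<close>

definition bpB :: "('e::topological_space \<Rightarrow> real) set" where
  "bpB = {f \<in> borel_measurable borel. (\<forall>x. 0 \<le> f x) \<and> bounded (range f)}"

definition branching_data ::
    "('e::topological_space \<Rightarrow> real) \<Rightarrow> ('e \<Rightarrow> real) \<Rightarrow> ('e \<Rightarrow> real measure) \<Rightarrow> bool" where
  "branching_data \<beta> \<sigma> \<pi> \<longleftrightarrow>
     \<beta> \<in> borel_measurable borel \<and> bounded (range \<beta>) \<and>
     \<sigma> \<in> borel_measurable borel \<and> bounded (range \<sigma>) \<and>
     (\<forall>x. sets (\<pi> x) = sets (restrict_space borel {0<..})) \<and>
     (\<forall>B\<in>sets (restrict_space borel {0<..}). (\<lambda>x. emeasure (\<pi> x) B) \<in> borel_measurable borel) \<and>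
     (SUP x. \<integral>\<^sup>+u. ennreal (min u (u\<^sup>2)) \<partial>\<pi> x) < \<infinity>"

definition branching_mechanism ::
    "('e \<Rightarrow> real) \<Rightarrow> ('e \<Rightarrow> real) \<Rightarrow> ('e \<Rightarrow> real measure) \<Rightarrow> 'e \<Rightarrow> real \<Rightarrow> real" where
  "branching_mechanism \<beta> \<sigma> \<pi> x z =
     - \<beta> x * z + (\<sigma> x)\<^sup>2 * z\<^sup>2 + (LINT u|\<pi> x. exp (- z * u) - 1 + z * u)"

definition cumulant_solution ::
    "(real \<Rightarrow> 'e::topological_space \<Rightarrow> 'e measure) \<Rightarrow> ('e \<Rightarrow> real \<Rightarrow> real) \<Rightarrow> ('e \<Rightarrow> real) \<Rightarrow>
      (real \<Rightarrow> 'e \<Rightarrow> real) \<Rightarrow> bool" where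
  "cumulant_solution P \<psi> f v \<longleftrightarrow>
     (\<lambda>(t, x). v t x) \<in> borel_measurable (restrict_space borel ({0..} \<times> UNIV)) \<and>
     (\<forall>t\<ge>0. \<forall>x. 0 \<le> v t x) \<and>
     (\<forall>t\<^sub>0\<ge>0. bounded ((\<lambda>(t, x). v t x) ` ({0..t\<^sub>0} \<times> UNIV))) \<and>
     (\<forall>t\<ge>0. \<forall>x. v t x + (LINT s:{0..t}|lborel. LINT y|P s x. \<psi> y (v (t - s) y)) =
        (LINT y|P t x. f y))"

definition cumulant_semigroup ::
    "(real \<Rightarrow> 'e::topological_space \<Rightarrow> 'e measure) \<Rightarrow> ('e \<Rightarrow> real \<Rightarrow> real) \<Rightarrow>
      (real \<Rightarrow> ('e \<Rightarrow> real) \<Rightarrow> 'e \<Rightarrow> real) \<Rightarrow> bool" where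
  "cumulant_semigroup P \<psi> V \<longleftrightarrow>
     (\<forall>f\<in>bpB. cumulant_solution P \<psi> f (\<lambda>t. V t f) \<and>
        (\<forall>v. cumulant_solution P \<psi> f v \<longrightarrow> (\<forall>t\<ge>0. \<forall>x. v t x = V t f x)))"

definition mean_semigroup ::
    "('e \<Rightarrow> 'w measure) \<Rightarrow> (real \<Rightarrow> 'w \<Rightarrow> 'e) \<Rightarrow> ('w \<Rightarrow> ereal) \<Rightarrow> ('e \<Rightarrow> real) \<Rightarrow>
      real \<Rightarrow> ('e \<Rightarrow> real) \<Rightarrow> 'e \<Rightarrow> ennreal" where
  "mean_semigroup \<P> \<xi> \<zeta> \<beta> t f x =
     (\<integral>\<^sup>+\<omega>. ennreal (exp (LINT s:{0..t}|lborel. \<beta> (\<xi> s \<omega>)) * f (\<xi> t \<omega>)) *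
        indicator {\<omega>. ereal t < \<zeta> \<omega>} \<omega> \<partial>\<P> x)"

definition L1_plus :: "'e::topological_space measure \<Rightarrow> ('e \<Rightarrow> real) set" where
  "L1_plus \<nu> = {f \<in> borel_measurable borel. (\<forall>x. 0 \<le> f x) \<and> (\<integral>\<^sup>+x. ennreal (f x) \<partial>\<nu>) < \<infinity>}"

section \<open>Superprocesses\<close>

text \<open>Right-continuous functions on \<open>[0, \<infinity>)\<close>, with the \<open>\<sigma>\<close>-algebra generated by the
  coordinates.\<close>

definition path_space :: "(real \<Rightarrow> 'e::topological_space fmeas) measure" where
  "path_space = restrict_space (PiM {0..} (\<lambda>_. borel))
     {\<omega>. \<forall>t\<ge>0. (\<omega> \<longlongrightarrow> \<omega> t) (at_right t)}"

definition X :: "real \<Rightarrow> (real \<Rightarrow> 'e::topological_space fmeas) \<Rightarrow> 'e fmeas" where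
  "X t \<omega> = (if t < 0 then 0 else \<omega> t)"

definition superprocess ::
    "(real \<Rightarrow> ('e::topological_space \<Rightarrow> real) \<Rightarrow> 'e \<Rightarrow> real) \<Rightarrow>
      (real \<Rightarrow> 'e fmeas \<Rightarrow> 'e fmeas measure) \<Rightarrow>
      ('e fmeas \<Rightarrow> (real \<Rightarrow> 'e fmeas) measure) \<Rightarrow> bool" where
  "superprocess V Q \<P> \<longleftrightarrow>
     right_process Q path_space \<P> X (\<lambda>_. \<infinity>) \<and>
     (\<forall>t\<ge>0. \<forall>\<mu>. \<forall>f\<in>bpB. (LINT \<eta>|Q t \<mu>. exp (- fmint \<eta> f)) = exp (- fmint \<mu> (V t f)))"

definition given_alive ::
    "(real \<Rightarrow> 'e::topological_space fmeas) measure \<Rightarrow> real \<Rightarrow> (real \<Rightarrow> 'e fmeas) measure" where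
  "given_alive M t = uniform_measure M {\<omega> \<in> space M. X t \<omega> \<noteq> 0}"

definition Yaglom_limit ::
    "('e::topological_space fmeas \<Rightarrow> (real \<Rightarrow> 'e fmeas) measure) \<Rightarrow> 'e fmeas measure \<Rightarrow> bool" where
  "Yaglom_limit \<P> R \<longleftrightarrow>
     R \<in> space (prob_algebra borel) \<and>
     (\<forall>\<mu>. \<mu> \<noteq> 0 \<longrightarrow>
        weakly_converges euclidean (\<lambda>t. distr (given_alive (\<P> \<mu>) t) borel (X t)) R at_top)"

end

theory Submission
  imports Defs
begin

text \<open>Why the theorem holds. Fix finitely many times \<open>u \<in> J\<close> and choose \<open>r > 0\<close> with \<open>r + u > 0\<close> for all
  of them. By the Markov property at time \<open>t - r\<close> and the Laplace functional of the superprocess, the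
  joint Laplace functional of \<open>(X\<^sub>t\<^sub>+\<^sub>u)\<close> on \<open>X\<^sub>t \<noteq> 0\<close> is \<open>P\<^sub>\<mu>[exp (- X(w)) - exp (- X(w'))]\<close>, where \<open>X\<close>
  stands for \<open>X\<^sub>t\<^sub>-\<^sub>r\<close> and \<open>w\<close>, \<open>w'\<close> are bounded non-negative Borel functions that do not depend on \<open>t\<close>
  or \<open>\<mu>\<close> (lemmas \<open>cylinder_Laplace\<close> and \<open>killed_cylinder_Laplace\<close>; the latter encodes the event
  of extinction as the limit of the weights \<open>exp (- n X\<^sub>t(1))\<close>). Likewise \<open>P\<^sub>\<mu>(X\<^sub>t \<noteq> 0) = P\<^sub>\<mu>[1 - exp (- X(v))]\<close>.
  Dividing, the conditional Laplace functional is a continuous expression in the numbers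
  \<open>P\<^sub>\<mu>[exp (- X\<^sub>s(f)) | X\<^sub>s \<noteq> 0]\<close> with \<open>s = t - r\<close> and \<open>f\<close> one of \<open>w\<close>, \<open>w'\<close>, \<open>v\<close>, and the same expression with
  the Yaglom limit in place of the conditional law is the Laplace functional of \<open>(Y\<^sub>u)\<close>.

  The functions \<open>w\<close>, \<open>w'\<close>, \<open>v\<close> are only Borel, whereas the Yaglom limit is a weak limit. Lemma \<open>Yaglom_Borel\<close>
  bridges this gap: if \<open>g\<close> is continuous and close to \<open>f\<close> in \<open>L\<^sup>1(\<nu>)\<close>, then the error
  \<open>P\<^sub>\<mu>[1 - exp (- X\<^sub>s\<^sub>+\<^sub>1(\<bar>f - g\<bar>)) | X\<^sub>s\<^sub>+\<^sub>1 \<noteq> 0]\<close> is at most a constant times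
  \<open>P\<^sub>\<mu>[1 - exp (- \<epsilon> X\<^sub>s(1)) | X\<^sub>s \<noteq> 0]\<close> with \<open>\<epsilon>\<close> proportional to \<open>\<nu>(\<bar>f - g\<bar>)\<close>, and that bound involves a continuous
  function. Two facts enter: \<open>V\<^sub>1 h \<le> C \<nu>(h)\<close>, and for large times the survival probability
  decreases at most by a constant factor per unit of time. Both follow, through elementary iterations of the cumulant equation
  (\<open>cumulant_upper_bound\<close>, \<open>cumulant_lower_bound\<close>), from the comparison of \<open>V\<^sub>t\<close> with the
  mean semigroup and the asymptotics of the latter (\<open>cumulant_bounds\<close>).

  Finally, convergence of joint Laplace functionals implies weak convergence on finite powers of the
  space of finite measures (\<open>Laplace_weak_convergence\<close>). That space is second countable, and every bounded
  continuous function on a finite power is, up to constants, an increasing limit of functions in the uniformly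
  closed algebra generated by the Laplace exponentials, which makes a tightness argument unnecessary.\<close>

section \<open>Countable lower approximation of lower semicontinuous functions\<close>

text \<open>If countably many functions below \<open>f\<close> have pointwise supremum \<open>f\<close>, then their successive maxima
  increase to \<open>f\<close>.\<close>

lemma increasing_max_approximation:
  fixes f :: "'a \<Rightarrow> real"
  assumes C: "countable C" "C \<noteq> {}" "C \<subseteq> H"
    and max_closed: "\<And>g h. g \<in> H \<Longrightarrow> h \<in> H \<Longrightarrow> (\<lambda>x. max (g x) (h x)) \<in> H"
    and below: "\<And>g x. g \<in> C \<Longrightarrow> x \<in> A \<Longrightarrow> g x \<le> f x"
    and dense: "\<And>x s. x \<in> A \<Longrightarrow> s < f x \<Longrightarrow> \<exists>g\<in>C. s < g x"
  obtains G :: "nat \<Rightarrow> 'a \<Rightarrow> real"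
  where "\<And>n. G n \<in> H" "\<And>x. incseq (\<lambda>n. G n x)"
    "\<And>n x. x \<in> A \<Longrightarrow> G n x \<le> f x" "\<And>x. x \<in> A \<Longrightarrow> (\<lambda>n. G n x) \<longlonglongrightarrow> f x"
proof -
  define e where "e = from_nat_into C"
  define G where "G = rec_nat (e 0) (\<lambda>n g x. max (g x) (e (Suc n) x))"
  have G0: "G 0 = e 0" and GS: "G (Suc n) = (\<lambda>x. max (G n x) (e (Suc n) x))" for n
    by (auto simp: G_def)
  have eC: "e n \<in> C" for n
    using from_nat_into[OF C(2)] by (simp add: e_def)
  have GH: "G n \<in> H" for n
  proof (induction n)
    case 0 then show ?case using eC C(3) by (auto simp: G0)
  next
    case (Suc n) then show ?case using eC C(3) max_closed by (auto simp: GS)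
  qed
  have inc: "incseq (\<lambda>n. G n x)" for x
    by (rule incseq_SucI) (simp add: GS)
  have le: "G n x \<le> f x" if "x \<in> A" for n x
    by (induction n) (use that eC below in \<open>auto simp: G0 GS\<close>)
  have ge: "e n x \<le> G n x" for n x
    by (cases n) (auto simp: G0 GS)
  have "(\<lambda>n. G n x) \<longlonglongrightarrow> f x" if x: "x \<in> A" for x
  proof (rule increasing_tendsto)
    show "\<forall>\<^sub>F n in sequentially. G n x \<le> f x" using le[OF x] by simp
    fix s assume "s < f x"
    with dense[OF x] obtain g where g: "g \<in> C" "s < g x" by blast
    then obtain k where "e k = g"
      using from_nat_into_surj[OF C(1)] e_def by metis
    then have "s < G k x" using g ge[of k x] by auto
    then have "s < G n x" if "k \<le> n" for n
      using incseqD[OF inc that, of x] by linarith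
    then show "\<forall>\<^sub>F n in sequentially. s < G n x"
      by (auto simp: eventually_sequentially)
  qed
  with GH inc le show ?thesis by (rule that)
qed

text \<open>A countable, max-closed family of continuous functions that exhausts every non-negative
  lower semicontinuous function from below: maxima of finitely many cones with rational height,
  integer slope and vertex in a countable dense set.\<close>

definition cones :: "('e::polish_space \<Rightarrow> real) set" where
  "cones = (\<lambda>(d, q, m) x. max 0 (of_rat q * (1 - real m * dist x d))) `
     ((SOME D. countable D \<and> (\<forall>X::'e set. open X \<longrightarrow> X \<noteq> {} \<longrightarrow> (\<exists>d\<in>D. d \<in> X)))
        \<times> {0..} \<times> (UNIV :: nat set))"

definition max_cones :: "('e::polish_space \<Rightarrow> real) set" where
  "max_cones = (\<lambda>F x. Max ((\<lambda>c. c x) ` F)) ` {F. finite F \<and> F \<subseteq> cones \<and> F \<noteq> {}}"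

lemma countable_dense_choice:
  defines "D \<equiv> (SOME D. countable D \<and> (\<forall>X::'e::polish_space set. open X \<longrightarrow> X \<noteq> {} \<longrightarrow> (\<exists>d\<in>D. d \<in> X)))"
  shows "countable D" "open U \<Longrightarrow> U \<noteq> {} \<Longrightarrow> \<exists>d\<in>D. d \<in> U"
proof -
  obtain D' :: "'e set" where "countable D'" "\<And>X. open X \<Longrightarrow> X \<noteq> {} \<Longrightarrow> \<exists>d\<in>D'. d \<in> X"
    using countable_dense_exists by blast
  then have "\<exists>D. countable D \<and> (\<forall>X::'e set. open X \<longrightarrow> X \<noteq> {} \<longrightarrow> (\<exists>d\<in>D. d \<in> X))"
    by blast
  from someI_ex[OF this] show "countable D" "open U \<Longrightarrow> U \<noteq> {} \<Longrightarrow> \<exists>d\<in>D. d \<in> U"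
    unfolding D_def by blast+
qed

lemma countable_cones: "countable cones"
proof -
  have "countable ({0..} :: rat set)" by (rule countableI_type)
  then show ?thesis
    unfolding cones_def using countable_dense_choice(1) by (intro countable_image countable_SIGMA) auto
qed

lemma countable_max_cones: "countable max_cones"
  unfolding max_cones_def using countable_Collect_finite_subset[OF countable_cones]
  by (intro countable_image) (auto elim: countable_subset[rotated])

lemma cones_props:
  assumes "g \<in> cones"
  shows "continuous_on UNIV g" "0 \<le> g x" "\<exists>K. \<forall>x. g x \<le> K"
proof -
  obtain d q m where g: "g = (\<lambda>x. max 0 (of_rat q * (1 - real m * dist x d)))" and q: "q \<ge> 0"
    using assms by (auto simp: cones_def)
  show "continuous_on UNIV g" unfolding g by (intro continuous_intros)
  show "0 \<le> g x" by (simp add: g)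
  have "g x \<le> of_rat q" for x
    using q by (auto simp: g mult_left_le)
  then show "\<exists>K. \<forall>x. g x \<le> K" by blast
qed

lemma cones_subset_max_cones: "cones \<subseteq> max_cones"
proof
  fix g :: "'a \<Rightarrow> real" assume "g \<in> cones"
  then show "g \<in> max_cones" unfolding max_cones_def
    by (intro image_eqI[where x = "{g}"]) auto
qed

lemma max_cones_max:
  assumes "g \<in> max_cones" "h \<in> max_cones"
  shows "(\<lambda>x. max (g x) (h x)) \<in> max_cones"
proof -
  obtain F F' where "finite F" "F \<subseteq> cones" "F \<noteq> {}" "g = (\<lambda>x. Max ((\<lambda>c. c x) ` F))"
    "finite F'" "F' \<subseteq> cones" "F' \<noteq> {}" "h = (\<lambda>x. Max ((\<lambda>c. c x) ` F'))"
    using assms by (auto simp: max_cones_def)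
  then show ?thesis unfolding max_cones_def
    by (intro image_eqI[where x = "F \<union> F'"]) (auto simp: image_Un Max_Un)
qed

lemma max_cones_props:
  assumes "g \<in> max_cones"
  shows "continuous_on UNIV g" "0 \<le> g x" "\<exists>K. \<forall>x. g x \<le> K"
proof -
  obtain F where F: "finite F" "F \<subseteq> cones" "F \<noteq> {}" "g = (\<lambda>x. Max ((\<lambda>c. c x) ` F))"
    using assms by (auto simp: max_cones_def)
  from F(1,3,2)
  have "continuous_on UNIV (\<lambda>x. Max ((\<lambda>c. c x) ` F)) \<and> (\<exists>K. \<forall>x. Max ((\<lambda>c. c x) ` F) \<le> K)"
  proof (induction F rule: finite_ne_induct)
    case (singleton c) then show ?case using cones_props[of c] by simp
  next
    case (insert c F)
    then have *: "Max ((\<lambda>c. c x) ` insert c F) = max (c x) (Max ((\<lambda>c. c x) ` F))" for x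
      by (simp add: Max_insert)
    obtain K where "\<forall>x. Max ((\<lambda>c. c x) ` F) \<le> K" using insert by auto
    moreover obtain K' where "\<forall>x. c x \<le> K'" using cones_props(3)[of c] insert by auto
    ultimately have "\<forall>x. max (c x) (Max ((\<lambda>c. c x) ` F)) \<le> max K' K"
      by (meson max.mono)
    then show ?case unfolding * using insert cones_props(1)[of c]
      by (auto intro!: continuous_intros)
  qed
  then show "continuous_on UNIV g" "\<exists>K. \<forall>x. g x \<le> K" using F by auto
  show "0 \<le> g x"
    using F cones_props(2)[where x=x] by (auto simp: Max_ge_iff)
qed

lemma lower_semicontinuous_approximation:
  fixes f :: "'e::polish_space \<Rightarrow> real"
  assumes nonneg: "\<And>x. 0 \<le> f x"
    and lsc: "\<And>x s. s < f x \<Longrightarrow> \<forall>\<^sub>F y in nhds x. s < f y"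
  obtains G :: "nat \<Rightarrow> 'e \<Rightarrow> real" where "\<And>n. G n \<in> max_cones" "\<And>x. incseq (\<lambda>n. G n x)"
    "\<And>n x. G n x \<le> f x" "\<And>x. (\<lambda>n. G n x) \<longlonglongrightarrow> f x"
proof -
  define C where "C = {g \<in> cones. \<forall>x. g x \<le> f x}"
  have zero: "\<exists>d. (\<lambda>x. 0) \<in> (C :: ('e \<Rightarrow> real) set)"
  proof -
    obtain d :: 'e where "d \<in> (SOME D. countable D \<and> (\<forall>X::'e set. open X \<longrightarrow> X \<noteq> {} \<longrightarrow> (\<exists>d\<in>D. d \<in> X)))"
      using countable_dense_choice(2)[of "UNIV :: 'e set"] by auto
    then have "(\<lambda>x. 0) \<in> (cones :: ('e \<Rightarrow> real) set)"
      unfolding cones_def by (intro image_eqI[where x = "(d, 0, 0)"]) auto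
    then show ?thesis using nonneg by (auto simp: C_def)
  qed
  have dense: "\<exists>g\<in>C. s < g x" if s: "s < f x" for x s
  proof (cases "s < 0")
    case True then show ?thesis using zero by auto
  next
    case False
    obtain s' where s': "s < s'" "s' < f x" using dense[OF s] by blast
    obtain q :: rat where q: "s < of_rat q" "of_rat q < s'" using of_rat_dense[OF s'(1)] by blast
    then have "(0 :: real) \<le> of_rat q" using False by linarith
    then have q0: "q \<ge> 0" by simp
    obtain \<epsilon> where \<epsilon>: "\<epsilon> > 0" "\<And>y. dist y x < \<epsilon> \<Longrightarrow> s' < f y"
      using lsc[OF s'(2)] by (auto simp: eventually_nhds_metric)
    obtain m :: nat where m: "m > 0" "1 / real m < \<epsilon> / 2"
      using ex_inverse_of_nat_less[of "\<epsilon> / 2"] \<epsilon>(1) by (auto simp: inverse_eq_divide)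
    define r where "r = 1 - s / of_rat q"
    have qpos: "0 < (of_rat q :: real)" using q False by linarith
    have r: "r > 0" using q qpos by (simp add: r_def)
    define \<delta> where "\<delta> = min (r / real m) (\<epsilon> / 2)"
    have \<delta>: "\<delta> > 0" using r m \<epsilon> by (auto simp: \<delta>_def)
    obtain d where d: "d \<in> (SOME D. countable D \<and> (\<forall>X::'e set. open X \<longrightarrow> X \<noteq> {} \<longrightarrow> (\<exists>d\<in>D. d \<in> X)))"
      "dist x d < \<delta>"
      using countable_dense_choice(2)[of "ball x \<delta>"] \<delta> by (auto simp: mem_ball)
    define g where "g = (\<lambda>y. max 0 (of_rat q * (1 - real m * dist y d)))"
    have "g \<in> cones"
      unfolding cones_def g_def using d q0 by (intro image_eqI[where x = "(d, q, m)"]) auto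
    moreover have "g y \<le> f y" for y
    proof (cases "dist y d < 1 / real m")
      case True
      have "dist y x \<le> dist y d + dist x d" by (metis dist_commute dist_triangle)
      also have "\<dots> < \<epsilon>" using True m d by (auto simp: \<delta>_def)
      finally have "s' < f y" using \<epsilon> by auto
      moreover have "g y \<le> of_rat q" using qpos by (auto simp: g_def mult_left_le)
      ultimately show ?thesis using q by linarith
    next
      case False
      then have "1 - real m * dist y d \<le> 0" using m by (simp add: field_simps)
      then have "g y = 0" using qpos by (auto simp: g_def mult_nonneg_nonpos)
      then show ?thesis using nonneg by simp
    qed
    moreover have "s < g x"
    proof -
      have "real m * dist x d < r" using d m by (auto simp: \<delta>_def field_simps)
      then have "of_rat q * (1 - r) < of_rat q * (1 - real m * dist x d)" using qpos by simp
      then show ?thesis using qpos by (auto simp: g_def r_def)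
    qed
    ultimately show ?thesis by (auto simp: C_def)
  qed
  have "countable C" "C \<noteq> {}" "C \<subseteq> max_cones"
    using countable_cones zero cones_subset_max_cones
    by (auto simp: C_def intro: countable_subset[OF _ countable_cones])
  then obtain G where "\<And>n. G n \<in> max_cones" "\<And>x. incseq (\<lambda>n. G n x)"
    "\<And>n x. x \<in> UNIV \<Longrightarrow> G n x \<le> f x" "\<And>x. x \<in> UNIV \<Longrightarrow> (\<lambda>n. G n x) \<longlonglongrightarrow> f x"
    by (rule increasing_max_approximation[of C max_cones UNIV f])
      (use dense in \<open>auto simp: C_def intro: max_cones_max\<close>)
  then show thesis by (intro that[of G]) simp_all
qed

lemma open_indicator_approximation:
  fixes U :: "'e::polish_space set"
  assumes U: "open U"
  obtains G :: "nat \<Rightarrow> 'e \<Rightarrow> real" where "\<And>n. G n \<in> max_cones" "\<And>x. incseq (\<lambda>n. G n x)"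
    "\<And>n x. G n x \<le> indicator U x" "\<And>x. (\<lambda>n. G n x) \<longlonglongrightarrow> indicator U x"
proof (rule lower_semicontinuous_approximation[of "indicator U"])
  fix x :: 'e and s :: real assume s: "s < indicator U x"
  show "\<forall>\<^sub>F y in nhds x. s < indicator U y"
  proof (cases "s < 0")
    case True then show ?thesis by (auto simp: indicator_def intro!: always_eventually)
  next
    case False
    with s have "x \<in> U" "s < 1" by (cases "x \<in> U"; simp)+
    with U show ?thesis by (auto simp: eventually_nhds intro!: exI[of _ U])
  qed
qed auto

section \<open>The space of finite measures\<close>

lemma sets_meas [simp, measurable_cong]: "sets (meas \<eta>) = sets borel"
  and finite_measure_meas: "finite_measure (meas \<eta>)"
  using meas[of \<eta>] by auto

lemma space_meas [simp]: "space (meas \<eta>) = UNIV"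
  using sets_eq_imp_space_eq[OF sets_meas[of \<eta>]] by simp

lemma meas_zero [simp]: "meas 0 = null_measure borel"
  unfolding zero_fmeas_def by (rule Abs_fmeas_inverse) (auto intro!: finite_measureI)

text \<open>The unit mass at \<open>x\<close>. Evaluating Laplace functionals at it recovers cumulants pointwise.\<close>

definition dirac :: "'e::topological_space \<Rightarrow> 'e fmeas" where
  "dirac x = Abs_fmeas (return borel x)"

lemma meas_dirac [simp]: "meas (dirac x) = return borel x"
  unfolding dirac_def
  by (rule Abs_fmeas_inverse) (auto intro!: prob_space.finite_measure prob_space_return)

lemma bpBI: "f \<in> borel_measurable borel \<Longrightarrow> (\<And>x. 0 \<le> f x) \<Longrightarrow> (\<And>x. f x \<le> K) \<Longrightarrow> f \<in> bpB"
  unfolding bpB_def by (auto simp: bounded_iff intro!: exI[of _ K])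

lemma bpBD:
  assumes "f \<in> bpB"
  shows "f \<in> borel_measurable borel" "0 \<le> f x" "\<exists>K\<ge>0. \<forall>x. f x \<le> K"
proof -
  show "f \<in> borel_measurable borel" "0 \<le> f x" using assms by (auto simp: bpB_def)
  obtain K where "\<forall>y\<in>range f. norm y \<le> K" using assms unfolding bpB_def bounded_iff by blast
  then have K: "\<bar>f x\<bar> \<le> K" for x by simp
  have "f x \<le> max K 0" for x using abs_ge_self[of "f x"] K[of x] by linarith
  then show "\<exists>K\<ge>0. \<forall>x. f x \<le> K" by (intro exI[of _ "max K 0"]) auto
qed

lemma bpB_const: "0 \<le> c \<Longrightarrow> (\<lambda>_. c) \<in> bpB"
  by (auto intro: bpBI)

lemma bpB_add:
  assumes "f \<in> bpB" "g \<in> bpB"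
  shows "(\<lambda>x. f x + g x) \<in> bpB"
proof -
  obtain K L where "\<forall>x. f x \<le> K" "\<forall>x. g x \<le> L" using bpBD(3)[OF assms(1)] bpBD(3)[OF assms(2)] by blast
  then show ?thesis
    by (intro bpBI[where K = "K + L"] borel_measurable_add add_nonneg_nonneg add_mono)
      (auto intro: assms bpBD(1,2))
qed

lemma bpB_cmult:
  assumes "f \<in> bpB" "0 \<le> c"
  shows "(\<lambda>x. c * f x) \<in> bpB"
proof -
  obtain K where "\<forall>x. f x \<le> K" using bpBD(3)[OF assms(1)] by blast
  then show ?thesis using assms(2) bpBD(1,2)[OF assms(1)]
    by (intro bpBI[where K = "c * K"]) (auto intro!: mult_left_mono)
qed

lemma bpB_abs_diff:
  assumes "f \<in> bpB" "g \<in> bpB"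
  shows "(\<lambda>x. \<bar>f x - g x\<bar>) \<in> bpB"
proof -
  obtain K L where K: "\<forall>x. f x \<le> K" "\<forall>x. g x \<le> L"
    using bpBD(3)[OF assms(1)] bpBD(3)[OF assms(2)] by blast
  have [measurable]: "f \<in> borel_measurable borel" "g \<in> borel_measurable borel"
    using assms bpBD(1) by auto
  have "\<bar>f x - g x\<bar> \<le> K + L" for x
    using K[rule_format, of x] bpBD(2)[OF assms(1), of x] bpBD(2)[OF assms(2), of x] by auto
  then show ?thesis by (intro bpBI[where K = "K + L"]) auto
qed

lemma integrable_bounded_fmeas:
  fixes f :: "'e::topological_space \<Rightarrow> real"
  assumes "f \<in> borel_measurable borel" "\<And>x. \<bar>f x\<bar> \<le> K"
  shows "integrable (meas \<eta>) f"
proof -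
  interpret finite_measure "meas \<eta>" by (rule finite_measure_meas)
  show ?thesis using assms by (intro integrable_const_bound[where B = K]) auto
qed

lemma integrable_bpB:
  assumes "f \<in> bpB"
  shows "integrable (meas \<eta>) f"
proof -
  obtain K where "\<forall>x. f x \<le> K" using bpBD(3)[OF assms] by blast
  then show ?thesis using bpBD(1,2)[OF assms] by (intro integrable_bounded_fmeas[where K = K]) auto
qed

lemma fmint_nonneg: "f \<in> bpB \<Longrightarrow> 0 \<le> fmint \<eta> f"
  by (intro integral_nonneg_AE) (auto simp: bpBD(2))

lemma fmint_add: "f \<in> bpB \<Longrightarrow> g \<in> bpB \<Longrightarrow> fmint \<eta> (\<lambda>x. f x + g x) = fmint \<eta> f + fmint \<eta> g"
  by (intro Bochner_Integration.integral_add integrable_bpB)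

lemma fmint_mono: "f \<in> bpB \<Longrightarrow> g \<in> bpB \<Longrightarrow> (\<And>x. f x \<le> g x) \<Longrightarrow> fmint \<eta> f \<le> fmint \<eta> g"
  by (intro integral_mono integrable_bpB)

lemma fmint_dirac: "f \<in> borel_measurable borel \<Longrightarrow> fmint (dirac x) f = f x"
  by (simp add: integral_return)

lemma fmeas_eq_0_iff: "\<eta> = 0 \<longleftrightarrow> fmint \<eta> (\<lambda>_. 1) = 0"
proof
  interpret finite_measure "meas \<eta>" by (rule finite_measure_meas)
  assume "fmint \<eta> (\<lambda>_. 1) = 0"
  then have 0: "measure (meas \<eta>) UNIV = 0" by simp
  have "meas \<eta> = meas 0"
  proof (rule measure_eqI)
    fix A assume "A \<in> sets (meas \<eta>)"
    have "measure (meas \<eta>) A \<le> measure (meas \<eta>) UNIV" by (rule finite_measure_mono) auto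
    then show "emeasure (meas \<eta>) A = emeasure (meas 0) A"
      using 0 measure_nonneg[of "meas \<eta>" A] by (simp add: emeasure_eq_measure)
  qed simp
  then show "\<eta> = 0" by (simp only: meas_inject)
qed simp

lemma continuous_fmint:
  assumes "continuous_on UNIV f" "bounded (range f)"
  shows "continuous_on UNIV (\<lambda>\<eta>. fmint \<eta> f)"
proof -
  have "open ((\<lambda>\<eta>. fmint \<eta> f) -` U)" if "open U" for U
    unfolding open_fmeas_def by (rule generate_topology.Basis) (use assms that in blast)
  then show ?thesis by (simp add: continuous_on_open_vimage)
qed

lemma max_cones_bpB: "g \<in> max_cones \<Longrightarrow> g \<in> bpB"
  using max_cones_props[of g] by (auto intro!: bpBI borel_measurable_continuous_onI)

lemma bpB_bounded: "f \<in> bpB \<Longrightarrow> bounded (range f)"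
  by (auto simp: bpB_def)

lemma fmint_incseq_tendsto:
  assumes "\<And>n. G n \<in> bpB" "f \<in> bpB" "\<And>n x. G n x \<le> f x" "\<And>x. (\<lambda>n. G n x) \<longlonglongrightarrow> f x"
  shows "(\<lambda>n. fmint \<eta> (G n)) \<longlonglongrightarrow> fmint \<eta> f"
  by (rule integral_dominated_convergence[where w = f])
    (use assms in \<open>auto simp: bpBD(2) integrable_bpB intro: borel_measurable_integrable\<close>)

text \<open>The weak topology has a countable subbase: the sets \<open>{\<eta>. q < \<eta>(g)}\<close> with \<open>g\<close> a maximum of cones, which
  by monotone convergence generate \<open>{\<eta>. a < \<eta>(f)}\<close> for every continuous \<open>f \<ge> 0\<close>, together with upper bounds
  on the total mass, which are needed to pass to \<open>- f\<close>.\<close>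

instance fmeas :: (polish_space) second_countable_topology
proof
  define B :: "'a fmeas set set" where
    "B = (\<lambda>(g, q). {\<eta>. of_rat q < fmint \<eta> g}) ` (max_cones \<times> (UNIV :: rat set))
       \<union> (\<lambda>q. {\<eta>. fmint \<eta> (\<lambda>_. 1) < of_rat q}) ` (UNIV :: rat set)"
  have "countable B"
    unfolding B_def using countable_max_cones by (intro countable_Un countable_image countable_SIGMA) auto
  note GT = generate_topology.intros
  have pos: "generate_topology B {\<eta>. a < fmint \<eta> f}"
    if f: "continuous_on UNIV f" "f \<in> bpB" for f a
  proof -
    obtain G where G: "\<And>n. G n \<in> max_cones" "\<And>x. incseq (\<lambda>n. G n x)"
      "\<And>n x. G n x \<le> f x" "\<And>x. (\<lambda>n. G n x) \<longlonglongrightarrow> f x"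
    proof (rule lower_semicontinuous_approximation[of f])
      fix x s assume "s < f x"
      moreover have "(f \<longlongrightarrow> f x) (nhds x)"
        using f(1) by (simp add: continuous_on_eq_continuous_at isCont_def tendsto_at_iff_tendsto_nhds)
      ultimately show "\<forall>\<^sub>F y in nhds x. s < f y" by (intro order_tendstoD(1))
    qed (use f in \<open>auto simp: bpBD(2)\<close>)
    have "{\<eta>. a < fmint \<eta> f} = \<Union> ((\<lambda>(q, n). {\<eta>. of_rat q < fmint \<eta> (G n)}) ` ({q. a \<le> of_rat q} \<times> UNIV))" (is "?L = ?R")
    proof (intro set_eqI iffI)
      fix \<eta> assume "\<eta> \<in> ?L"
      then obtain q where q: "a < of_rat q" "of_rat q < fmint \<eta> f"
        using of_rat_dense[of a "fmint \<eta> f"] by auto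
      have "(\<lambda>n. fmint \<eta> (G n)) \<longlonglongrightarrow> fmint \<eta> f"
        using G f by (intro fmint_incseq_tendsto) (auto intro: max_cones_bpB)
      from order_tendstoD(1)[OF this q(2)] obtain n where "of_rat q < fmint \<eta> (G n)"
        by (auto simp: eventually_sequentially)
      with q(1) show "\<eta> \<in> ?R" by (intro UnionI[OF imageI[of "(q, n)"]]) auto
    next
      fix \<eta> assume "\<eta> \<in> ?R"
      then obtain q n where q: "a \<le> of_rat q" "of_rat q < fmint \<eta> (G n)" by auto
      have "fmint \<eta> (G n) \<le> fmint \<eta> f" using G f by (intro fmint_mono) (auto intro: max_cones_bpB)
      then show "\<eta> \<in> ?L" using q by simp
    qed
    moreover have "generate_topology B ?R"
      by (rule GT(3)) (use G(1) in \<open>auto intro!: GT(4) simp: B_def image_iff\<close>)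
    ultimately show ?thesis by simp
  qed
  have lower: "generate_topology B {\<eta>. a < fmint \<eta> f}"
    if f: "continuous_on UNIV f" "bounded (range f)" for f :: "'a \<Rightarrow> real" and a
  proof -
    obtain c where c: "c > 0" "\<And>x. \<bar>f x\<bar> \<le> c" using f(2) by (auto simp: bounded_pos)
    have fm: "f \<in> borel_measurable borel" using f(1) by (rule borel_measurable_continuous_onI)
    have fc: "- c \<le> f x" "f x \<le> c" for x using c(2)[of x] by auto
    have fcB: "(\<lambda>x. f x + c) \<in> bpB"
    proof (rule bpBI[where K = "2 * c"])
      show "0 \<le> f x + c" "f x + c \<le> 2 * c" for x using fc[of x] by linarith+
    qed (use fm in simp)
    have split: "fmint \<eta> (\<lambda>x. f x + c) = fmint \<eta> f + c * fmint \<eta> (\<lambda>_. 1)" for \<eta>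
    proof -
      have "fmint \<eta> (\<lambda>x. f x + c) = fmint \<eta> f + fmint \<eta> (\<lambda>_. c)"
        using fm c by (intro Bochner_Integration.integral_add integrable_bounded_fmeas[where K = c]) auto
      then show ?thesis by simp
    qed
    have "{\<eta>. a < fmint \<eta> f} =
        \<Union> (range (\<lambda>q. {\<eta>. fmint \<eta> (\<lambda>_. 1) < of_rat q} \<inter> {\<eta>. a + c * of_rat q < fmint \<eta> (\<lambda>x. f x + c)}))"
      (is "?L = ?R")
    proof (intro set_eqI iffI)
      fix \<eta> assume "\<eta> \<in> ?L"
      then have "fmint \<eta> (\<lambda>_. 1) < (fmint \<eta> (\<lambda>x. f x + c) - a) / c"
        unfolding split using c by (simp add: field_simps)
      from of_rat_dense[OF this] obtain q where "fmint \<eta> (\<lambda>_. 1) < of_rat q"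
        "of_rat q < (fmint \<eta> (\<lambda>x. f x + c) - a) / c" by blast
      then have "fmint \<eta> (\<lambda>_. 1) < of_rat q" "a + c * of_rat q < fmint \<eta> (\<lambda>x. f x + c)"
        using c by (simp_all add: field_simps)
      then show "\<eta> \<in> ?R" by blast
    next
      fix \<eta> assume "\<eta> \<in> ?R"
      then obtain q where q: "fmint \<eta> (\<lambda>_. 1) < of_rat q" "a + c * of_rat q < fmint \<eta> (\<lambda>x. f x + c)"
        by blast
      have "c * fmint \<eta> (\<lambda>_. 1) < c * of_rat q" by (rule mult_strict_left_mono[OF q(1) c(1)])
      with q(2) show "\<eta> \<in> ?L" unfolding split by simp
    qed
    moreover have "generate_topology B ?R"
    proof (rule GT(3))
      fix k assume "k \<in> range (\<lambda>q. {\<eta>. fmint \<eta> (\<lambda>_. 1) < of_rat q} \<inter> {\<eta>. a + c * of_rat q < fmint \<eta> (\<lambda>x. f x + c)})"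
      then obtain q where k: "k = {\<eta>. fmint \<eta> (\<lambda>_. 1) < of_rat q} \<inter> {\<eta>. a + c * of_rat q < fmint \<eta> (\<lambda>x. f x + c)}"
        by blast
      have "generate_topology B {\<eta>. fmint \<eta> (\<lambda>_. 1) < of_rat q}"
        unfolding B_def by (intro GT(4) UnI2 imageI UNIV_I)
      moreover have "generate_topology B {\<eta>. a + c * of_rat q < fmint \<eta> (\<lambda>x. f x + c)}"
        by (rule pos[OF _ fcB]) (intro continuous_intros f(1))
      ultimately show "generate_topology B k" unfolding k by (rule GT(2))
    qed
    ultimately show ?thesis by simp
  qed
  have upper: "generate_topology B {\<eta>. fmint \<eta> f < b}"
    if f: "continuous_on UNIV f" "bounded (range f)" for f :: "'a \<Rightarrow> real" and b
  proof -
    have "bounded (range (\<lambda>x. - f x))" using f(2) by (simp add: bounded_iff)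
    then have "generate_topology B {\<eta>. - b < fmint \<eta> (\<lambda>x. - f x)}"
      using f(1) by (intro lower continuous_intros)
    then show ?thesis by simp
  qed
  have "generate_topology B ((\<lambda>\<gamma>. fmint \<gamma> f) -` U)"
    if f: "continuous_on UNIV f" "bounded (range f)" and U: "open U" for f :: "'a \<Rightarrow> real" and U
  proof -
    have "(\<lambda>\<gamma>. fmint \<gamma> f) -` U =
      \<Union> ((\<lambda>(a, b). {\<eta>. a < fmint \<eta> f} \<inter> {\<eta>. fmint \<eta> f < b}) ` {(a, b). {a<..<b} \<subseteq> U})" (is "?L = ?R")
    proof (intro set_eqI iffI)
      fix \<eta> assume "\<eta> \<in> ?L"
      then obtain \<epsilon> where "\<epsilon> > 0" "ball (fmint \<eta> f) \<epsilon> \<subseteq> U" using U by (auto simp: open_contains_ball)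
      then have "{fmint \<eta> f - \<epsilon> <..< fmint \<eta> f + \<epsilon>} \<subseteq> U" "fmint \<eta> f - \<epsilon> < fmint \<eta> f"
        "fmint \<eta> f < fmint \<eta> f + \<epsilon>" by (auto simp: ball_eq_greaterThanLessThan)
      then show "\<eta> \<in> ?R"
        by (intro UnionI[OF imageI[of "(fmint \<eta> f - \<epsilon>, fmint \<eta> f + \<epsilon>)"]]) auto
    qed auto
    moreover have "generate_topology B ?R"
      by (rule GT(3)) (use lower[OF f] upper[OF f] in \<open>auto intro: GT(2)\<close>)
    ultimately show ?thesis by simp
  qed note basis = this
  have "open = generate_topology B"
  proof (intro ext iffI)
    fix S :: "'a fmeas set" assume "open S"
    then show "generate_topology B S" unfolding open_fmeas_def
      by (induction rule: generate_topology.induct) (auto intro: GT(1-3) basis)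
  next
    fix S :: "'a fmeas set" assume "generate_topology B S"
    then show "open S"
    proof (induction rule: generate_topology.induct)
      case (Basis s)
      have "continuous_on UNIV (\<lambda>\<eta>. fmint \<eta> g)" if "g \<in> max_cones" for g :: "'a \<Rightarrow> real"
        using that by (intro continuous_fmint max_cones_props(1) bpB_bounded max_cones_bpB)
      moreover have "continuous_on UNIV (\<lambda>\<eta> :: 'a fmeas. fmint \<eta> (\<lambda>_. 1))"
        by (rule continuous_fmint) auto
      ultimately show ?case using Basis unfolding B_def
        by (auto intro!: open_Collect_less continuous_on_const simp del: lebesgue_integral_const)
    qed auto
  qed
  with \<open>countable B\<close> show "\<exists>B :: 'a fmeas set set. countable B \<and> open = generate_topology B" by blast
qed

section \<open>Measurability of the evaluation maps\<close>

lemma measurable_fmint_continuous: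
  "continuous_on UNIV f \<Longrightarrow> bounded (range f) \<Longrightarrow> (\<lambda>\<eta>. fmint \<eta> f) \<in> borel_measurable borel"
  by (intro borel_measurable_continuous_onI continuous_fmint)

lemma measurable_emeasure_meas:
  fixes B :: "'e::polish_space set"
  assumes "B \<in> sets borel"
  shows "(\<lambda>\<eta>. emeasure (meas \<eta>) B) \<in> borel_measurable borel"
proof -
  have total: "(\<lambda>\<eta> :: 'e fmeas. emeasure (meas \<eta>) UNIV) \<in> borel_measurable borel"
  proof -
    have "(\<lambda>\<eta> :: 'e fmeas. ennreal (fmint \<eta> (\<lambda>_. 1))) \<in> borel_measurable borel"
      by (intro measurable_compose[OF _ measurable_ennreal] measurable_fmint_continuous) auto
    also have "(\<lambda>\<eta> :: 'e fmeas. ennreal (fmint \<eta> (\<lambda>_. 1))) = (\<lambda>\<eta>. emeasure (meas \<eta>) UNIV)"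
      by (simp add: finite_measure.emeasure_eq_measure[OF finite_measure_meas])
    finally show ?thesis .
  qed
  have B: "B \<in> sigma_sets UNIV {S. open S}" using assms by (simp add: sets_borel)
  have subset_Pow_UNIV: "{S :: 'e set. open S} \<subseteq> Pow UNIV" by simp
  have "Int_stable {S :: 'e set. open S}" by (auto simp: Int_stable_def)
  show ?thesis
    using \<open>Int_stable {S :: 'e set. open S}\<close> subset_Pow_UNIV B
  proof (induction rule: sigma_sets_induct_disjoint)
    case (basic U)
    define f :: "'e \<Rightarrow> real" where "f = indicator U"
    have U: "open U" using basic by simp
    have fB: "f \<in> bpB" using U by (intro bpBI[where K = 1]) (auto simp: f_def indicator_def)
    obtain G where G: "\<And>n. G n \<in> max_cones" "\<And>x. incseq (\<lambda>n. G n x)"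
      "\<And>n x. G n x \<le> f x" "\<And>x. (\<lambda>n. G n x) \<longlonglongrightarrow> f x"
      unfolding f_def using open_indicator_approximation[OF U] by blast
    have "(\<lambda>\<eta>. fmint \<eta> f) \<in> borel_measurable borel"
    proof (rule borel_measurable_LIMSEQ_metric)
      show "(\<lambda>\<eta>. fmint \<eta> (G n)) \<in> borel_measurable borel" for n
        using G(1) by (intro measurable_fmint_continuous max_cones_props(1) bpB_bounded max_cones_bpB)
      show "(\<lambda>n. fmint \<eta> (G n)) \<longlonglongrightarrow> fmint \<eta> f" for \<eta>
        using G fB by (intro fmint_incseq_tendsto) (auto intro: max_cones_bpB)
    qed
    then have "(\<lambda>\<eta>. ennreal (fmint \<eta> f)) \<in> borel_measurable borel" by simp
    also have "(\<lambda>\<eta>. ennreal (fmint \<eta> f)) = (\<lambda>\<eta>. emeasure (meas \<eta>) U)"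
      using U by (simp add: f_def finite_measure.emeasure_eq_measure[OF finite_measure_meas])
    finally show ?case .
  next
    case empty then show ?case by simp
  next
    case (compl A)
    have "emeasure (meas \<eta>) (UNIV - A) = emeasure (meas \<eta>) UNIV - emeasure (meas \<eta>) A" for \<eta> :: "'e fmeas"
      using compl(1) finite_measure.emeasure_finite[OF finite_measure_meas]
      by (intro emeasure_Diff) (auto simp: sets_borel)
    then show ?case using compl(2) total by simp
  next
    case (union A)
    have "emeasure (meas \<eta>) (\<Union>i. A i) = (\<Sum>i. emeasure (meas \<eta>) (A i))" for \<eta> :: "'e fmeas"
      using union(1,2) by (intro suminf_emeasure[symmetric]) (auto simp: sets_borel)
    then show ?case using union(3) by simp
  qed
qed

lemma measurable_nn_integral_meas:
  fixes f :: "'e::polish_space \<Rightarrow> ennreal"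
  assumes "f \<in> borel_measurable borel"
  shows "(\<lambda>\<eta>. \<integral>\<^sup>+x. f x \<partial>meas \<eta>) \<in> borel_measurable borel"
  using assms
proof (induction rule: borel_measurable_induct)
  case (cong f g)
  then have "f = g" by auto
  then show ?case using cong by simp
next
  case (set A) then show ?case by (simp add: measurable_emeasure_meas)
next
  case (mult u c)
  have "(\<integral>\<^sup>+x. c * u x \<partial>meas \<eta>) = c * (\<integral>\<^sup>+x. u x \<partial>meas \<eta>)" for \<eta> :: "'e fmeas"
    using mult by (intro nn_integral_cmult) simp
  then show ?case using mult by simp
next
  case (add u v)
  have "(\<integral>\<^sup>+x. v x + u x \<partial>meas \<eta>) = (\<integral>\<^sup>+x. v x \<partial>meas \<eta>) + (\<integral>\<^sup>+x. u x \<partial>meas \<eta>)" for \<eta> :: "'e fmeas"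
    using add by (intro nn_integral_add) auto
  then show ?case using add by simp
next
  case (seq U)
  have sup: "(SUP i. U i) = (\<lambda>x. SUP i. U i x)" by (auto simp: fun_eq_iff image_comp)
  have "(\<integral>\<^sup>+x. (SUP i. U i) x \<partial>meas \<eta>) = (SUP i. \<integral>\<^sup>+x. U i x \<partial>meas \<eta>)" for \<eta> :: "'e fmeas"
    unfolding sup using seq by (intro nn_integral_monotone_convergence_SUP) auto
  then show ?case using seq by simp
qed

lemma nn_integral_bpB:
  "f \<in> bpB \<Longrightarrow> (\<integral>\<^sup>+x. ennreal (f x) \<partial>meas \<eta>) = ennreal (fmint \<eta> f)"
  by (intro nn_integral_eq_integral integrable_bpB) (auto simp: bpBD(2))

lemma measurable_fmint [measurable (raw)]:
  fixes f :: "'e::polish_space \<Rightarrow> real"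
  assumes "f \<in> bpB"
  shows "(\<lambda>\<eta>. fmint \<eta> f) \<in> borel_measurable borel"
proof -
  have "(\<lambda>\<eta>. enn2real (\<integral>\<^sup>+x. ennreal (f x) \<partial>meas \<eta>)) \<in> borel_measurable borel"
    using measurable_nn_integral_meas[of "\<lambda>x. ennreal (f x)"] bpBD(1)[OF assms] by simp
  then show ?thesis using nn_integral_bpB[OF assms] fmint_nonneg[OF assms] by simp
qed

lemma sets_zero_fmeas [measurable]: "{0 :: 'e::polish_space fmeas} \<in> sets borel"
proof -
  have "(\<lambda>\<eta> :: 'e fmeas. fmint \<eta> (\<lambda>_. 1)) -` {0} \<inter> space borel \<in> sets borel"
    by (intro measurable_sets[OF measurable_fmint]) (auto intro: bpB_const)
  also have "(\<lambda>\<eta> :: 'e fmeas. fmint \<eta> (\<lambda>_. 1)) -` {0} \<inter> space borel = {0}"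
    using fmeas_eq_0_iff by auto
  finally show ?thesis .
qed

section \<open>Approximation by continuous functions\<close>

lemma integrable_finite_bounded:
  fixes f :: "'e::topological_space \<Rightarrow> real"
  assumes "finite_measure M" "sets M = sets borel" "f \<in> borel_measurable borel" "\<And>x. \<bar>f x\<bar> \<le> K"
  shows "integrable M f"
proof -
  interpret finite_measure M by fact
  have "f \<in> borel_measurable M" using assms(2,3) by (simp cong: measurable_cong_sets)
  then show ?thesis using assms(4) by (intro integrable_const_bound[where B = K]) auto
qed

lemma bpB_integrable_finite:
  assumes "finite_measure M" "sets M = sets borel" "f \<in> bpB"
  shows "integrable M f"
proof -
  obtain K where K: "\<forall>x. f x \<le> K" using bpBD(3)[OF assms(3)] by blast
  show ?thesis
    by (rule integrable_finite_bounded[OF assms(1,2) bpBD(1)[OF assms(3)], where K = K])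
      (use K bpBD(2)[OF assms(3)] in auto)
qed

lemma open_superset_approximation:
  fixes M :: "'e::polish_space measure"
  assumes M: "finite_measure M" "sets M = sets borel" and A: "A \<in> sets borel" and e: "0 < e"
  obtains U where "open U" "A \<subseteq> U" "measure M (U - A) < e"
proof -
  interpret finite_measure M by fact
  have "emeasure M A < emeasure M A + ennreal e"
    using e by (simp add: emeasure_eq_measure ennreal_plus[symmetric] ennreal_less_iff del: ennreal_plus)
  then have "(INF U\<in>{U. A \<subseteq> U \<and> open U}. emeasure M U) < emeasure M A + ennreal e"
    using outer_regular[OF M(2) _ A] by simp
  then obtain U where U: "A \<subseteq> U" "open U" "emeasure M U < emeasure M A + ennreal e"
    by (auto simp: INF_less_iff)
  have "measure M U < measure M A + e"
    using U(3) e by (simp add: emeasure_eq_measure ennreal_plus[symmetric] ennreal_less_iff del: ennreal_plus)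
  moreover have "measure M (U - A) = measure M U - measure M A"
    using U A M(2) by (intro finite_measure_Diff) auto
  ultimately show ?thesis using U by (intro that[of U]) auto
qed

text \<open>Continuous functions are dense in \<open>L\<^sup>1\<close> of two finite Borel measures at the same time.\<close>

lemma continuous_L1_approximation:
  fixes M N :: "'e::polish_space measure"
  assumes M: "finite_measure M" "sets M = sets borel" and N: "finite_measure N" "sets N = sets borel"
    and f: "f \<in> bpB" and e: "0 < e"
  obtains g where "continuous_on UNIV g" "g \<in> bpB"
    "(LINT x|M. \<bar>f x - g x\<bar>) < e" "(LINT x|N. \<bar>f x - g x\<bar>) < e"
proof -
  define close where "close L e f g \<longleftrightarrow> (LINT x|L. \<bar>f x - g x\<bar>) < e"
    for L :: "'e measure" and e and f g :: "'e \<Rightarrow> real"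
  have int: "integrable M h" "integrable N h" if "h \<in> bpB" for h
    using that M N bpB_integrable_finite by auto
  have tri: "close L e f h" if L: "L = M \<or> L = N" and B: "f \<in> bpB" "g \<in> bpB" "h \<in> bpB"
    and c: "close L (e / 2) f g" "close L (e / 2) g h" for L e f g h
  proof -
    have i: "integrable L (\<lambda>x. \<bar>f x - g x\<bar>)" "integrable L (\<lambda>x. \<bar>g x - h x\<bar>)" "integrable L (\<lambda>x. \<bar>f x - h x\<bar>)"
      using L B by (metis int bpB_abs_diff)+
    have "(LINT x|L. \<bar>f x - h x\<bar>) \<le> (LINT x|L. \<bar>f x - g x\<bar> + \<bar>g x - h x\<bar>)"
      using i by (intro integral_mono) auto
    also have "\<dots> < e" using c i by (simp add: close_def)
    finally show ?thesis by (simp add: close_def)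
  qed
  have limit: "\<exists>n. close M e f (G n) \<and> close N e f (G n)"
    if f: "f \<in> bpB" and G: "\<And>n. G n \<in> bpB" "\<And>n x. G n x \<le> f x" "\<And>x. (\<lambda>n. G n x) \<longlonglongrightarrow> f x"
      and e: "0 < e" for f G e
  proof -
    have ev: "\<forall>\<^sub>F n in sequentially. close L e f (G n)" if L: "L = M \<or> L = N" for L
    proof -
      have "(\<lambda>n. LINT x|L. \<bar>f x - G n x\<bar>) \<longlonglongrightarrow> (LINT x|L. 0)"
      proof (rule integral_dominated_convergence[where w = f])
        show "integrable L f" using L int[OF f] by auto
        show "(\<lambda>x. \<bar>f x - G n x\<bar>) \<in> borel_measurable L" for n
          using L int[OF bpB_abs_diff[OF f G(1)]] by auto
        show "AE x in L. (\<lambda>n. \<bar>f x - G n x\<bar>) \<longlonglongrightarrow> 0"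
        proof (rule AE_I2)
          fix x
          have "(\<lambda>n. \<bar>f x - G n x\<bar>) \<longlonglongrightarrow> \<bar>f x - f x\<bar>" by (intro tendsto_intros G)
          then show "(\<lambda>n. \<bar>f x - G n x\<bar>) \<longlonglongrightarrow> 0" by simp
        qed
        show "AE x in L. norm \<bar>f x - G n x\<bar> \<le> f x" for n
          using G(2) bpBD(2)[OF G(1)] by (intro AE_I2) (simp add: abs_of_nonneg)
      qed simp
      then show ?thesis using order_tendstoD(2)[of _ 0 sequentially e] e by (simp add: close_def)
    qed
    show ?thesis using eventually_happens[OF eventually_conj[OF ev[of M] ev[of N]]] by auto
  qed
  have "bounded (range f) \<longrightarrow>
      (\<forall>e>0. \<exists>g. continuous_on UNIV g \<and> g \<in> bpB \<and> close M e f g \<and> close N e f g)"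
    using bpBD(1,2)[OF f]
  proof (induction rule: borel_measurable_induct_real)
    case (set A)
    show ?case
    proof (intro impI allI)
      fix e :: real assume e: "0 < e"
      have A: "A \<in> sets borel" using set by simp
      obtain U where U: "open U" "A \<subseteq> U" "measure M (U - A) < e / 2"
        by (rule open_superset_approximation[OF M A half_gt_zero[OF e]])
      obtain V where V: "open V" "A \<subseteq> V" "measure N (V - A) < e / 2"
        by (rule open_superset_approximation[OF N A half_gt_zero[OF e]])
      define u :: "'e \<Rightarrow> real" where "u = indicator (U \<inter> V)"
      have uB: "u \<in> bpB" unfolding u_def using borel_open[OF open_Int[OF U(1) V(1)]]
        by (intro bpBI[where K = 1] borel_measurable_indicator) (auto simp: indicator_def)
      have iB: "(indicator A :: 'e \<Rightarrow> real) \<in> bpB"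
        using A by (intro bpBI[where K = 1]) (auto simp: indicator_def)
      have "(\<lambda>x. \<bar>indicator A x - u x\<bar>) = (indicator (U \<inter> V - A) :: 'e \<Rightarrow> real)"
        using U V by (auto simp: u_def indicator_def fun_eq_iff)
      moreover have "measure M (U \<inter> V - A) \<le> measure M (U - A)" "measure N (U \<inter> V - A) \<le> measure N (V - A)"
        using U V A M N by (auto intro!: finite_measure.finite_measure_mono)
      ultimately have 1: "close M (e / 2) (indicator A) u" "close N (e / 2) (indicator A) u"
        using U V A M(2) N(2) sets_eq_imp_space_eq[OF M(2)] sets_eq_imp_space_eq[OF N(2)]
        by (simp_all add: close_def)
      obtain G where G: "\<And>n. G n \<in> max_cones" "\<And>x. incseq (\<lambda>n. G n x)"
        "\<And>n x. G n x \<le> u x" "\<And>x. (\<lambda>n. G n x) \<longlonglongrightarrow> u x"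
        unfolding u_def using open_indicator_approximation[OF open_Int[OF U(1) V(1)]] by blast
      then obtain n where "close M (e / 2) u (G n)" "close N (e / 2) u (G n)"
        using limit[OF uB max_cones_bpB[OF G(1)] G(3,4) half_gt_zero[OF e]] by auto
      with 1 have "close M e (indicator A) (G n)" "close N e (indicator A) (G n)"
        using tri uB iB max_cones_bpB[OF G(1)] by blast+
      then show "\<exists>g. continuous_on UNIV g \<and> g \<in> bpB \<and> close M e (indicator A) g \<and> close N e (indicator A) g"
        using max_cones_bpB[OF G(1)] max_cones_props(1)[OF G(1)] by blast
    qed
  next
    case (mult u c)
    show ?case
    proof (intro impI allI)
      fix e :: real assume b: "bounded (range (\<lambda>x. c * u x))" and e: "0 < e"
      show "\<exists>g. continuous_on UNIV g \<and> g \<in> bpB \<and> close M e (\<lambda>x. c * u x) g \<and> close N e (\<lambda>x. c * u x) g"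
      proof (cases "c = 0")
        case True
        then show ?thesis using e by (intro exI[of _ "\<lambda>_. 0"]) (auto simp: close_def bpB_const)
      next
        case False
        have "bounded ((\<lambda>x. inverse c * x) ` range (\<lambda>x. c * u x))"
          using b by (intro bounded_linear_image bounded_linear_mult_right)
        then have "bounded (range u)" using False by (simp add: image_image field_simps)
        then obtain g where g: "continuous_on UNIV g" "g \<in> bpB" "close M (e / c) u g" "close N (e / c) u g"
          using mult.IH[rule_format, of "e / c"] mult.hyps(1) e False by auto
        have "c > 0" using False mult by simp
        then have "\<bar>c * u x - c * g x\<bar> = c * \<bar>u x - g x\<bar>" for x
          by (simp add: abs_mult flip: right_diff_distrib)
        then show ?thesis using g \<open>c > 0\<close>
          by (intro exI[of _ "\<lambda>x. c * g x"])
            (auto simp: close_def bpB_cmult field_simps intro!: continuous_intros)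
      qed
    qed
  next
    case (add u v)
    show ?case
    proof (intro impI allI)
      fix e :: real assume b: "bounded (range (\<lambda>x. v x + u x))" and e: "0 < e"
      obtain K where K: "\<And>x. \<bar>v x + u x\<bar> \<le> K" using b by (auto simp: bounded_iff)
      have uK: "u x \<le> K" "v x \<le> K" for x
        using K[of x] add.hyps(2)[of x] add.hyps(4)[of x] by auto
      have B: "u \<in> bpB" "v \<in> bpB" using uK add by (auto intro!: bpBI[where K = K])
      then obtain g h where g: "continuous_on UNIV g" "g \<in> bpB" "close M (e / 2) u g" "close N (e / 2) u g"
        and h: "continuous_on UNIV h" "h \<in> bpB" "close M (e / 2) v h" "close N (e / 2) v h"
        using add.IH(1)[rule_format, OF bpB_bounded[OF B(1)] half_gt_zero[OF e]]
          add.IH(2)[rule_format, OF bpB_bounded[OF B(2)] half_gt_zero[OF e]] by blast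
      have "close L e (\<lambda>x. v x + u x) (\<lambda>x. h x + g x)"
        if L: "L = M \<or> L = N" and c: "close L (e / 2) u g" "close L (e / 2) v h" for L
      proof -
        have i: "integrable L (\<lambda>x. \<bar>u x - g x\<bar>)" "integrable L (\<lambda>x. \<bar>v x - h x\<bar>)"
          "integrable L (\<lambda>x. \<bar>v x + u x - (h x + g x)\<bar>)"
          using L int bpB_abs_diff B g(2) h(2) bpB_add by auto
        have "(LINT x|L. \<bar>v x + u x - (h x + g x)\<bar>) \<le> (LINT x|L. \<bar>u x - g x\<bar> + \<bar>v x - h x\<bar>)"
          using i by (intro integral_mono) auto
        also have "\<dots> < e" using c i by (simp add: close_def)
        finally show ?thesis by (simp add: close_def)
      qed
      then show "\<exists>g. continuous_on UNIV g \<and> g \<in> bpB \<and> close M e (\<lambda>x. v x + u x) g \<and> close N e (\<lambda>x. v x + u x) g"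
        using g h by (intro exI[of _ "\<lambda>x. h x + g x"]) (auto intro!: continuous_intros bpB_add)
    qed
  next
    case (seq U)
    show ?case
    proof (intro impI allI)
      fix e :: real assume b: "bounded (range f)" and e: "0 < e"
      have le: "U i x \<le> f x" for i x
        using incseq_le[of "\<lambda>i. U i x" "f x" i] seq.hyps(3,4) by (auto simp: incseq_def le_fun_def)
      obtain K where K: "\<And>x. f x \<le> K" using bpBD(3)[OF f] by blast
      have UB: "U i \<in> bpB" for i
        using seq.hyps(1,2) order_trans[OF le K] by (intro bpBI[where K = K]) auto
      obtain n where n: "close M (e / 2) f (U n)" "close N (e / 2) f (U n)"
        using limit[of f U "e / 2", OF f UB le _ half_gt_zero[OF e]] seq.hyps(4) by auto
      obtain g where "continuous_on UNIV g" "g \<in> bpB" "close M (e / 2) (U n) g" "close N (e / 2) (U n) g"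
        using seq.IH[rule_format, OF bpB_bounded[OF UB] half_gt_zero[OF e]] by blast
      then show "\<exists>g. continuous_on UNIV g \<and> g \<in> bpB \<and> close M e f g \<and> close N e f g"
        using n tri f UB by blast
    qed
  qed
  then show ?thesis using that e bpB_bounded[OF f] unfolding close_def by blast
qed

section \<open>Laplace functionals determine weak convergence\<close>

text \<open>The algebra spanned by the exponentials \<open>x \<mapsto> exp (- \<Sum>\<^sub>j x\<^sub>j(f\<^sub>j))\<close> with bounded continuous
  \<open>f\<^sub>j \<ge> 0\<close>, as functions of a family \<open>x\<close> of finite measures indexed by \<open>J\<close>, and its uniform closure.\<close>

inductive_set Laplace_span :: "'i set \<Rightarrow> (('i \<Rightarrow> 'e::polish_space fmeas) \<Rightarrow> real) set" for J where
  exponential: "(\<And>j. j \<in> J \<Longrightarrow> f j \<in> bpB) \<Longrightarrow> (\<And>j. j \<in> J \<Longrightarrow> continuous_on UNIV (f j)) \<Longrightarrow>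
    (\<lambda>x. exp (- (\<Sum>j\<in>J. fmint (x j) (f j)))) \<in> Laplace_span J"
| add: "g \<in> Laplace_span J \<Longrightarrow> h \<in> Laplace_span J \<Longrightarrow> (\<lambda>x. g x + h x) \<in> Laplace_span J"
| cmult: "h \<in> Laplace_span J \<Longrightarrow> (\<lambda>x. c * h x) \<in> Laplace_span J"

definition Laplace_closure :: "'i set \<Rightarrow> (('i \<Rightarrow> 'e::polish_space fmeas) \<Rightarrow> real) set" where
  "Laplace_closure J = {h. \<forall>e>0. \<exists>g\<in>Laplace_span J. \<forall>x. \<bar>h x - g x\<bar> \<le> e}"

lemma Laplace_span_mult:
  assumes "g \<in> Laplace_span J" "h \<in> Laplace_span J"
  shows "(\<lambda>x. g x * h x) \<in> Laplace_span J"
  using assms(1)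
proof induction
  case (exponential f)
  note f = exponential
  from assms(2) show ?case
  proof induction
    case (exponential f')
    have "(\<lambda>x. exp (- (\<Sum>j\<in>J. fmint (x j) (\<lambda>y. f j y + f' j y)))) \<in> Laplace_span J"
      using f exponential by (intro Laplace_span.exponential bpB_add continuous_on_add)
    moreover have "(\<Sum>j\<in>J. fmint (x j) (\<lambda>y. f j y + f' j y)) =
        (\<Sum>j\<in>J. fmint (x j) (f j)) + (\<Sum>j\<in>J. fmint (x j) (f' j))" for x
      using f exponential by (subst sum.distrib[symmetric]) (auto intro!: sum.cong fmint_add)
    ultimately show ?case by (simp add: exp_add[symmetric])
  next
    case (add g h)
    then show ?case using Laplace_span.add[OF add.IH] by (simp add: distrib_left)
  next
    case (cmult h c)
    then show ?case using Laplace_span.cmult[OF cmult.IH, of c] by (simp add: algebra_simps)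
  qed
next
  case (add g g')
  then show ?case using Laplace_span.add[OF add.IH] by (simp add: distrib_right)
next
  case (cmult g c)
  then show ?case using Laplace_span.cmult[OF cmult.IH, of c] by (simp add: algebra_simps)
qed

lemma Laplace_span_const: "(\<lambda>x. c) \<in> Laplace_span J"
proof -
  have "(\<lambda>x. exp (- (\<Sum>j\<in>J. fmint (x j) (\<lambda>_. 0)))) \<in> Laplace_span J"
    by (intro Laplace_span.exponential) (auto intro: bpB_const)
  from Laplace_span.cmult[OF this, of c] show ?thesis by simp
qed

lemma Laplace_span_bounded:
  assumes "g \<in> Laplace_span J"
  shows "\<exists>K\<ge>0. \<forall>x. \<bar>g x\<bar> \<le> K"
  using assms
proof induction
  case (exponential f)
  have "0 \<le> (\<Sum>j\<in>J. fmint (x j) (f j))" for x using exponential by (intro sum_nonneg fmint_nonneg)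
  then show ?case by (intro exI[of _ 1]) auto
next
  case (add g h)
  then obtain K L where "0 \<le> K" "\<forall>x. \<bar>g x\<bar> \<le> K" "0 \<le> L" "\<forall>x. \<bar>h x\<bar> \<le> L" by blast
  then show ?case by (intro exI[of _ "K + L"]) (auto intro: order_trans[OF abs_triangle_ineq add_mono])
next
  case (cmult h c)
  then obtain K where "0 \<le> K" "\<forall>x. \<bar>h x\<bar> \<le> K" by blast
  then show ?case by (intro exI[of _ "\<bar>c\<bar> * K"]) (auto simp: abs_mult intro: mult_left_mono)
qed

lemma Laplace_span_measurable:
  assumes "g \<in> Laplace_span J"
  shows "g \<in> borel_measurable (PiM J (\<lambda>_. borel))"
  using assms
proof induction
  case (exponential f)
  have "(\<lambda>x. fmint (x j) (f j)) \<in> borel_measurable (PiM J (\<lambda>_. borel))" if "j \<in> J" for j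
    by (rule measurable_compose[OF measurable_component_singleton[OF that] measurable_fmint])
      (rule exponential(1)[OF that])
  then show ?case by measurable
qed simp_all

lemma Laplace_span_continuous:
  assumes "finite J" "g \<in> Laplace_span J"
  shows "continuous_map (product_topology (\<lambda>_. euclidean) J) euclideanreal g"
  using assms(2)
proof induction
  case (exponential f)
  have "continuous_map (product_topology (\<lambda>_. euclidean) J) euclideanreal (\<lambda>x. fmint (x j) (f j))" if "j \<in> J" for j
  proof -
    have "continuous_map euclidean euclideanreal (\<lambda>\<eta>. fmint \<eta> (f j))"
      using continuous_fmint[OF exponential(2)[OF that] bpB_bounded[OF exponential(1)[OF that]]] by simp
    from continuous_map_compose[OF continuous_map_product_projection[OF that] this]
    show ?thesis by (simp add: o_def)
  qed
  then have 1: "continuous_map (product_topology (\<lambda>_. euclidean) J) euclideanreal (\<lambda>x. - (\<Sum>j\<in>J. fmint (x j) (f j)))"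
    by (intro continuous_map_minus continuous_map_sum assms(1))
  have "continuous_map euclideanreal euclideanreal (exp :: real \<Rightarrow> real)" by (simp add: continuous_on_exp)
  from continuous_map_compose[OF 1 this] show ?case by (simp add: o_def)
next
  case (add g h) then show ?case by (intro continuous_map_add)
next
  case (cmult h c) then show ?case by (intro continuous_map_real_mult continuous_map_const[THEN iffD2]) auto
qed

lemma Laplace_closureI_span: "g \<in> Laplace_span J \<Longrightarrow> g \<in> Laplace_closure J"
  unfolding Laplace_closure_def by (auto intro!: bexI[of _ g])

lemma Laplace_closureD:
  "h \<in> Laplace_closure J \<Longrightarrow> 0 < e \<Longrightarrow> \<exists>g\<in>Laplace_span J. \<forall>x. \<bar>h x - g x\<bar> \<le> e"
  unfolding Laplace_closure_def by blast

lemma Laplace_closure_limit: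
  assumes "\<And>e. 0 < e \<Longrightarrow> \<exists>g\<in>Laplace_closure J. \<forall>x. \<bar>h x - g x\<bar> \<le> e"
  shows "h \<in> Laplace_closure J"
  unfolding Laplace_closure_def
proof (intro CollectI allI impI)
  fix e :: real assume "0 < e"
  then obtain g where g: "g \<in> Laplace_closure J" "\<And>x. \<bar>h x - g x\<bar> \<le> e / 2" using assms[of "e / 2"] by auto
  then obtain k where k: "k \<in> Laplace_span J" "\<And>x. \<bar>g x - k x\<bar> \<le> e / 2"
    using Laplace_closureD[OF g(1), of "e / 2"] \<open>0 < e\<close> by auto
  have "\<bar>h x - k x\<bar> \<le> e" for x using g(2)[of x] k(2)[of x] by linarith
  with k(1) show "\<exists>g\<in>Laplace_span J. \<forall>x. \<bar>h x - g x\<bar> \<le> e" by blast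
qed

lemma Laplace_closure_bounded:
  assumes "h \<in> Laplace_closure J"
  shows "\<exists>K>0. \<forall>x. \<bar>h x\<bar> \<le> K"
proof -
  obtain g where g: "g \<in> Laplace_span J" "\<And>x. \<bar>h x - g x\<bar> \<le> 1" using Laplace_closureD[OF assms, of 1] by auto
  obtain K where K: "0 \<le> K" "\<And>x. \<bar>g x\<bar> \<le> K" using Laplace_span_bounded[OF g(1)] by auto
  have "\<bar>h x\<bar> \<le> K + 1" for x using g(2)[of x] K(2)[of x] by linarith
  then show ?thesis using K(1) by (intro exI[of _ "K + 1"]) auto
qed

lemma Laplace_closure_measurable:
  assumes "h \<in> Laplace_closure J"
  shows "h \<in> borel_measurable (PiM J (\<lambda>_. borel))"
proof -
  have "\<exists>g. g \<in> Laplace_span J \<and> (\<forall>x. \<bar>h x - g x\<bar> \<le> inverse (real (Suc n)))" for n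
    using Laplace_closureD[OF assms, of "inverse (real (Suc n))"] by auto
  then obtain g where g: "\<And>n. g n \<in> Laplace_span J" "\<And>n x. \<bar>h x - g n x\<bar> \<le> inverse (real (Suc n))"
    by metis
  show ?thesis
  proof (rule borel_measurable_LIMSEQ_metric)
    show "g n \<in> borel_measurable (PiM J (\<lambda>_. borel))" for n by (rule Laplace_span_measurable[OF g(1)])
    fix x
    have "(\<lambda>n. g n x - h x) \<longlonglongrightarrow> 0"
      by (rule Lim_null_comparison[OF _ LIMSEQ_inverse_real_of_nat])
        (use g(2)[of x] in \<open>auto simp: abs_minus_commute\<close>)
    then show "(\<lambda>n. g n x) \<longlonglongrightarrow> h x" by (simp add: LIM_zero_iff)
  qed
qed

lemma Laplace_closure_add:
  assumes "g \<in> Laplace_closure J" "h \<in> Laplace_closure J"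
  shows "(\<lambda>x. g x + h x) \<in> Laplace_closure J"
  unfolding Laplace_closure_def
proof (intro CollectI allI impI)
  fix e :: real assume e: "0 < e"
  obtain g' where g: "g' \<in> Laplace_span J" "\<And>x. \<bar>g x - g' x\<bar> \<le> e / 2" using Laplace_closureD[OF assms(1), of "e / 2"] e by auto
  obtain h' where h: "h' \<in> Laplace_span J" "\<And>x. \<bar>h x - h' x\<bar> \<le> e / 2" using Laplace_closureD[OF assms(2), of "e / 2"] e by auto
  have "\<bar>g x + h x - (g' x + h' x)\<bar> \<le> e" for x using g(2)[of x] h(2)[of x] by linarith
  then show "\<exists>k\<in>Laplace_span J. \<forall>x. \<bar>g x + h x - k x\<bar> \<le> e"
    by (intro bexI[OF _ Laplace_span.add[OF g(1) h(1)]] allI)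
qed

lemma Laplace_closure_mult:
  assumes "g \<in> Laplace_closure J" "h \<in> Laplace_closure J"
  shows "(\<lambda>x. g x * h x) \<in> Laplace_closure J"
  unfolding Laplace_closure_def
proof (intro CollectI allI impI)
  fix e :: real assume e: "0 < e"
  obtain K where K: "0 < K" "\<And>x. \<bar>g x\<bar> \<le> K" using Laplace_closure_bounded[OF assms(1)] by auto
  have "0 < e / (2 * K)" using e K by simp
  then obtain h' where h: "h' \<in> Laplace_span J" "\<And>x. \<bar>h x - h' x\<bar> \<le> e / (2 * K)"
    using Laplace_closureD[OF assms(2)] by blast
  obtain L where L: "0 \<le> L" "\<And>x. \<bar>h' x\<bar> \<le> L" using Laplace_span_bounded[OF h(1)] by auto
  have "0 < e / (2 * (L + 1))" using e L by simp
  then obtain g' where g: "g' \<in> Laplace_span J" "\<And>x. \<bar>g x - g' x\<bar> \<le> e / (2 * (L + 1))"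
    using Laplace_closureD[OF assms(1)] by blast
  have "\<bar>g x * h x - g' x * h' x\<bar> \<le> e" for x
  proof -
    have "\<bar>g x * h x - g' x * h' x\<bar> \<le> \<bar>g x * (h x - h' x)\<bar> + \<bar>(g x - g' x) * h' x\<bar>"
      by (rule order_trans[OF eq_refl abs_triangle_ineq]) (simp add: algebra_simps)
    also have "\<dots> \<le> K * (e / (2 * K)) + e / (2 * (L + 1)) * (L + 1)"
      unfolding abs_mult using K h(2)[of x] g(2)[of x] L e order_trans[OF L(2)[of x], of "L + 1"]
      by (intro add_mono mult_mono) auto
    also have "\<dots> = e" using K L by (simp add: field_simps)
    finally show ?thesis .
  qed
  then show "\<exists>k\<in>Laplace_span J. \<forall>x. \<bar>g x * h x - k x\<bar> \<le> e"
    by (intro bexI[OF _ Laplace_span_mult[OF g(1) h(1)]] allI)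
qed

lemma Laplace_closure_const: "(\<lambda>x. c) \<in> Laplace_closure J"
  by (intro Laplace_closureI_span Laplace_span_const)

lemma Laplace_closure_cmult: "h \<in> Laplace_closure J \<Longrightarrow> (\<lambda>x. c * h x) \<in> Laplace_closure J"
  by (intro Laplace_closure_mult Laplace_closure_const)

lemma Laplace_closure_diff: "g \<in> Laplace_closure J \<Longrightarrow> h \<in> Laplace_closure J \<Longrightarrow> (\<lambda>x. g x - h x) \<in> Laplace_closure J"
  using Laplace_closure_add[of g J "\<lambda>x. - 1 * h x"] Laplace_closure_cmult[of h J "- 1"] by simp

lemma Laplace_closure_power: "h \<in> Laplace_closure J \<Longrightarrow> (\<lambda>x. h x ^ n) \<in> Laplace_closure J"
  by (induction n) (auto intro: Laplace_closure_const Laplace_closure_mult)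

lemma Laplace_closure_sum:
  "(\<And>k. k \<in> A \<Longrightarrow> h k \<in> Laplace_closure J) \<Longrightarrow> (\<lambda>x. \<Sum>k\<in>A. h k x) \<in> Laplace_closure J"
  by (induction A rule: infinite_finite_induct) (auto intro: Laplace_closure_const Laplace_closure_add)

lemma Laplace_closure_prod:
  "(\<And>k. k \<in> A \<Longrightarrow> h k \<in> Laplace_closure J) \<Longrightarrow> (\<lambda>x. \<Prod>k\<in>A. h k x) \<in> Laplace_closure J"
  by (induction A rule: infinite_finite_induct) (auto intro: Laplace_closure_const Laplace_closure_mult)

text \<open>A uniformly closed algebra of bounded functions is a lattice, because \<open>\<bar>z\<bar>\<close> is a uniform limit of
  polynomials on compact intervals.\<close>

lemma Laplace_closure_abs:
  assumes h: "h \<in> Laplace_closure J"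
  shows "(\<lambda>x. \<bar>h x\<bar>) \<in> Laplace_closure J"
proof -
  obtain K where K: "0 < K" "\<And>x. \<bar>h x\<bar> \<le> K" using Laplace_closure_bounded[OF h] by auto
  define u where "u = (\<lambda>x. 1 / (2 * K) * h x + 1 / 2)"
  have u: "u \<in> Laplace_closure J" unfolding u_def
    by (intro Laplace_closure_add Laplace_closure_cmult Laplace_closure_const h)
  have u01: "u x \<in> {0..1}" for x using K(1) K(2)[of x] by (auto simp: u_def field_simps abs_le_iff)
  define \<rho> :: "real \<Rightarrow> real" where "\<rho> = (\<lambda>z. K * \<bar>2 * z - 1\<bar>)"
  have \<rho>u: "\<rho> (u x) = \<bar>h x\<bar>" for x
    using K(1) by (simp add: \<rho>_def u_def abs_mult abs_divide)
  show ?thesis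
  proof (rule Laplace_closure_limit)
    fix e :: real assume e: "0 < e"
    have "continuous_on {0..1} \<rho>" unfolding \<rho>_def by (intro continuous_intros)
    then obtain N where N: "\<And>n x. N \<le> n \<Longrightarrow> x \<in> {0..1} \<Longrightarrow> \<bar>\<rho> x - (\<Sum>k\<le>n. \<rho> (k / n) * Bernstein n k x)\<bar> < e"
      using Bernstein_Weierstrass[of \<rho> e] e by blast
    have p: "(\<lambda>x. \<Sum>k\<le>N. \<rho> (k / N) * Bernstein N k (u x)) \<in> Laplace_closure J"
      unfolding Bernstein_def
      by (intro Laplace_closure_sum Laplace_closure_mult Laplace_closure_power Laplace_closure_diff Laplace_closure_const u)
    have "\<bar>\<bar>h x\<bar> - (\<Sum>k\<le>N. \<rho> (k / N) * Bernstein N k (u x))\<bar> \<le> e" for x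
      using N[OF order_refl u01[of x]] unfolding \<rho>u by (rule less_imp_le)
    then show "\<exists>g\<in>Laplace_closure J. \<forall>x. \<bar>\<bar>h x\<bar> - g x\<bar> \<le> e"
      by (intro bexI[OF _ p] allI)
  qed
qed

lemma Laplace_closure_max:
  assumes "g \<in> Laplace_closure J" "h \<in> Laplace_closure J"
  shows "(\<lambda>x. max (g x) (h x)) \<in> Laplace_closure J"
proof -
  have "(\<lambda>x. 1 / 2 * (g x + h x + \<bar>g x - h x\<bar>)) \<in> Laplace_closure J"
    by (intro Laplace_closure_cmult Laplace_closure_add Laplace_closure_abs Laplace_closure_diff assms)
  moreover have "(\<lambda>x. 1 / 2 * (g x + h x + \<bar>g x - h x\<bar>)) = (\<lambda>x. max (g x) (h x))"
    by (auto simp: fun_eq_iff max_def)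
  ultimately show ?thesis by simp
qed

lemma Laplace_closure_coordinate:
  assumes "finite J" "j \<in> J" "f \<in> bpB" "continuous_on UNIV f"
  shows "(\<lambda>x. exp (- fmint (x j) f)) \<in> Laplace_closure J"
proof -
  have "(\<lambda>x. exp (- (\<Sum>i\<in>J. fmint (x i) (if i = j then f else (\<lambda>_. 0))))) \<in> Laplace_span J"
    using assms by (intro Laplace_span.exponential) (auto intro: bpB_const)
  moreover have "(\<Sum>i\<in>J. fmint (x i) (if i = j then f else (\<lambda>_. 0))) = fmint (x j) f" for x
  proof -
    have "(\<Sum>i\<in>J. fmint (x i) (if i = j then f else (\<lambda>_. 0))) = (\<Sum>i\<in>J. if i = j then fmint (x j) f else 0)"
      by (intro sum.cong) auto
    then show ?thesis using assms by (simp add: sum.delta)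
  qed
  ultimately show ?thesis by (auto intro: Laplace_closureI_span)
qed

text \<open>The closed algebra contains bump functions that are 1 at a given point and vanish off a given
  neighbourhood, first for neighbourhoods described by a single coordinate.\<close>

lemma Laplace_closure_coordinate_bump:
  fixes U :: "'e::polish_space fmeas set"
  assumes J: "finite J" "j \<in> J" and U: "open U" "\<theta> \<in> U"
  shows "\<exists>h\<in>Laplace_closure J. \<forall>x. 0 \<le> h x \<and> h x \<le> 1 \<and> (x j \<notin> U \<longrightarrow> h x = 0) \<and> (x j = \<theta> \<longrightarrow> h x = 1)"
  using U[unfolded open_fmeas_def]
proof (induction rule: generate_topology.induct)
  case UNIV
  then show ?case by (intro bexI[OF _ Laplace_closure_const[of 1]]) auto
next
  case (Int A B)
  then obtain g h where g: "g \<in> Laplace_closure J" "\<And>x. 0 \<le> g x \<and> g x \<le> 1 \<and> (x j \<notin> A \<longrightarrow> g x = 0) \<and> (x j = \<theta> \<longrightarrow> g x = 1)"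
    and h: "h \<in> Laplace_closure J" "\<And>x. 0 \<le> h x \<and> h x \<le> 1 \<and> (x j \<notin> B \<longrightarrow> h x = 0) \<and> (x j = \<theta> \<longrightarrow> h x = 1)"
    by blast
  have "0 \<le> g x * h x \<and> g x * h x \<le> 1 \<and> (x j \<notin> A \<inter> B \<longrightarrow> g x * h x = 0) \<and> (x j = \<theta> \<longrightarrow> g x * h x = 1)" for x
    using g(2)[of x] h(2)[of x] mult_mono[of "g x" 1 "h x" 1] by auto
  then show ?case by (intro bexI[OF _ Laplace_closure_mult[OF g(1) h(1)]]) blast
next
  case (UN K)
  then obtain A where A: "A \<in> K" "\<theta> \<in> A" by blast
  from UN.IH[OF this] obtain h where "h \<in> Laplace_closure J"
    "\<forall>x. 0 \<le> h x \<and> h x \<le> 1 \<and> (x j \<notin> A \<longrightarrow> h x = 0) \<and> (x j = \<theta> \<longrightarrow> h x = 1)" by blast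
  then show ?case using A by (intro bexI[of _ h]) auto
next
  case (Basis S)
  then obtain f V where S: "S = (\<lambda>\<gamma>. fmint \<gamma> f) -` V" and f: "continuous_on UNIV f" "bounded (range f)" and V: "open V"
    by blast
  obtain c where c: "c > 0" "\<And>x. \<bar>f x\<bar> \<le> c" using f(2) by (auto simp: bounded_pos)
  have fm: "f \<in> borel_measurable borel" using f(1) by (rule borel_measurable_continuous_onI)
  \<comment> \<open>\<open>f\<close> may be negative, so its integral is written as the difference of those of \<open>f + c\<close> and \<open>c\<close>\<close>
  define g where "g = (\<lambda>x. f x + c)"
  have gB: "g \<in> bpB"
  proof (rule bpBI[where K = "2 * c"])
    show "0 \<le> g x" "g x \<le> 2 * c" for x using c(2)[of x] by (auto simp: g_def abs_le_iff)
  qed (use fm in \<open>simp add: g_def\<close>)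
  have cB: "(\<lambda>_. c) \<in> bpB" using c by (intro bpB_const) simp
  have gcont: "continuous_on UNIV g" unfolding g_def by (intro continuous_intros f)
  have split: "fmint \<gamma> f = fmint \<gamma> g - fmint \<gamma> (\<lambda>_. c)" for \<gamma>
  proof -
    have "fmint \<gamma> g = fmint \<gamma> f + fmint \<gamma> (\<lambda>_. c)" unfolding g_def
      using fm c by (intro Bochner_Integration.integral_add integrable_bounded_fmeas[where K = c]) auto
    then show ?thesis by simp
  qed
  define a where "a = (\<lambda>\<gamma> :: 'e fmeas. exp (- fmint \<gamma> g))"
  define b where "b = (\<lambda>\<gamma> :: 'e fmeas. exp (- fmint \<gamma> (\<lambda>_. c)))"
  have ab: "fmint \<gamma> f = ln (b \<gamma>) - ln (a \<gamma>)" for \<gamma> by (simp add: split a_def b_def)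
  have pos: "0 < a \<gamma>" "0 < b \<gamma>" for \<gamma> by (simp_all add: a_def b_def)
  have "((\<lambda>p. ln (snd p) - ln (fst p)) \<longlongrightarrow> ln (b \<theta>) - ln (a \<theta>)) (at (a \<theta>, b \<theta>))"
    using pos[of \<theta>] by (auto intro!: tendsto_eq_intros)
  moreover have "ln (b \<theta>) - ln (a \<theta>) \<in> V" using Basis(2) ab[of \<theta>] S by simp
  ultimately have "\<forall>\<^sub>F p in at (a \<theta>, b \<theta>). ln (snd p) - ln (fst p) \<in> V"
    by (intro topological_tendstoD[OF _ V])
  then obtain d where d: "0 < d" "\<And>p. p \<noteq> (a \<theta>, b \<theta>) \<Longrightarrow> dist p (a \<theta>, b \<theta>) < d \<Longrightarrow> ln (snd p) - ln (fst p) \<in> V"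
    by (auto simp: eventually_at)
  have near: "\<gamma> \<in> S" if "\<bar>a \<gamma> - a \<theta>\<bar> + \<bar>b \<gamma> - b \<theta>\<bar> < d" for \<gamma>
  proof (cases "(a \<gamma>, b \<gamma>) = (a \<theta>, b \<theta>)")
    case True
    then have "fmint \<gamma> f = fmint \<theta> f" unfolding ab by simp
    then show ?thesis using Basis(2) S by simp
  next
    case False
    have "dist (a \<gamma>, b \<gamma>) (a \<theta>, b \<theta>) \<le> \<bar>a \<gamma> - a \<theta>\<bar> + \<bar>b \<gamma> - b \<theta>\<bar>"
      unfolding dist_prod_def by (simp add: dist_real_def sqrt_sum_squares_le_sum_abs)
    then have "ln (b \<gamma>) - ln (a \<gamma>) \<in> V" using d(2)[OF False] that by simp
    then show ?thesis unfolding S ab[symmetric] by simp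
  qed
  define h where "h = (\<lambda>x :: 'a \<Rightarrow> 'e fmeas. max 0 (1 - 1 / d * (\<bar>a (x j) - a \<theta>\<bar> + \<bar>b (x j) - b \<theta>\<bar>)))"
  have "h \<in> Laplace_closure J"
    unfolding h_def
    by (intro Laplace_closure_max Laplace_closure_diff Laplace_closure_cmult Laplace_closure_add
        Laplace_closure_abs Laplace_closure_const)
      (auto simp: a_def b_def simp del: lebesgue_integral_const
        intro!: Laplace_closure_coordinate J gB cB gcont)
  moreover have "0 \<le> h x \<and> h x \<le> 1 \<and> (x j \<notin> S \<longrightarrow> h x = 0) \<and> (x j = \<theta> \<longrightarrow> h x = 1)" for x
  proof (intro conjI impI)
    show "0 \<le> h x" by (simp add: h_def)
    show "h x \<le> 1" using d(1) by (simp add: h_def)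
    show "h x = 1" if "x j = \<theta>" using that by (simp add: h_def)
    assume "x j \<notin> S"
    then have "d \<le> \<bar>a (x j) - a \<theta>\<bar> + \<bar>b (x j) - b \<theta>\<bar>" using near[of "x j"] by force
    then have "1 \<le> 1 / d * (\<bar>a (x j) - a \<theta>\<bar> + \<bar>b (x j) - b \<theta>\<bar>)" using d(1) by (simp add: field_simps)
    then show "h x = 0" by (simp add: h_def)
  qed
  ultimately show ?case by blast
qed

lemma openin_product_box:
  assumes "openin (product_topology (\<lambda>_. euclidean) J) U" "z \<in> U"
  shows "\<exists>A. (\<forall>j\<in>J. open (A j)) \<and> z \<in> PiE J A \<and> PiE J A \<subseteq> U"
proof -
  obtain A where "\<forall>j\<in>J. openin euclidean (A j)" "z \<in> PiE J A" "PiE J A \<subseteq> U"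
    using bspec[OF assms(1)[unfolded openin_product_topology_alt] assms(2)] by (elim exE conjE)
  then show ?thesis by (intro exI[of _ A]) (simp add: open_openin[symmetric])
qed

lemma Laplace_closure_bump:
  fixes z :: "'i \<Rightarrow> 'e::polish_space fmeas"
  assumes J: "finite J" and U: "openin (product_topology (\<lambda>_. euclidean) J) U" "z \<in> U"
  shows "\<exists>h\<in>Laplace_closure J. h z = 1 \<and> (\<forall>x. h x \<le> 1) \<and> (\<forall>x\<in>PiE J (\<lambda>_. UNIV). x \<notin> U \<longrightarrow> h x = 0)"
proof -
  obtain A where A: "\<And>j. j \<in> J \<Longrightarrow> open (A j)" "z \<in> PiE J A" "PiE J A \<subseteq> U"
    using openin_product_box[OF U] by blast
  have "\<exists>h. h \<in> Laplace_closure J \<and> (\<forall>x. 0 \<le> h x \<and> h x \<le> 1 \<and> (x j \<notin> A j \<longrightarrow> h x = 0) \<and> (x j = z j \<longrightarrow> h x = 1))"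
    if "j \<in> J" for j
    using Laplace_closure_coordinate_bump[OF J that A(1)[OF that], of "z j"] A(2) that by auto
  then obtain h where h: "\<And>j. j \<in> J \<Longrightarrow> h j \<in> Laplace_closure J"
    "\<And>j x. j \<in> J \<Longrightarrow> 0 \<le> h j x \<and> h j x \<le> 1 \<and> (x j \<notin> A j \<longrightarrow> h j x = 0) \<and> (x j = z j \<longrightarrow> h j x = 1)"
    by metis
  show ?thesis
  proof (intro bexI[of _ "\<lambda>x. \<Prod>j\<in>J. h j x"] conjI allI ballI impI)
    show "(\<Prod>j\<in>J. h j z) = 1" using h(2) by (intro prod.neutral) auto
    show "(\<Prod>j\<in>J. h j x) \<le> 1" for x using h(2) by (intro prod_le_1) auto
    fix x assume x: "x \<in> PiE J (\<lambda>_. UNIV)" "x \<notin> U"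
    have "x \<notin> PiE J A" using A(3) x(2) by blast
    then obtain j where "j \<in> J" "x j \<notin> A j" using x(1) by (auto simp: PiE_iff)
    then show "(\<Prod>j\<in>J. h j x) = 0" using h(2)[of j x] J by (intro prod_zero) auto
  qed (intro Laplace_closure_prod h(1))
qed

lemma Laplace_closure_lower_approximation:
  fixes f :: "('i \<Rightarrow> 'e::polish_space fmeas) \<Rightarrow> real"
  assumes J: "finite J" and f: "continuous_map (product_topology (\<lambda>_. euclidean) J) euclideanreal f"
    and f0: "\<And>x. x \<in> PiE J (\<lambda>_. UNIV) \<Longrightarrow> 0 \<le> f x"
  obtains G where "\<And>n. G n \<in> Laplace_closure J" "\<And>x. incseq (\<lambda>n. G n x)"
    "\<And>n x. x \<in> PiE J (\<lambda>_. UNIV) \<Longrightarrow> G n x \<le> f x" "\<And>x. x \<in> PiE J (\<lambda>_. UNIV) \<Longrightarrow> (\<lambda>n. G n x) \<longlonglongrightarrow> f x"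
proof -
  note result = that
  let ?T = "product_topology (\<lambda>_. euclidean :: 'e fmeas topology) J"
  have top: "topspace ?T = PiE J (\<lambda>_. UNIV)" by simp
  obtain \<B> :: "'e fmeas set set" where \<B>: "countable \<B>" "topological_basis \<B>" using ex_countable_basis by blast
  define good where "good = (\<lambda>(A, q :: rat) h. h \<in> Laplace_closure J \<and> (\<forall>x\<in>PiE J (\<lambda>_. UNIV). h x \<le> f x) \<and>
    (\<forall>x\<in>PiE J A. of_rat q < h x))"
  \<comment> \<open>one function for each basic box and each rational level suffices\<close>
  define C where "C = insert (\<lambda>_. 0) ((\<lambda>p. SOME h. good p h) ` {p \<in> PiE J (\<lambda>_. \<B>) \<times> (UNIV :: rat set). \<exists>h. good p h})"
  have "countable (PiE J (\<lambda>_. \<B>) \<times> (UNIV :: rat set))"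
    using J \<B>(1) by (intro countable_SIGMA countable_PiE) auto
  then have "countable {p \<in> PiE J (\<lambda>_. \<B>) \<times> (UNIV :: rat set). \<exists>h. good p h}"
    by (rule countable_subset[rotated]) auto
  then have cC: "countable C" "C \<noteq> {}" unfolding C_def by auto
  have CH: "C \<subseteq> Laplace_closure J" and Cf: "\<And>g x. g \<in> C \<Longrightarrow> x \<in> PiE J (\<lambda>_. UNIV) \<Longrightarrow> g x \<le> f x"
  proof -
    have "g \<in> Laplace_closure J \<and> (\<forall>x\<in>PiE J (\<lambda>_. UNIV). g x \<le> f x)" if g: "g \<in> C" for g
    proof (cases "g = (\<lambda>_. 0)")
      case True then show ?thesis using Laplace_closure_const[of 0] f0 by simp
    next
      case False
      then obtain p where p: "\<exists>h. good p h" "g = (SOME h. good p h)" using g by (auto simp: C_def)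
      then have "good p g" using someI_ex[OF p(1)] by simp
      then show ?thesis by (cases p) (simp add: good_def)
    qed
    then show "C \<subseteq> Laplace_closure J" "\<And>g x. g \<in> C \<Longrightarrow> x \<in> PiE J (\<lambda>_. UNIV) \<Longrightarrow> g x \<le> f x" by blast+
  qed
  have dense: "\<exists>g\<in>C. s < g z" if z: "z \<in> PiE J (\<lambda>_. UNIV)" and s: "s < f z" for z s
  proof (cases "s < 0")
    case True then show ?thesis by (auto simp: C_def)
  next
    case False
    obtain q where q: "s < of_rat q" "of_rat q < f z" using of_rat_dense[OF s] by blast
    obtain r where r: "of_rat q < r" "r < f z" using dense[OF q(2)] by blast
    have r0: "0 < r" using False q r by linarith
    have "openin ?T {x \<in> topspace ?T. f x \<in> {r<..}}"
      using f by (rule openin_continuous_map_preimage) auto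
    then obtain h where h: "h \<in> Laplace_closure J" "h z = 1" "\<And>x. h x \<le> 1"
      "\<And>x. x \<in> PiE J (\<lambda>_. UNIV) \<Longrightarrow> \<not> r < f x \<Longrightarrow> h x = 0"
      using Laplace_closure_bump[OF J, of "{x \<in> topspace ?T. f x \<in> {r<..}}" z] z r unfolding top by auto
    define k where "k = (\<lambda>x. r * h x)"
    have k: "k \<in> Laplace_closure J" unfolding k_def by (rule Laplace_closure_cmult[OF h(1)])
    have kf: "k x \<le> f x" if x: "x \<in> PiE J (\<lambda>_. UNIV)" for x
    proof (cases "r < f x")
      case True
      have "k x \<le> r * 1" unfolding k_def using h(3) r0 by (intro mult_left_mono) auto
      then show ?thesis using True by simp
    next
      case False
      then show ?thesis using h(4)[OF x] f0[OF x] by (simp add: k_def)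
    qed
    define e where "e = (r - of_rat q) / 3"
    have e: "0 < e" using r by (simp add: e_def)
    obtain g where g: "g \<in> Laplace_span J" "\<And>x. \<bar>k x - g x\<bar> \<le> e" using Laplace_closureD[OF k e] by blast
    let ?S = "{x \<in> topspace ?T. g x \<in> {of_rat q + e<..}}"
    have "openin ?T ?S"
      using Laplace_span_continuous[OF J g(1)] by (rule openin_continuous_map_preimage) auto
    moreover have "z \<in> ?S"
    proof -
      have "k z = r" using h(2) by (simp add: k_def)
      then have "r - e \<le> g z" using g(2)[of z] by (simp add: abs_le_iff)
      then have "of_rat q + e < g z" using e by (simp add: e_def field_simps)
      then show ?thesis using z by (simp add: top)
    qed
    ultimately obtain A where A: "\<And>j. j \<in> J \<Longrightarrow> open (A j)" "z \<in> PiE J A" "PiE J A \<subseteq> ?S"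
      using openin_product_box[of J ?S z] by blast
    have "\<exists>B. B \<in> \<B> \<and> z j \<in> B \<and> B \<subseteq> A j" if "j \<in> J" for j
      using topological_basisE[OF \<B>(2) A(1)[OF that], of "z j"] A(2) that by (metis PiE_mem)
    then obtain B where B: "\<And>j. j \<in> J \<Longrightarrow> B j \<in> \<B> \<and> z j \<in> B j \<and> B j \<subseteq> A j" by metis
    define B' where "B' = restrict B J"
    have B': "B' \<in> PiE J (\<lambda>_. \<B>)" "z \<in> PiE J B'"
      using B z by (auto simp: B'_def PiE_iff extensional_def)
    have B'A: "PiE J B' \<subseteq> PiE J A" by (rule PiE_mono) (use B in \<open>auto simp: B'_def\<close>)
    have "of_rat q < k x" if "x \<in> PiE J B'" for x
    proof -
      have "of_rat q + e < g x" using subsetD[OF A(3) subsetD[OF B'A that]] by blast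
      then show ?thesis using g(2)[of x] by (simp add: abs_le_iff)
    qed
    then have ex: "\<exists>h. good (B', q) h" using k kf unfolding good_def by auto
    define l where "l = (SOME h. good (B', q) h)"
    have "good (B', q) l" unfolding l_def by (rule someI_ex[OF ex])
    then have "of_rat q < l z" using B'(2) by (simp add: good_def)
    moreover have "l \<in> C" unfolding C_def l_def using B'(1) ex by (intro insertI2 imageI) simp
    ultimately show ?thesis using q(1) by (intro bexI[of _ l]) auto
  qed
  show ?thesis
  proof (rule increasing_max_approximation[of C "Laplace_closure J" "PiE J (\<lambda>_. UNIV)" f])
    show "(\<lambda>x. max (g x) (h x)) \<in> Laplace_closure J" if "g \<in> Laplace_closure J" "h \<in> Laplace_closure J" for g h
      using that by (rule Laplace_closure_max)
    show "g x \<le> f x" if "g \<in> C" "x \<in> PiE J (\<lambda>_. UNIV)" for g x using that by (rule Cf)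
    show "\<exists>g\<in>C. s < g x" if "x \<in> PiE J (\<lambda>_. UNIV)" "s < f x" for x s using that by (rule dense)
    show thesis if "\<And>n. G n \<in> Laplace_closure J" "\<And>x. incseq (\<lambda>n. G n x)"
      "\<And>n x. x \<in> PiE J (\<lambda>_. UNIV) \<Longrightarrow> G n x \<le> f x"
      "\<And>x. x \<in> PiE J (\<lambda>_. UNIV) \<Longrightarrow> (\<lambda>n. G n x) \<longlonglongrightarrow> f x" for G
      using that by (rule result)
  qed (fact cC CH)+
qed

text \<open>If the Laplace functionals converge, then so do the integrals of all functions in the closed
  algebra; a bounded continuous function is, up to an additive constant, an increasing
  limit of such functions, and so is its negative.\<close>

lemma Laplace_weak_convergence:
  fixes Ms :: "'t \<Rightarrow> ('i \<Rightarrow> 'e::polish_space fmeas) measure" and M :: "('i \<Rightarrow> 'e fmeas) measure"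
  assumes J: "finite J"
    and Ms: "\<forall>\<^sub>F t in F. prob_space (Ms t)" "\<And>t. sets (Ms t) = sets (PiM J (\<lambda>_. borel))"
    and M: "prob_space M" "sets M = sets (PiM J (\<lambda>_. borel))"
    and lim: "\<And>f. (\<And>j. j \<in> J \<Longrightarrow> f j \<in> bpB) \<Longrightarrow>
      ((\<lambda>t. LINT x|Ms t. exp (- (\<Sum>j\<in>J. fmint (x j) (f j)))) \<longlongrightarrow> (LINT x|M. exp (- (\<Sum>j\<in>J. fmint (x j) (f j))))) F"
  shows "weakly_converges (product_topology (\<lambda>_. euclidean) J) Ms M F"
proof -
  let ?T = "product_topology (\<lambda>_. euclidean :: 'e fmeas topology) J"
  have int: "integrable L h" if L: "prob_space L" "sets L = sets (PiM J (\<lambda>_. borel))" and h: "h \<in> Laplace_closure J"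
    for L :: "('i \<Rightarrow> 'e fmeas) measure" and h
  proof -
    interpret prob_space L by fact
    obtain K where K: "\<And>x. \<bar>h x\<bar> \<le> K" using Laplace_closure_bounded[OF h] by auto
    have "h \<in> borel_measurable L" using Laplace_closure_measurable[OF h] L(2) by (simp cong: measurable_cong_sets)
    then show ?thesis using K by (intro integrable_const_bound[where B = K]) auto
  qed
  have span: "((\<lambda>t. LINT x|Ms t. g x) \<longlongrightarrow> (LINT x|M. g x)) F" if "g \<in> Laplace_span J" for g
    using that
  proof induction
    case (exponential f) then show ?case by (intro lim)
  next
    case (add g h)
    have "((\<lambda>t. (LINT x|Ms t. g x) + (LINT x|Ms t. h x)) \<longlongrightarrow> (LINT x|M. g x) + (LINT x|M. h x)) F"
      by (intro tendsto_add add.IH)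
    moreover have "\<forall>\<^sub>F t in F. (LINT x|Ms t. g x) + (LINT x|Ms t. h x) = (LINT x|Ms t. g x + h x)"
      using Ms(1)
    proof eventually_elim
      case (elim t)
      show ?case using int[OF elim Ms(2)] add(1,2) Laplace_closureI_span
        by (subst Bochner_Integration.integral_add) auto
    qed
    moreover have "(LINT x|M. g x + h x) = (LINT x|M. g x) + (LINT x|M. h x)"
      using int[OF M] add(1,2) Laplace_closureI_span by (subst Bochner_Integration.integral_add) auto
    ultimately show ?case by (simp add: tendsto_cong)
  next
    case (cmult h c) then show ?case by (auto intro!: tendsto_mult)
  qed
  have closure: "((\<lambda>t. LINT x|Ms t. h x) \<longlongrightarrow> (LINT x|M. h x)) F" if h: "h \<in> Laplace_closure J" for h
  proof (rule tendstoI)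
    fix e :: real assume e: "0 < e"
    obtain g where g: "g \<in> Laplace_span J" "\<And>x. \<bar>h x - g x\<bar> \<le> e / 4" using Laplace_closureD[OF h, of "e / 4"] e by auto
    have close: "\<bar>(LINT x|L. h x) - (LINT x|L. g x)\<bar> \<le> e / 4"
      if L: "prob_space L" "sets L = sets (PiM J (\<lambda>_. borel))" for L :: "('i \<Rightarrow> 'e fmeas) measure"
    proof -
      interpret prob_space L by fact
      note i = int[OF L h] int[OF L Laplace_closureI_span[OF g(1)]]
      have "\<bar>(LINT x|L. h x) - (LINT x|L. g x)\<bar> = \<bar>LINT x|L. h x - g x\<bar>" using i by simp
      also have "\<dots> \<le> (LINT x|L. \<bar>h x - g x\<bar>)" by (rule integral_abs_bound)
      also have "\<dots> \<le> (LINT x|L. e / 4)" using g(2) i by (intro integral_mono) auto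
      finally show ?thesis by (simp add: prob_space)
    qed
    have "\<forall>\<^sub>F t in F. \<bar>(LINT x|Ms t. g x) - (LINT x|M. g x)\<bar> < e / 4"
      using tendstoD[OF span[OF g(1)], of "e / 4"] e by (simp add: dist_real_def)
    with Ms(1) show "\<forall>\<^sub>F t in F. dist (LINT x|Ms t. h x) (LINT x|M. h x) < e"
    proof eventually_elim
      case (elim t)
      show ?case using close[OF elim(1) Ms(2)] close[OF M] elim(2) e unfolding dist_real_def by linarith
    qed
  qed
  have lower: "\<forall>\<^sub>F t in F. (LINT x|M. f x) - e < (LINT x|Ms t. f x)"
    if f: "continuous_map ?T euclideanreal f" "\<And>x. x \<in> PiE J (\<lambda>_. UNIV) \<Longrightarrow> \<bar>f x\<bar> \<le> K" and e: "0 < e" for f K e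
  proof -
    have K0: "0 \<le> f x + K" if "x \<in> PiE J (\<lambda>_. UNIV)" for x using f(2)[OF that] by (simp add: abs_le_iff)
    have fK: "continuous_map ?T euclideanreal (\<lambda>x. f x + K)"
      using f(1) by (intro continuous_map_add) auto
    obtain G where G: "\<And>n. G n \<in> Laplace_closure J" "\<And>x. incseq (\<lambda>n. G n x)"
      "\<And>n x. x \<in> PiE J (\<lambda>_. UNIV) \<Longrightarrow> G n x \<le> f x + K"
      "\<And>x. x \<in> PiE J (\<lambda>_. UNIV) \<Longrightarrow> (\<lambda>n. G n x) \<longlonglongrightarrow> f x + K"
      using Laplace_closure_lower_approximation[OF J fK K0] by blast
    interpret M: prob_space M by fact
    obtain K' where K': "\<And>x. \<bar>G 0 x\<bar> \<le> K'" using Laplace_closure_bounded[OF G(1)[of 0]] by auto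
    have sp: "space L = PiE J (\<lambda>_. UNIV)" if "sets L = sets (PiM J (\<lambda>_. borel :: 'e fmeas measure))" for L
      using sets_eq_imp_space_eq[OF that] by (simp add: space_PiM)
    have fint: "integrable L f" if L: "prob_space L" "sets L = sets (PiM J (\<lambda>_. borel))" for L :: "('i \<Rightarrow> 'e fmeas) measure"
    proof -
      interpret prob_space L by fact
      have "(\<lambda>x. f x + K) \<in> borel_measurable L"
        by (rule borel_measurable_LIMSEQ_metric[where f = G])
          (use G(4) int[OF L G(1)] sp[OF L(2)] in auto)
      then have "(\<lambda>x. f x + K - K) \<in> borel_measurable L" by (rule borel_measurable_diff) simp
      then show ?thesis using f(2) sp[OF L(2)] by (intro integrable_const_bound[where B = K]) auto
    qed
    have "(\<lambda>n. LINT x|M. G n x) \<longlonglongrightarrow> (LINT x|M. f x + K)"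
    proof (rule integral_dominated_convergence[where w = "\<lambda>_. max K' (2 * K)"])
      interpret prob_space M by fact
      show "(\<lambda>x. f x + K) \<in> borel_measurable M" using fint[OF M] by simp
      show "G n \<in> borel_measurable M" for n using int[OF M G(1)] by simp
      show "integrable M (\<lambda>_. max K' (2 * K))" by simp
      show "AE x in M. (\<lambda>n. G n x) \<longlonglongrightarrow> f x + K" using G(4) sp[OF M(2)] by (intro AE_I2) simp
      show "AE x in M. norm (G n x) \<le> max K' (2 * K)" for n
      proof (rule AE_I2)
        fix x assume "x \<in> space M"
        then have x: "x \<in> PiE J (\<lambda>_. UNIV)" by (simp add: sp[OF M(2)])
        have "G 0 x \<le> G n x" using incseqD[OF G(2)] by simp
        then show "norm (G n x) \<le> max K' (2 * K)"
          using K'[of x] G(3)[OF x, of n] f(2)[OF x] by (auto simp: abs_le_iff le_max_iff_disj)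
      qed
    qed
    then have "\<forall>\<^sub>F n in sequentially. (LINT x|M. f x + K) - e < (LINT x|M. G n x)"
      using e by (intro order_tendstoD) auto
    then obtain n where n: "(LINT x|M. f x + K) - e < (LINT x|M. G n x)" using eventually_happens by force
    from order_tendstoD(1)[OF closure[OF G(1)[of n]] n] Ms(1)
    show ?thesis
    proof eventually_elim
      case (elim t)
      interpret L: prob_space "Ms t" by fact
      have "(LINT x|Ms t. G n x) \<le> (LINT x|Ms t. f x + K)"
        using int[OF elim(2) Ms(2) G(1)] fint[OF elim(2) Ms(2)] G(3) sp[OF Ms(2)]
        by (intro integral_mono) auto
      also have "\<dots> = (LINT x|Ms t. f x) + K" using fint[OF elim(2) Ms(2)] by (simp add: L.prob_space)
      finally have "(LINT x|Ms t. G n x) \<le> (LINT x|Ms t. f x) + K" .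
      moreover have "(LINT x|M. f x + K) = (LINT x|M. f x) + K"
        using fint[OF M] M.prob_space by simp
      ultimately show ?case using elim(1) by linarith
    qed
  qed
  show ?thesis
    unfolding weakly_converges_def
  proof (intro allI impI, elim conjE)
    fix f assume f: "continuous_map ?T euclideanreal f" "bounded (f ` topspace ?T)"
    obtain K where "\<forall>y\<in>f ` topspace ?T. norm y \<le> K" using f(2) unfolding bounded_iff by blast
    then have K: "\<bar>f x\<bar> \<le> K" if "x \<in> PiE J (\<lambda>_. UNIV)" for x using that by simp
    show "((\<lambda>t. LINT x|Ms t. f x) \<longlongrightarrow> (LINT x|M. f x)) F"
    proof (rule tendstoI)
      fix e :: real assume e: "0 < e"
      have "continuous_map ?T euclideanreal (\<lambda>x. - f x)" using f(1) by (rule continuous_map_minus)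
      moreover have "\<bar>- f x\<bar> \<le> K" if "x \<in> PiE J (\<lambda>_. UNIV)" for x using K[OF that] by simp
      ultimately have "\<forall>\<^sub>F t in F. (LINT x|M. - f x) - e < (LINT x|Ms t. - f x)" using e by (rule lower)
      moreover have "\<forall>\<^sub>F t in F. (LINT x|M. f x) - e < (LINT x|Ms t. f x)"
        by (rule lower[OF f(1) _ e]) (rule K)
      ultimately show "\<forall>\<^sub>F t in F. dist (LINT x|Ms t. f x) (LINT x|M. f x) < e"
        by eventually_elim (auto simp: dist_real_def abs_less_iff)
    qed
  qed
qed

section \<open>Comparison of the cumulant semigroup with the spatial motion\<close>

text \<open>The action \<open>P\<^sub>t f\<close> of the transition kernels on functions.\<close>

abbreviation kernel_int :: "(real \<Rightarrow> 'e \<Rightarrow> 'e measure) \<Rightarrow> real \<Rightarrow> ('e \<Rightarrow> real) \<Rightarrow> 'e \<Rightarrow> real" where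
  "kernel_int P t f x \<equiv> (LINT y|P t x. f y)"

lemma transition_kernel:
  assumes "transition_semigroup P" "0 \<le> t"
  shows "P t \<in> borel \<rightarrow>\<^sub>M subprob_algebra borel" "subprob_space (P t x)" "sets (P t x) = sets borel"
    "space (P t x) = UNIV"
proof -
  show 1: "P t \<in> borel \<rightarrow>\<^sub>M subprob_algebra borel" using assms by (auto simp: transition_semigroup_def)
  from subprob_measurableD[OF 1, of x]
  show "sets (P t x) = sets borel" "space (P t x) = UNIV" by auto
  show "subprob_space (P t x)" using measurable_space[OF 1, of x] by (simp add: space_subprob_algebra)
qed

lemma integrable_kernel:
  assumes "transition_semigroup P" "0 \<le> t" "f \<in> bpB"
  shows "integrable (P t x) f"
proof -
  interpret subprob_space "P t x" using transition_kernel(2)[OF assms(1,2)] .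
  obtain K where K: "\<forall>x. f x \<le> K" using bpBD(3)[OF assms(3)] by blast
  have "f \<in> borel_measurable (P t x)"
    using bpBD(1)[OF assms(3)] transition_kernel(3)[OF assms(1,2)] by (simp cong: measurable_cong_sets)
  then show ?thesis
    using K bpBD(2)[OF assms(3)] by (intro integrable_const_bound[where B = K]) auto
qed

lemma nn_integral_kernel:
  assumes "transition_semigroup P" "0 \<le> t" "f \<in> bpB"
  shows "(\<integral>\<^sup>+y. ennreal (f y) \<partial>P t x) = ennreal (kernel_int P t f x)"
  by (intro nn_integral_eq_integral integrable_kernel assms) (auto simp: bpBD(2)[OF assms(3)])

lemma kernel_int_bounds:
  assumes "transition_semigroup P" "0 \<le> t" "f \<in> bpB"
  shows "0 \<le> kernel_int P t f x" "(\<And>y. f y \<le> K) \<Longrightarrow> 0 \<le> K \<Longrightarrow> kernel_int P t f x \<le> K"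
proof -
  interpret subprob_space "P t x" using transition_kernel(2)[OF assms(1,2)] .
  show "0 \<le> kernel_int P t f x" by (intro integral_nonneg_AE) (auto simp: bpBD(2)[OF assms(3)])
  assume K: "\<And>y. f y \<le> K" "0 \<le> K"
  have "kernel_int P t f x \<le> (LINT y|P t x. K)"
    using K by (intro integral_mono integrable_kernel assms bpB_const) auto
  also have "\<dots> \<le> K" using K(2) mult_left_le_one_le[OF K(2) measure_nonneg subprob_measure_le_1] by simp
  finally show "kernel_int P t f x \<le> K" .
qed

lemma kernel_int_bpB:
  assumes "transition_semigroup P" "0 \<le> t" "f \<in> bpB"
  shows "kernel_int P t f \<in> bpB"
proof -
  obtain K where K: "0 \<le> K" "\<forall>x. f x \<le> K" using bpBD(3)[OF assms(3)] by blast
  have "(\<lambda>x. \<integral>\<^sup>+y. ennreal (f y) \<partial>P t x) \<in> borel_measurable borel"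
    using bpBD(1)[OF assms(3)]
    by (intro measurable_compose[OF transition_kernel(1)[OF assms(1,2)] nn_integral_measurable_subprob_algebra]) simp
  then have "(\<lambda>x. enn2real (ennreal (kernel_int P t f x))) \<in> borel_measurable borel"
    unfolding nn_integral_kernel[OF assms] by measurable
  then show ?thesis using kernel_int_bounds[OF assms] K
    by (intro bpBI[where K = K]) auto
qed

lemma kernel_int_mono:
  assumes "transition_semigroup P" "0 \<le> t" "f \<in> bpB" "g \<in> bpB" "\<And>x. f x \<le> g x"
  shows "kernel_int P t f x \<le> kernel_int P t g x"
  using assms by (intro integral_mono integrable_kernel) auto

lemma kernel_int_kernel_int:
  assumes P: "transition_semigroup P" and st: "0 \<le> s" "0 \<le> t" and f: "f \<in> bpB"
  shows "kernel_int P s (kernel_int P t f) x = kernel_int P (s + t) f x"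
proof -
  have eq: "P (s + t) x = P s x \<bind> P t"
  proof (rule measure_eqI)
    have s: "sets (P s x \<bind> P t) = sets borel"
      using transition_kernel(3)[OF P st(2)] transition_kernel(4)[OF P st(1)]
      by (intro sets_bind) auto
    then show "sets (P (s + t) x) = sets (P s x \<bind> P t)"
      using transition_kernel(3)[OF P] st by simp
    fix A assume "A \<in> sets (P (s + t) x)"
    then have A: "A \<in> sets borel" using transition_kernel(3)[OF P, of "s + t" x] st by simp
    have m: "P t \<in> P s x \<rightarrow>\<^sub>M subprob_algebra borel"
      using transition_kernel(1)[OF P st(2)] transition_kernel(3)[OF P st(1)]
      by (simp cong: measurable_cong_sets)
    have "emeasure (P s x \<bind> P t) A = (\<integral>\<^sup>+y. emeasure (P t y) A \<partial>P s x)"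
      using transition_kernel(4)[OF P st(1)] by (intro emeasure_bind[OF _ m A]) auto
    then show "emeasure (P (s + t) x) A = emeasure (P s x \<bind> P t) A"
      using P st A by (simp add: transition_semigroup_def)
  qed
  have m: "P t \<in> P s x \<rightarrow>\<^sub>M subprob_algebra borel"
    using transition_kernel(1)[OF P st(2)] transition_kernel(3)[OF P st(1)]
    by (simp cong: measurable_cong_sets)
  have "ennreal (kernel_int P (s + t) f x) = (\<integral>\<^sup>+z. (\<integral>\<^sup>+y. ennreal (f y) \<partial>P t z) \<partial>P s x)"
    using nn_integral_kernel[OF P add_nonneg_nonneg[OF st] f, of x] bpBD(1)[OF f]
      nn_integral_bind[OF _ m, of "\<lambda>y. ennreal (f y)"] by (simp add: eq)
  also have "\<dots> = ennreal (kernel_int P s (kernel_int P t f) x)"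
    unfolding nn_integral_kernel[OF P st(2) f]
    by (rule nn_integral_kernel[OF P st(1) kernel_int_bpB[OF P st(2) f]])
  finally show ?thesis
    using kernel_int_bounds(1)[OF P st(1) kernel_int_bpB[OF P st(2) f]]
      kernel_int_bounds(1)[OF P add_nonneg_nonneg[OF st] f] by simp
qed

lemma branching_mechanism_lower:
  assumes b: "\<And>x. \<bar>\<beta> x\<bar> \<le> b" and \<pi>: "\<And>x. sets (\<pi> x) = sets (restrict_space borel {0<..})" and z: "0 \<le> z"
  shows "- b * z \<le> branching_mechanism \<beta> \<sigma> \<pi> x z"
proof -
  have "0 \<le> (LINT u|\<pi> x. exp (- z * u) - 1 + z * u)"
  proof (rule integral_nonneg_AE, rule AE_I2)
    fix u show "0 \<le> exp (- z * u) - 1 + z * u"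
      using exp_ge_add_one_self[of "- z * u"] by simp
  qed
  moreover have "\<beta> x * z \<le> b * z" using b[of x] z by (intro mult_right_mono) auto
  moreover have "0 \<le> (\<sigma> x)\<^sup>2 * z\<^sup>2" by simp
  ultimately show ?thesis unfolding branching_mechanism_def by linarith
qed

lemma exp_minus_remainder:
  fixes z u :: real
  assumes "0 \<le> z" "0 \<le> u"
  shows "exp (- z * u) - 1 + z * u \<le> (z + z\<^sup>2) * min u (u\<^sup>2)"
proof -
  define a where "a = z * u"
  have a: "0 \<le> a" using assms by (simp add: a_def)
  have "exp (- a) * (1 + a) \<le> exp (- a) * exp a" using exp_ge_add_one_self[of a] by simp
  then have e: "exp (- a) * (1 + a) \<le> 1" by (simp add: exp_minus_inverse flip: exp_add)
  have "1 \<le> (1 - a + a\<^sup>2) * (1 + a)" using a by (simp add: algebra_simps power2_eq_square)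
  with e have "exp (- a) * (1 + a) \<le> (1 - a + a\<^sup>2) * (1 + a)" by linarith
  then have 1: "exp (- a) \<le> 1 - a + a\<^sup>2" using a by simp
  have 2: "exp (- a) - 1 + a \<le> a" using a by simp
  have "a \<le> (z + z\<^sup>2) * u" "a\<^sup>2 \<le> (z + z\<^sup>2) * u\<^sup>2"
    using assms by (simp_all add: a_def algebra_simps power_mult_distrib)
  then have "exp (- a) - 1 + a \<le> (z + z\<^sup>2) * u" "exp (- a) - 1 + a \<le> (z + z\<^sup>2) * u\<^sup>2"
    using 1 2 by linarith+
  then show ?thesis by (simp add: min_def a_def)
qed

lemma branching_mechanism_upper:
  assumes "branching_data \<beta> \<sigma> \<pi>" "0 \<le> K"
  obtains C where "0 \<le> C" "\<And>x z. 0 \<le> z \<Longrightarrow> z \<le> K \<Longrightarrow> branching_mechanism \<beta> \<sigma> \<pi> x z \<le> C * z"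
proof -
  obtain b where b: "\<And>x. \<bar>\<beta> x\<bar> \<le> b" using assms(1) by (auto simp: branching_data_def bounded_iff)
  obtain s where s: "\<And>x. \<bar>\<sigma> x\<bar> \<le> s" using assms(1) by (auto simp: branching_data_def bounded_iff)
  define m where "m = (SUP x. \<integral>\<^sup>+u. ennreal (min u (u\<^sup>2)) \<partial>\<pi> x)"
  have m: "m < \<infinity>" using assms(1) by (auto simp: branching_data_def m_def)
  have sets: "sets (\<pi> x) = sets (restrict_space borel {0<..})" for x
    using assms(1) by (auto simp: branching_data_def)
  have space: "space (\<pi> x) = {0<..}" for x
    using sets_eq_imp_space_eq[OF sets[of x]] by simp
  define C where "C = b + s\<^sup>2 * K + (1 + K) * enn2real m"
  have b0: "0 \<le> b" "0 \<le> s" using b s by (meson abs_ge_zero order_trans)+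
  show ?thesis
  proof (rule that[of C])
    show "0 \<le> C" using b0 assms(2) by (simp add: C_def)
    fix x z assume z: "0 \<le> z" "z \<le> K"
    have zz: "z\<^sup>2 \<le> K * z" using z by (simp add: power2_eq_square mult_right_mono)
    let ?g = "\<lambda>u. exp (- z * u) - 1 + z * u"
    have g0: "0 \<le> ?g u" for u using exp_ge_add_one_self[of "- z * u"] by simp
    have I: "(LINT u|\<pi> x. ?g u) \<le> (1 + K) * enn2real m * z"
    proof (cases "integrable (\<pi> x) ?g")
      case True
      have "ennreal (LINT u|\<pi> x. ?g u) = (\<integral>\<^sup>+u. ennreal (?g u) \<partial>\<pi> x)"
        using True g0 by (intro nn_integral_eq_integral[symmetric]) auto
      also have "\<dots> \<le> (\<integral>\<^sup>+u. ennreal (z + z\<^sup>2) * ennreal (min u (u\<^sup>2)) \<partial>\<pi> x)"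
      proof (rule nn_integral_mono)
        fix u assume "u \<in> space (\<pi> x)"
        then have "0 \<le> u" by (simp add: space)
        then show "ennreal (?g u) \<le> ennreal (z + z\<^sup>2) * ennreal (min u (u\<^sup>2))"
          using exp_minus_remainder[OF z(1), of u] z
            by (simp add: ennreal_mult[symmetric] del: ennreal_plus)
      qed
      also have "\<dots> = ennreal (z + z\<^sup>2) * (\<integral>\<^sup>+u. ennreal (min u (u\<^sup>2)) \<partial>\<pi> x)"
      proof (rule nn_integral_cmult)
        have "(\<lambda>u. ennreal (min u (u\<^sup>2))) \<in> borel_measurable (restrict_space borel {0<..})"
          by (intro measurable_restrict_space1) measurable
        then show "(\<lambda>u. ennreal (min u (u\<^sup>2))) \<in> borel_measurable (\<pi> x)"
          by (simp add: measurable_cong_sets[OF sets refl])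
      qed
      also have "\<dots> \<le> ennreal (z + z\<^sup>2) * m"
        unfolding m_def by (intro mult_left_mono SUP_upper) auto
      also have "\<dots> = ennreal ((z + z\<^sup>2) * enn2real m)"
        using m z by (simp add: ennreal_mult)
      finally have "(LINT u|\<pi> x. ?g u) \<le> (z + z\<^sup>2) * enn2real m"
        using z by (simp add: ennreal_le_iff)
      also have "\<dots> \<le> ((1 + K) * z) * enn2real m"
        using zz by (intro mult_right_mono) (auto simp: algebra_simps)
      finally show ?thesis by (simp add: algebra_simps)
    next
      case False
      then show ?thesis using z by (simp add: not_integrable_integral_eq)
    qed
    have "- \<beta> x * z \<le> b * z" using b[of x] z by (intro mult_right_mono) auto
    moreover have "(\<sigma> x)\<^sup>2 * z\<^sup>2 \<le> s\<^sup>2 * (K * z)"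
    proof (rule mult_mono)
      show "(\<sigma> x)\<^sup>2 \<le> s\<^sup>2" using s[of x] by (metis abs_ge_zero power2_abs power_mono)
    qed (use zz in auto)
    ultimately show "branching_mechanism \<beta> \<sigma> \<pi> x z \<le> C * z"
      using I unfolding branching_mechanism_def C_def by (simp add: algebra_simps)
  qed
qed

lemma cumulant_solutionD:
  assumes "cumulant_solution P \<psi> f v" "0 \<le> t"
  shows "v t \<in> bpB"
    and "v t x = kernel_int P t f x - (LINT s:{0..t}|lborel. LINT y|P s x. \<psi> y (v (t - s) y))"
    and "\<exists>K\<ge>0. \<forall>s\<in>{0..t}. \<forall>x. v s x \<le> K"
proof -
  have b: "bounded ((\<lambda>(t, x). v t x) ` ({0..t} \<times> UNIV))" and nn: "\<And>x. 0 \<le> v t x"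
    using assms by (auto simp: cumulant_solution_def)
  then obtain K where K: "\<forall>y\<in>(\<lambda>(t, x). v t x) ` ({0..t} \<times> UNIV). norm y \<le> K" by (auto simp: bounded_iff)
  have K': "v s x \<le> K" if "s \<in> {0..t}" for s x
    using K[rule_format, of "v s x"] that by (force simp: image_iff)
  have m: "(\<lambda>(t, x). v t x) \<in> borel_measurable (restrict_space borel ({0..} \<times> UNIV))"
    using assms(1) by (simp add: cumulant_solution_def)
  have "(\<lambda>x. (t, x)) \<in> borel \<rightarrow>\<^sub>M restrict_space borel ({0..} \<times> UNIV)"
    using assms(2) by (intro measurable_restrict_space2 borel_measurable_continuous_onI continuous_intros) auto
  from measurable_compose[OF this m] have "v t \<in> borel_measurable borel" by simp
  then show "v t \<in> bpB" using nn K' assms(2) by (intro bpBI[where K = K]) auto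
  have "v t x + (LINT s:{0..t}|lborel. LINT y|P s x. \<psi> y (v (t - s) y)) = (LINT y|P t x. f y)"
    using assms unfolding cumulant_solution_def by blast
  then show "v t x = kernel_int P t f x - (LINT s:{0..t}|lborel. LINT y|P s x. \<psi> y (v (t - s) y))"
    by simp
  have "0 \<le> K" using nn K'[of t] assms(2) by (meson atLeastAtMost_iff order_refl order_trans)
  with K' show "\<exists>K\<ge>0. \<forall>s\<in>{0..t}. \<forall>x. v s x \<le> K" by blast
qed

lemma exponential_integral:
  fixes b p K t :: real
  assumes "0 \<le> t"
  shows "set_integrable lborel {0..t} (\<lambda>s. b * (exp (b * (t - s)) * p + (b * (t - s)) ^ n / fact n * K))"
    and "(LINT s:{0..t}|lborel. b * (exp (b * (t - s)) * p + (b * (t - s)) ^ n / fact n * K)) =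
      (exp (b * t) - 1) * p + (b * t) ^ Suc n / fact (Suc n) * K"
proof -
  define F where "F = (\<lambda>s. - (exp (b * (t - s)) * p + (b * (t - s)) ^ Suc n / fact (Suc n) * K))"
  have c: "continuous_on {0..t} (\<lambda>s. b * (exp (b * (t - s)) * p + (b * (t - s)) ^ n / fact n * K))"
    by (intro continuous_intros) auto
  then show "set_integrable lborel {0..t} (\<lambda>s. b * (exp (b * (t - s)) * p + (b * (t - s)) ^ n / fact n * K))"
    by (intro borel_integrable_atLeastAtMost')
  have "(F has_vector_derivative b * (exp (b * (t - s)) * p + (b * (t - s)) ^ n / fact n * K)) (at s within {0..t})" for s
  proof -
    have G: "((\<lambda>s. (b * (t - s)) ^ Suc n / fact (Suc n)) has_real_derivative
        - (b * ((b * (t - s)) ^ n / fact n))) (at s within {0..t})"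
    proof -
      have "((\<lambda>s. (b * (t - s)) ^ Suc n / fact (Suc n)) has_real_derivative
          (real (Suc n) * (b * (t - s)) ^ n * (- b)) / fact (Suc n)) (at s within {0..t})"
        by (auto intro!: derivative_eq_intros simp del: power_Suc fact_Suc)
      moreover have "(real (Suc n) * y * (- b)) / fact (Suc n) = - (b * (y / fact n))" for y
        unfolding fact_Suc by (simp del: of_nat_Suc)
      ultimately show ?thesis by (simp only:)
    qed
    have "((\<lambda>s. exp (b * (t - s))) has_real_derivative - (b * exp (b * (t - s)))) (at s within {0..t})"
      by (auto intro!: derivative_eq_intros)
    from DERIV_minus[OF DERIV_add[OF DERIV_cmult_right[OF this, of p] DERIV_cmult_right[OF G, of K]]]
    have "(F has_real_derivative b * (exp (b * (t - s)) * p + (b * (t - s)) ^ n / fact n * K)) (at s within {0..t})"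
      unfolding F_def by (rule DERIV_cong) (simp add: distrib_left)
    then show ?thesis by (simp add: has_real_derivative_iff_has_vector_derivative)
  qed
  then have "(LINT s|lborel. indicator {0..t} s *\<^sub>R (b * (exp (b * (t - s)) * p + (b * (t - s)) ^ n / fact n * K))) = F t - F 0"
    using assms c by (intro integral_FTC_atLeastAtMost) auto
  then show "(LINT s:{0..t}|lborel. b * (exp (b * (t - s)) * p + (b * (t - s)) ^ n / fact n * K)) =
      (exp (b * t) - 1) * p + (b * t) ^ Suc n / fact (Suc n) * K"
    by (simp add: set_lebesgue_integral_def F_def algebra_simps)
qed

text \<open>Iterating the integral inequality \<open>v\<^sub>t \<le> P\<^sub>t f + b \<integral>\<^sub>0\<^sup>t P\<^sub>s v\<^sub>t\<^sub>-\<^sub>s ds\<close>. The integrands on the right-hand side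
  of the cumulant equation are compared with explicit functions of \<open>s\<close>, so that no joint
  measurability of the transition kernels is needed.\<close>

lemma cumulant_upper_bound:
  assumes P: "transition_semigroup P" and v: "cumulant_solution P \<psi> f v" and f: "f \<in> bpB"
    and \<psi>: "\<And>x z. 0 \<le> z \<Longrightarrow> - b * z \<le> \<psi> x z" and b: "0 \<le> b" and t: "0 \<le> t"
  shows "v t x \<le> exp (b * t) * kernel_int P t f x"
proof -
  obtain K where K: "0 \<le> K" "\<And>s x. 0 \<le> s \<Longrightarrow> s \<le> t \<Longrightarrow> v s x \<le> K"
    using cumulant_solutionD(3)[OF v t] by auto
  have bound: "v r x \<le> exp (b * r) * kernel_int P r f x + (b * r) ^ n / fact n * K"
    if "0 \<le> r" "r \<le> t" for n r x
    using that
  proof (induction n arbitrary: r x)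
    case 0
    have "0 \<le> exp (b * r) * kernel_int P r f x" using kernel_int_bounds(1)[OF P 0(1) f] by simp
    then show ?case using K(2)[OF 0, of x] by simp
  next
    case (Suc n)
    define p where "p = kernel_int P r f x"
    define h where "h = (\<lambda>s. b * (exp (b * (r - s)) * p + (b * (r - s)) ^ n / fact n * K))"
    define J where "J = (\<lambda>s. LINT y|P s x. \<psi> y (v (r - s) y))"
    have J: "- h s \<le> J s" if s: "0 \<le> s" "s \<le> r" for s
    proof -
      have rs: "0 \<le> r - s" "r - s \<le> t" using s Suc by auto
      define g where "g = (\<lambda>y. exp (b * (r - s)) * kernel_int P (r - s) f y + (b * (r - s)) ^ n / fact n * K)"
      have KB: "kernel_int P (r - s) f \<in> bpB" by (rule kernel_int_bpB[OF P rs(1) f])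
      have c0: "0 \<le> (b * (r - s)) ^ n / fact n * K" using b rs K by simp
      have gB: "g \<in> bpB" unfolding g_def using KB c0 by (intro bpB_add bpB_cmult bpB_const) auto
      have gint: "kernel_int P s g x \<le> exp (b * (r - s)) * p + (b * (r - s)) ^ n / fact n * K"
      proof -
        have "kernel_int P s g x = exp (b * (r - s)) * kernel_int P s (kernel_int P (r - s) f) x
          + kernel_int P s (\<lambda>_. (b * (r - s)) ^ n / fact n * K) x"
          unfolding g_def
          using integrable_kernel[OF P s(1) KB] integrable_kernel[OF P s(1) bpB_const[OF c0]]
          by (subst Bochner_Integration.integral_add) auto
        also have "kernel_int P s (kernel_int P (r - s) f) x = p"
          unfolding p_def using kernel_int_kernel_int[OF P s(1) rs(1) f] by simp
        also have "kernel_int P s (\<lambda>_. (b * (r - s)) ^ n / fact n * K) x \<le> (b * (r - s)) ^ n / fact n * K"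
          by (rule kernel_int_bounds(2)[OF P s(1) bpB_const[OF c0]]) (use c0 in auto)
        finally show ?thesis by simp
      qed
      have hge: "b * kernel_int P s g x \<le> h s" unfolding h_def using gint b by (intro mult_left_mono)
      have g0: "0 \<le> kernel_int P s g x" by (rule kernel_int_bounds(1)[OF P s(1) gB])
      show ?thesis
      proof (cases "integrable (P s x) (\<lambda>y. \<psi> y (v (r - s) y))")
        case True
        have "- (b * kernel_int P s g x) = (LINT y|P s x. - b * g y)" by simp
        also have "\<dots> \<le> J s"
          unfolding J_def
        proof (rule integral_mono)
          show "integrable (P s x) (\<lambda>y. - b * g y)" using integrable_kernel[OF P s(1) gB] by simp
          fix y
          have "b * v (r - s) y \<le> b * g y" unfolding g_def using Suc.IH[OF rs] b by (intro mult_left_mono)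
          moreover have "- b * v (r - s) y \<le> \<psi> y (v (r - s) y)"
            by (intro \<psi> bpBD(2)[OF cumulant_solutionD(1)[OF v rs(1)]])
          ultimately show "- b * g y \<le> \<psi> y (v (r - s) y)" by simp
        qed fact
        finally show ?thesis using hge by simp
      next
        case False
        then have "J s = 0" by (simp add: J_def not_integrable_integral_eq)
        moreover have "0 \<le> b * kernel_int P s g x" using b g0 by simp
        ultimately show ?thesis using hge by simp
      qed
    qed
    have h: "set_integrable lborel {0..r} h" "(LINT s:{0..r}|lborel. h s) =
        (exp (b * r) - 1) * p + (b * r) ^ Suc n / fact (Suc n) * K"
      unfolding h_def by (rule exponential_integral[OF Suc(2)])+
    have h0: "0 \<le> h s" if "0 \<le> s" "s \<le> r" for s
      using b that K kernel_int_bounds(1)[OF P Suc(2) f, of x] by (simp add: h_def p_def)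
    have "- (LINT s:{0..r}|lborel. h s) \<le> (LINT s:{0..r}|lborel. J s)"
    proof (cases "set_integrable lborel {0..r} J")
      case True
      have "(LINT s:{0..r}|lborel. - h s) \<le> (LINT s:{0..r}|lborel. J s)"
        using h(1) True J by (intro set_integral_mono) (auto simp: set_integrable_def)
      then show ?thesis using h(1) by (simp add: set_integral_uminus)
    next
      case False
      have "0 \<le> (LINT s:{0..r}|lborel. h s)"
        unfolding set_lebesgue_integral_def using h0
        by (intro integral_nonneg_AE AE_I2) (auto simp: indicator_def)
      with False show ?thesis
        by (simp add: set_integrable_def set_lebesgue_integral_def not_integrable_integral_eq)
    qed
    moreover have "v r x = p - (LINT s:{0..r}|lborel. J s)"
      unfolding p_def J_def by (rule cumulant_solutionD(2)[OF v Suc(2)])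
    ultimately have "v r x \<le> p + ((exp (b * r) - 1) * p + (b * r) ^ Suc n / fact (Suc n) * K)"
      using h(2) by linarith
    then show ?case unfolding p_def by (simp add: algebra_simps)
  qed
  have "(\<lambda>n. (b * t) ^ n / fact n) \<longlonglongrightarrow> 0"
    using summable_LIMSEQ_zero[OF summable_exp[of "b * t"]] by (simp add: field_simps)
  then have "(\<lambda>n. exp (b * t) * kernel_int P t f x + (b * t) ^ n / fact n * K) \<longlonglongrightarrow>
      exp (b * t) * kernel_int P t f x + 0 * K"
    by (intro tendsto_intros)
  then show ?thesis using bound[OF t order_refl] by (intro LIMSEQ_le_const) auto
qed

text \<open>Bounding the integrand by \<open>\<psi>(x, z) \<le> C z\<close> and the previous lemma gives a converse for short times.\<close>

lemma cumulant_lower_bound: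
  assumes P: "transition_semigroup P" and v: "cumulant_solution P \<psi> f v" and f: "f \<in> bpB"
    and \<psi>: "\<And>x z. 0 \<le> z \<Longrightarrow> - b * z \<le> \<psi> x z" and b: "0 \<le> b" and t: "0 \<le> t"
    and C: "0 \<le> C" "\<And>x z. 0 \<le> z \<Longrightarrow> z \<le> K \<Longrightarrow> \<psi> x z \<le> C * z"
    and K: "\<And>s x. 0 \<le> s \<Longrightarrow> s \<le> t \<Longrightarrow> v s x \<le> K"
  shows "(1 - C * exp (b * t) * t) * kernel_int P t f x \<le> v t x"
proof -
  define p where "p = kernel_int P t f x"
  define J where "J = (\<lambda>s. LINT y|P s x. \<psi> y (v (t - s) y))"
  have p: "0 \<le> p" unfolding p_def by (rule kernel_int_bounds(1)[OF P t f])
  have J: "J s \<le> C * (exp (b * t) * p)" if s: "0 \<le> s" "s \<le> t" for s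
  proof (cases "integrable (P s x) (\<lambda>y. \<psi> y (v (t - s) y))")
    case True
    have ts: "0 \<le> t - s" using s by simp
    have KB: "kernel_int P (t - s) f \<in> bpB" by (rule kernel_int_bpB[OF P ts f])
    have "J s \<le> (LINT y|P s x. C * exp (b * (t - s)) * kernel_int P (t - s) f y)"
      unfolding J_def
    proof (rule integral_mono[OF True])
      show "integrable (P s x) (\<lambda>y. C * exp (b * (t - s)) * kernel_int P (t - s) f y)"
        using integrable_kernel[OF P s(1) KB] by simp
      fix y
      have "\<psi> y (v (t - s) y) \<le> C * v (t - s) y"
        using s by (intro C K bpBD(2)[OF cumulant_solutionD(1)[OF v ts]]) auto
      also have "\<dots> \<le> C * (exp (b * (t - s)) * kernel_int P (t - s) f y)"
        using cumulant_upper_bound[OF P v f \<psi> b ts] C by (intro mult_left_mono)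
      finally show "\<psi> y (v (t - s) y) \<le> C * exp (b * (t - s)) * kernel_int P (t - s) f y"
        by (simp add: mult.assoc)
    qed
    also have "\<dots> = C * (exp (b * (t - s)) * p)"
      unfolding p_def using kernel_int_kernel_int[OF P s(1) ts f] by simp
    also have "\<dots> \<le> C * (exp (b * t) * p)"
      using C(1) b s p by (intro mult_left_mono mult_right_mono) (auto intro!: mult_left_mono)
    finally show ?thesis .
  next
    case False
    then have "J s = 0" by (simp add: J_def not_integrable_integral_eq)
    then show ?thesis using C p by simp
  qed
  have "(LINT s:{0..t}|lborel. J s) \<le> C * (exp (b * t) * p) * t"
  proof (cases "set_integrable lborel {0..t} J")
    case True
    have i: "set_integrable lborel {0..t} (\<lambda>s. C * (exp (b * t) * p))"
      by (intro borel_integrable_atLeastAtMost') auto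
    have "(LINT s:{0..t}|lborel. J s) \<le> (LINT s:{0..t}|lborel. C * (exp (b * t) * p))"
      using J by (intro set_integral_mono[OF True i]) auto
    also have "\<dots> = C * (exp (b * t) * p) * t" using t by (simp add: set_integral_const)
    finally show ?thesis .
  next
    case False
    then show ?thesis using C p t
      by (simp add: set_integrable_def set_lebesgue_integral_def not_integrable_integral_eq)
  qed
  moreover have "v t x = p - (LINT s:{0..t}|lborel. J s)"
    unfolding p_def J_def by (rule cumulant_solutionD(2)[OF v t])
  ultimately show ?thesis unfolding p_def by (simp add: algebra_simps)
qed

section \<open>Comparison of the mean semigroup with the spatial motion\<close>

text \<open>The one-dimensional distributions are given by the kernels: the Markov property at time 0, applied
  to the trivial event.\<close>

lemma right_process_kernel:
  fixes f :: "'a::topological_space \<Rightarrow> ennreal"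
  assumes X: "right_process P W \<P> \<xi> \<zeta>" and t: "0 \<le> t" and f: "f \<in> borel_measurable borel"
  shows "(\<integral>\<^sup>+\<omega>. f (\<xi> t \<omega>) * indicator {\<omega>. ereal t < \<zeta> \<omega>} \<omega> \<partial>\<P> x) = (\<integral>\<^sup>+y. f y \<partial>P t x)"
proof -
  interpret right_process P W \<P> \<xi> \<zeta> by fact
  have sP: "sets (\<P> x) = sets W" and ps: "prob_space (\<P> x)"
    using measurable_space[OF laws, of x] by (auto simp: space_prob_algebra)
  have spP: "space (\<P> x) = space W" using sP by (rule sets_eq_imp_space_eq)
  let ?S = "{\<omega> \<in> space W. ereal t < \<zeta> \<omega>}"
  have S: "?S \<in> sets W" using measurable_process[OF t, of UNIV] by simp
  define D where "D = distr (restrict_space (\<P> x) ?S) borel (\<xi> t)"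
  have m: "\<xi> t \<in> restrict_space (\<P> x) ?S \<rightarrow>\<^sub>M borel"
  proof (rule measurableI)
    fix B :: "'a set" assume "B \<in> sets borel"
    then have "{\<omega> \<in> space W. ereal t < \<zeta> \<omega> \<and> \<xi> t \<omega> \<in> B} \<in> sets W" by (rule measurable_process[OF t])
    moreover have "\<xi> t -` B \<inter> space (restrict_space (\<P> x) ?S) = {\<omega> \<in> space W. ereal t < \<zeta> \<omega> \<and> \<xi> t \<omega> \<in> B}"
      by (auto simp: space_restrict_space spP)
    ultimately show "\<xi> t -` B \<inter> space (restrict_space (\<P> x) ?S) \<in> sets (restrict_space (\<P> x) ?S)"
      using S by (subst sets_restrict_space_iff) (auto simp: sP spP)
  qed simp
  have "D = P t x"
  proof (rule measure_eqI)
    show "sets D = sets (P t x)" using transition_kernel(3)[OF semigroup t] by (simp add: D_def)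
    fix B assume "B \<in> sets D"
    then have B: "B \<in> sets borel" by (simp add: D_def)
    have "space W \<in> sets (natural_filtration W \<xi> \<zeta> 0)"
      unfolding natural_filtration_def using sets.top[of "sigma (space W) _"] by (simp add: space_measure_of_conv)
    from Markov[OF t order_refl this B, of x]
    have "emeasure (\<P> x) {\<omega> \<in> space W. ereal t < \<zeta> \<omega> \<and> \<xi> t \<omega> \<in> B} =
      (\<integral>\<^sup>+\<omega>. emeasure (P t (\<xi> 0 \<omega>)) B * indicator {\<omega> \<in> space W. ereal 0 < \<zeta> \<omega>} \<omega> \<partial>\<P> x)"
      by simp
    also have "\<dots> = (\<integral>\<^sup>+\<omega>. emeasure (P t x) B \<partial>\<P> x)"
    proof (rule nn_integral_cong_AE)
      show "AE \<omega> in \<P> x. emeasure (P t (\<xi> 0 \<omega>)) B * indicator {\<omega> \<in> space W. ereal 0 < \<zeta> \<omega>} \<omega> = emeasure (P t x) B"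
        using start[of x] AE_space[of "\<P> x"] by eventually_elim (auto simp: spP zero_ereal_def)
    qed
    also have "\<dots> = emeasure (P t x) B"
      using prob_space.emeasure_space_1[OF ps] by simp
    finally have e: "emeasure (\<P> x) {\<omega> \<in> space W. ereal t < \<zeta> \<omega> \<and> \<xi> t \<omega> \<in> B} = emeasure (P t x) B" .
    have "emeasure D B = emeasure (restrict_space (\<P> x) ?S) (\<xi> t -` B \<inter> space (restrict_space (\<P> x) ?S))"
      unfolding D_def by (rule emeasure_distr[OF m B])
    also have "\<dots> = emeasure (\<P> x) (\<xi> t -` B \<inter> space (restrict_space (\<P> x) ?S))"
      using S by (intro emeasure_restrict_space) (auto simp: sP spP space_restrict_space)
    also have "\<xi> t -` B \<inter> space (restrict_space (\<P> x) ?S) = {\<omega> \<in> space W. ereal t < \<zeta> \<omega> \<and> \<xi> t \<omega> \<in> B}"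
      by (auto simp: space_restrict_space spP)
    finally show "emeasure D B = emeasure (P t x) B" using e by simp
  qed
  moreover have "(\<integral>\<^sup>+y. f y \<partial>D) = (\<integral>\<^sup>+\<omega>. f (\<xi> t \<omega>) \<partial>restrict_space (\<P> x) ?S)"
    unfolding D_def using nn_integral_distr[OF m, of f] f by simp
  ultimately have "(\<integral>\<^sup>+y. f y \<partial>P t x) = (\<integral>\<^sup>+\<omega>. f (\<xi> t \<omega>) \<partial>restrict_space (\<P> x) ?S)"
    by simp
  also have "\<dots> = (\<integral>\<^sup>+\<omega>. f (\<xi> t \<omega>) * indicator ?S \<omega> \<partial>\<P> x)"
    using S by (intro nn_integral_restrict_space) (auto simp: sP spP)
  also have "\<dots> = (\<integral>\<^sup>+\<omega>. f (\<xi> t \<omega>) * indicator {\<omega>. ereal t < \<zeta> \<omega>} \<omega> \<partial>\<P> x)"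
    by (intro nn_integral_cong) (auto simp: spP indicator_def)
  finally show ?thesis by simp
qed

text \<open>Since \<open>\<beta>\<close> is bounded, the Feynman--Kac weight lies between \<open>exp (- b t)\<close> and \<open>exp (b t)\<close>.\<close>

lemma mean_semigroup_bounds:
  assumes X: "right_process P W \<P> \<xi> \<zeta>" and t: "0 \<le> t" and f: "f \<in> bpB" and b: "\<And>x. \<bar>\<beta> x\<bar> \<le> b"
  shows "ennreal (exp (- b * t) * kernel_int P t f x) \<le> mean_semigroup \<P> \<xi> \<zeta> \<beta> t f x"
    and "mean_semigroup \<P> \<xi> \<zeta> \<beta> t f x \<le> ennreal (exp (b * t) * kernel_int P t f x)"
proof -
  interpret right_process P W \<P> \<xi> \<zeta> by fact
  have b0: "0 \<le> b" using b by (meson abs_ge_zero order_trans)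
  have I: "\<bar>LINT s:{0..t}|lborel. \<beta> (\<xi> s \<omega>)\<bar> \<le> b * t" for \<omega>
  proof (cases "set_integrable lborel {0..t} (\<lambda>s. \<beta> (\<xi> s \<omega>))")
    case True
    have "\<bar>LINT s:{0..t}|lborel. \<beta> (\<xi> s \<omega>)\<bar> \<le> (LINT s:{0..t}|lborel. \<bar>\<beta> (\<xi> s \<omega>)\<bar>)"
      using True set_integral_norm_bound[OF True] by simp
    also have "\<dots> \<le> (LINT s:{0..t}|lborel. b)"
      using b by (intro set_integral_mono[OF set_integrable_abs[OF True]] borel_integrable_atLeastAtMost') auto
    also have "\<dots> = b * t" using t by (simp add: set_integral_const)
    finally show ?thesis .
  next
    case False
    then show ?thesis using b0 t
      by (simp add: set_integrable_def set_lebesgue_integral_def not_integrable_integral_eq)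
  qed
  have K: "(\<integral>\<^sup>+\<omega>. ennreal (c * f (\<xi> t \<omega>)) * indicator {\<omega>. ereal t < \<zeta> \<omega>} \<omega> \<partial>\<P> x) = ennreal (c * kernel_int P t f x)"
    if "0 \<le> c" for c
  proof -
    have "(\<integral>\<^sup>+\<omega>. ennreal (c * f (\<xi> t \<omega>)) * indicator {\<omega>. ereal t < \<zeta> \<omega>} \<omega> \<partial>\<P> x) = (\<integral>\<^sup>+y. ennreal (c * f y) \<partial>P t x)"
      using bpBD(1)[OF f] by (intro right_process_kernel[OF X t]) simp
    also have "\<dots> = ennreal (kernel_int P t (\<lambda>y. c * f y) x)"
      by (rule nn_integral_kernel[OF semigroup t bpB_cmult[OF f that]])
    finally show ?thesis by simp
  qed
  have "ennreal (exp (- b * t) * f (\<xi> t \<omega>)) \<le> ennreal (exp (LINT s:{0..t}|lborel. \<beta> (\<xi> s \<omega>)) * f (\<xi> t \<omega>))"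
    "ennreal (exp (LINT s:{0..t}|lborel. \<beta> (\<xi> s \<omega>)) * f (\<xi> t \<omega>)) \<le> ennreal (exp (b * t) * f (\<xi> t \<omega>))" for \<omega>
    using I[of \<omega>] by (intro ennreal_leI mult_right_mono bpBD(2)[OF f]; simp add: abs_le_iff)+
  then show "ennreal (exp (- b * t) * kernel_int P t f x) \<le> mean_semigroup \<P> \<xi> \<zeta> \<beta> t f x"
    "mean_semigroup \<P> \<xi> \<zeta> \<beta> t f x \<le> ennreal (exp (b * t) * kernel_int P t f x)"
    unfolding mean_semigroup_def
    by (subst K[symmetric]; auto intro!: nn_integral_mono mult_right_mono)+
qed

lemma fmint_dirac_bpB: "f \<in> bpB \<Longrightarrow> fmint (dirac x) f = f x"
  by (rule fmint_dirac) (rule bpBD(1))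

section \<open>Laplace functionals of superprocesses\<close>

text \<open>A superprocess whose cumulant maps preserve the bounded non-negative Borel functions.\<close>

locale superprocess_laws =
  fixes V :: "real \<Rightarrow> ('e::polish_space \<Rightarrow> real) \<Rightarrow> 'e \<Rightarrow> real"
    and Q :: "real \<Rightarrow> 'e fmeas \<Rightarrow> 'e fmeas measure"
    and \<P> :: "'e fmeas \<Rightarrow> (real \<Rightarrow> 'e fmeas) measure"
  assumes is_superprocess: "superprocess V Q \<P>"
    and V_bpB: "\<And>t f. 0 \<le> t \<Longrightarrow> f \<in> bpB \<Longrightarrow> V t f \<in> bpB"
begin

text \<open>The Laplace functional of \<open>X\<^sub>s\<close> under the law started from \<open>\<mu>\<close>, and the exponential whose
  expectation is the joint Laplace functional at the times \<open>s + t\<close> with \<open>t \<in> S\<close>.\<close>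

abbreviation Laplace_X :: "'e fmeas \<Rightarrow> real \<Rightarrow> ('e \<Rightarrow> real) \<Rightarrow> real" where
  "Laplace_X \<mu> s f \<equiv> (LINT \<omega>|\<P> \<mu>. exp (- fmint (X s \<omega>) f))"

abbreviation cylinder :: "real set \<Rightarrow> (real \<Rightarrow> 'e \<Rightarrow> real) \<Rightarrow> real \<Rightarrow> (real \<Rightarrow> 'e fmeas) \<Rightarrow> real" where
  "cylinder S f s \<omega> \<equiv> exp (- (\<Sum>t\<in>S. fmint (X (s + t) \<omega>) (f t)))"

sublocale right_process Q path_space \<P> X "\<lambda>_. \<infinity>"
  using is_superprocess by (simp add: superprocess_def)

abbreviation filtration :: "real \<Rightarrow> (real \<Rightarrow> 'e fmeas) measure" where
  "filtration \<equiv> natural_filtration path_space X (\<lambda>_. \<infinity>)"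

lemma sets_law [measurable_cong]: "sets (\<P> \<mu>) = sets path_space"
  and prob_space_law: "prob_space (\<P> \<mu>)"
  using measurable_space[OF laws, of \<mu>] by (auto simp: space_prob_algebra)

lemma space_law: "space (\<P> \<mu>) = space path_space"
  using sets_law by (rule sets_eq_imp_space_eq)

lemma measurable_X [measurable]: "X t \<in> path_space \<rightarrow>\<^sub>M (borel :: 'e fmeas measure)"
proof (cases "0 \<le> t")
  case True
  show ?thesis
  proof (rule measurableI)
    fix B :: "'e fmeas set" assume "B \<in> sets borel"
    from measurable_process[OF True this] show "X t -` B \<inter> space path_space \<in> sets path_space"
      by (simp add: vimage_def Int_def conj_commute)
  qed simp
next
  case False
  then have "X t = (\<lambda>_. 0 :: 'e fmeas)" by (auto simp: X_def fun_eq_iff)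
  then show ?thesis by simp
qed

lemma space_filtration: "space (filtration t) = space path_space"
  unfolding natural_filtration_def by (simp add: space_measure_of_conv)

lemma sets_filtration_subset: "sets (filtration t) \<subseteq> sets path_space"
proof -
  have "{\<omega> \<in> space path_space. ereal s < \<infinity> \<and> X s \<omega> \<in> B} \<in> sets path_space"
    if "0 \<le> s" "B \<in> sets (borel :: 'e fmeas measure)" for s B
    using measurable_process[OF that] by simp
  then show ?thesis
    unfolding natural_filtration_def
    by (subst sets_measure_of) (auto intro!: sets.sigma_sets_subset)
qed

lemma measurable_X_filtration:
  assumes "0 \<le> s" "s \<le> t"
  shows "X s \<in> filtration t \<rightarrow>\<^sub>M borel"
proof (rule measurableI)
  fix B :: "'e fmeas set" assume "B \<in> sets borel"
  note * = this assms
  have "{\<omega> \<in> space path_space. ereal s < \<infinity> \<and> X s \<omega> \<in> B} \<in> sets (filtration t)"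
    unfolding natural_filtration_def using * by (intro in_measure_of) auto
  then show "X s -` B \<inter> space (filtration t) \<in> sets (filtration t)"
    by (simp add: vimage_def Int_def conj_commute space_filtration)
qed simp

lemma measurable_filtration_law:
  "Z \<in> borel_measurable (filtration t) \<Longrightarrow> Z \<in> borel_measurable (\<P> \<mu>)"
  using sets_filtration_subset[of t]
  by (auto simp: measurable_def space_filtration space_law sets_law)

lemma measurable_exp_X:
  assumes "f \<in> bpB"
  shows "(\<lambda>\<omega>. exp (- fmint (X t \<omega>) f)) \<in> borel_measurable (\<P> \<mu>)"
  using measurable_compose[OF measurable_X measurable_fmint[OF assms], of t] by measurable

lemma kernel_Q:
  assumes "0 \<le> t"
  shows "Q t \<in> borel \<rightarrow>\<^sub>M subprob_algebra borel" "subprob_space (Q t \<eta>)" "sets (Q t \<eta>) = sets borel"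
    "space (Q t \<eta>) = UNIV"
proof -
  show 1: "Q t \<in> borel \<rightarrow>\<^sub>M subprob_algebra borel" using semigroup assms by (auto simp: transition_semigroup_def)
  from subprob_measurableD[OF 1, of \<eta>]
  show "sets (Q t \<eta>) = sets borel" "space (Q t \<eta>) = UNIV" by auto
  show "subprob_space (Q t \<eta>)" using measurable_space[OF 1, of \<eta>] by (simp add: space_subprob_algebra)
qed

lemma nn_integral_Q_exp:
  assumes t: "0 \<le> t" and f: "f \<in> bpB"
  shows "(\<integral>\<^sup>+\<theta>. ennreal (exp (- fmint \<theta> f)) \<partial>Q t \<eta>) = ennreal (exp (- fmint \<eta> (V t f)))"
proof -
  interpret subprob_space "Q t \<eta>" by (rule kernel_Q(2)[OF t])
  have "(\<lambda>\<theta>. exp (- fmint \<theta> f)) \<in> borel_measurable (borel :: 'e fmeas measure)"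
    using measurable_fmint[OF f] by measurable
  then have "(\<lambda>\<theta>. exp (- fmint \<theta> f)) \<in> borel_measurable (Q t \<eta>)"
    using kernel_Q(3)[OF t] by (simp cong: measurable_cong_sets)
  then have "integrable (Q t \<eta>) (\<lambda>\<theta>. exp (- fmint \<theta> f))"
    using fmint_nonneg[OF f] by (intro integrable_const_bound[where B = 1]) auto
  then have "(\<integral>\<^sup>+\<theta>. ennreal (exp (- fmint \<theta> f)) \<partial>Q t \<eta>) = ennreal (LINT \<theta>|Q t \<eta>. exp (- fmint \<theta> f))"
    by (intro nn_integral_eq_integral) auto
  also have "(LINT \<theta>|Q t \<eta>. exp (- fmint \<theta> f)) = exp (- fmint \<eta> (V t f))"
    using is_superprocess t f by (auto simp: superprocess_def)
  finally show ?thesis .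
qed

lemma Markov_integral:
  assumes st: "0 \<le> s" "0 \<le> t" and A: "A \<in> sets (filtration t)" and h: "h \<in> borel_measurable borel"
  shows "(\<integral>\<^sup>+\<omega>. indicator A \<omega> * h (X (t + s) \<omega>) \<partial>\<P> \<mu>) =
    (\<integral>\<^sup>+\<omega>. indicator A \<omega> * (\<integral>\<^sup>+\<eta>. h \<eta> \<partial>Q s (X t \<omega>)) \<partial>\<P> \<mu>)"
proof -
  have AP: "A \<in> sets (\<P> \<mu>)" using A sets_filtration_subset by (auto simp: sets_law)
  then have AS: "A \<subseteq> space path_space" using sets.sets_into_space space_law by blast
  define D where "D = density (\<P> \<mu>) (indicator A)"
  have X [measurable]: "X r \<in> D \<rightarrow>\<^sub>M borel" for r unfolding D_def by measurable
  have Qm: "Q s \<in> distr D borel (X t) \<rightarrow>\<^sub>M subprob_algebra borel"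
    using kernel_Q(1)[OF st(1)] by (simp cong: measurable_cong_sets)
  have Qe [measurable]: "(\<lambda>\<eta>. emeasure (Q s \<eta>) B) \<in> borel_measurable borel" if "B \<in> sets borel" for B
    using measurable_emeasure_kernel[OF kernel_Q(1)[OF st(1)] that] .
  have Qh [measurable]: "(\<lambda>\<eta>. \<integral>\<^sup>+\<theta>. h \<theta> \<partial>Q s \<eta>) \<in> borel_measurable borel"
    by (rule measurable_compose[OF kernel_Q(1)[OF st(1)] nn_integral_measurable_subprob_algebra[OF h]])
  have "distr D borel (X (t + s)) = distr D borel (X t) \<bind> Q s"
  proof (rule measure_eqI)
    show "sets (distr D borel (X (t + s))) = sets (distr D borel (X t) \<bind> Q s)"
      using kernel_Q(3)[OF st(1)] by (subst sets_bind[where N = borel]) auto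
    fix B assume "B \<in> sets (distr D borel (X (t + s)))"
    then have B: "B \<in> sets borel" by simp
    have "emeasure (distr D borel (X (t + s))) B = emeasure D (X (t + s) -` B \<inter> space D)"
      using B by (intro emeasure_distr) auto
    also have "\<dots> = (\<integral>\<^sup>+\<omega>. indicator A \<omega> * indicator (X (t + s) -` B \<inter> space D) \<omega> \<partial>\<P> \<mu>)"
      unfolding D_def using AP B by (intro emeasure_density) (auto intro!: measurable_sets)
    also have "\<dots> = (\<integral>\<^sup>+\<omega>. indicator {\<omega> \<in> A. X (t + s) \<omega> \<in> B} \<omega> \<partial>\<P> \<mu>)"
      by (intro nn_integral_cong) (auto simp: indicator_def D_def)
    also have "\<dots> = emeasure (\<P> \<mu>) {\<omega> \<in> A. X (t + s) \<omega> \<in> B}"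
    proof (rule nn_integral_indicator)
      have "{\<omega> \<in> A. X (t + s) \<omega> \<in> B} = A \<inter> (X (t + s) -` B \<inter> space (\<P> \<mu>))"
        using AS by (auto simp: space_law)
      also have "\<dots> \<in> sets (\<P> \<mu>)" using AP B by (intro sets.Int measurable_sets[of _ _ borel]) auto
      finally show "{\<omega> \<in> A. X (t + s) \<omega> \<in> B} \<in> sets (\<P> \<mu>)" .
    qed
    also have "\<dots> = (\<integral>\<^sup>+\<omega>. indicator A \<omega> * emeasure (Q s (X t \<omega>)) B \<partial>\<P> \<mu>)"
      using Markov[OF st A B, of \<mu>] by (simp add: mult.commute)
    also have "\<dots> = (\<integral>\<^sup>+\<omega>. emeasure (Q s (X t \<omega>)) B \<partial>D)"
      unfolding D_def using AP B by (intro nn_integral_density[symmetric]) auto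
    also have "\<dots> = (\<integral>\<^sup>+\<eta>. emeasure (Q s \<eta>) B \<partial>distr D borel (X t))"
      using B by (intro nn_integral_distr[symmetric]) auto
    also have "\<dots> = emeasure (distr D borel (X t) \<bind> Q s) B"
      by (intro emeasure_bind[symmetric, OF _ Qm B]) auto
    finally show "emeasure (distr D borel (X (t + s))) B = emeasure (distr D borel (X t) \<bind> Q s) B" .
  qed
  then have "(\<integral>\<^sup>+\<eta>. h \<eta> \<partial>distr D borel (X (t + s))) = (\<integral>\<^sup>+\<eta>. (\<integral>\<^sup>+\<theta>. h \<theta> \<partial>Q s \<eta>) \<partial>distr D borel (X t))"
    using nn_integral_bind[OF h Qm] by simp
  then have "(\<integral>\<^sup>+\<omega>. h (X (t + s) \<omega>) \<partial>D) = (\<integral>\<^sup>+\<omega>. (\<integral>\<^sup>+\<theta>. h \<theta> \<partial>Q s (X t \<omega>)) \<partial>D)"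
    using h Qh by (simp add: nn_integral_distr)
  then show ?thesis
    unfolding D_def using AP h Qh by (subst (asm) (1 2) nn_integral_density) auto
qed

lemma Markov_exp:
  assumes st: "0 \<le> s" "0 \<le> t" and f: "f \<in> bpB" and Z: "Z \<in> borel_measurable (filtration t)"
  shows "(\<integral>\<^sup>+\<omega>. Z \<omega> * ennreal (exp (- fmint (X (t + s) \<omega>) f)) \<partial>\<P> \<mu>) =
    (\<integral>\<^sup>+\<omega>. Z \<omega> * ennreal (exp (- fmint (X t \<omega>) (V s f))) \<partial>\<P> \<mu>)"
proof -
  define g where "g = (\<lambda>\<omega>. ennreal (exp (- fmint (X (t + s) \<omega>) f)))"
  define k where "k = (\<lambda>\<omega>. ennreal (exp (- fmint (X t \<omega>) (V s f))))"
  have [measurable]: "g \<in> borel_measurable (\<P> \<mu>)" "k \<in> borel_measurable (\<P> \<mu>)"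
    unfolding g_def k_def using measurable_exp_X[OF f] measurable_exp_X[OF V_bpB[OF st(1) f]] by simp_all
  have "(\<integral>\<^sup>+\<omega>. Z \<omega> * g \<omega> \<partial>\<P> \<mu>) = (\<integral>\<^sup>+\<omega>. Z \<omega> * k \<omega> \<partial>\<P> \<mu>)"
    using Z
  proof (induction rule: borel_measurable_induct)
    case (cong u v)
    have "u \<omega> = v \<omega>" if "\<omega> \<in> space (\<P> \<mu>)" for \<omega>
      using cong(3) that by (simp add: space_filtration space_law)
    then have "(\<integral>\<^sup>+\<omega>. u \<omega> * l \<omega> \<partial>\<P> \<mu>) = (\<integral>\<^sup>+\<omega>. v \<omega> * l \<omega> \<partial>\<P> \<mu>)" for l
      by (intro nn_integral_cong) simp
    then show ?case using cong by simp
  next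
    case (set A)
    have "(\<lambda>\<eta>. ennreal (exp (- fmint \<eta> f))) \<in> borel_measurable (borel :: 'e fmeas measure)"
      using measurable_fmint[OF f] by measurable
    from Markov_integral[OF st set this] show ?case
      by (simp add: g_def k_def nn_integral_Q_exp[OF st(1) f])
  next
    case (mult u c)
    note measurable_filtration_law[OF mult.hyps(2), of \<mu>, measurable]
    show ?case using mult by (simp add: mult.assoc nn_integral_cmult)
  next
    case (add u v)
    note measurable_filtration_law[OF add.hyps(1), of \<mu>, measurable]
    note measurable_filtration_law[OF add.hyps(3), of \<mu>, measurable]
    show ?case using add by (simp add: distrib_right nn_integral_add)
  next
    case (seq U)
    note measurable_filtration_law[OF seq.hyps(1), of _ \<mu>, measurable]
    have "(\<integral>\<^sup>+\<omega>. (SUP i. U i) \<omega> * l \<omega> \<partial>\<P> \<mu>) = (SUP i. \<integral>\<^sup>+\<omega>. U i \<omega> * l \<omega> \<partial>\<P> \<mu>)"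
      if [measurable]: "l \<in> borel_measurable (\<P> \<mu>)" for l
    proof -
      have "(\<integral>\<^sup>+\<omega>. (SUP i. U i) \<omega> * l \<omega> \<partial>\<P> \<mu>) = (\<integral>\<^sup>+\<omega>. (SUP i. U i \<omega> * l \<omega>) \<partial>\<P> \<mu>)"
        by (intro nn_integral_cong) (simp add: image_comp SUP_mult_right_ennreal)
      also have "\<dots> = (SUP i. \<integral>\<^sup>+\<omega>. U i \<omega> * l \<omega> \<partial>\<P> \<mu>)"
        using seq.hyps(3) by (intro nn_integral_monotone_convergence_SUP)
          (auto simp: incseq_def le_fun_def intro!: mult_right_mono)
      finally show ?thesis .
    qed
    then show ?case using seq by simp
  qed
  then show ?thesis by (simp add: g_def k_def)
qed

lemma Markov_exp_real:
  assumes st: "0 \<le> s" "0 \<le> t" and f: "f \<in> bpB"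
    and Z: "Z \<in> borel_measurable (filtration t)" "\<And>\<omega>. 0 \<le> Z \<omega>" "\<And>\<omega>. Z \<omega> \<le> 1"
  shows "(LINT \<omega>|\<P> \<mu>. Z \<omega> * exp (- fmint (X (t + s) \<omega>) f)) = (LINT \<omega>|\<P> \<mu>. Z \<omega> * exp (- fmint (X t \<omega>) (V s f)))"
proof -
  interpret prob_space "\<P> \<mu>" by (rule prob_space_law)
  have "(\<integral>\<^sup>+\<omega>. ennreal (Z \<omega> * exp (- fmint (X (t + s) \<omega>) f)) \<partial>\<P> \<mu>) =
    (\<integral>\<^sup>+\<omega>. ennreal (Z \<omega> * exp (- fmint (X t \<omega>) (V s f))) \<partial>\<P> \<mu>)"
    using Markov_exp[OF st f, of "\<lambda>\<omega>. ennreal (Z \<omega>)" \<mu>] Z by (simp add: ennreal_mult)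
  moreover have "Z \<in> borel_measurable (\<P> \<mu>)" by (rule measurable_filtration_law[OF Z(1)])
  ultimately show ?thesis
    using Z measurable_exp_X[OF f, of "t + s" \<mu>] measurable_exp_X[OF V_bpB[OF st(1) f], of t \<mu>]
    by (subst (1 2) integral_eq_nn_integral) auto
qed

lemma integral_exp_X_0:
  assumes "f \<in> bpB"
  shows "Laplace_X \<mu> 0 f = exp (- fmint \<mu> f)"
proof -
  interpret prob_space "\<P> \<mu>" by (rule prob_space_law)
  have "Laplace_X \<mu> 0 f = (LINT \<omega>|\<P> \<mu>. exp (- fmint \<mu> f))"
    using start[of \<mu>] measurable_exp_X[OF assms]
    by (intro integral_cong_AE) (auto elim!: eventually_mono)
  then show ?thesis by (simp add: prob_space)
qed

lemma integral_exp_X_add: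
  assumes "0 \<le> s" "0 \<le> t" "f \<in> bpB"
  shows "Laplace_X \<mu> (t + s) f = Laplace_X \<mu> t (V s f)"
  using Markov_exp_real[OF assms, of "\<lambda>_. 1" \<mu>] by simp

lemma integral_exp_X:
  assumes "0 \<le> t" "f \<in> bpB"
  shows "Laplace_X \<mu> t f = exp (- fmint \<mu> (V t f))"
  using integral_exp_X_add[OF assms(1) order_refl assms(2), of \<mu>] integral_exp_X_0[OF V_bpB[OF assms]] by simp

lemma V_semigroup:
  assumes "0 \<le> s" "0 \<le> t" "f \<in> bpB"
  shows "V (t + s) f x = V t (V s f) x"
proof -
  have "exp (- fmint (dirac x) (V (t + s) f)) = exp (- fmint (dirac x) (V t (V s f)))"
    using integral_exp_X_add[OF assms, of "dirac x"] integral_exp_X[of "t + s" f "dirac x"]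
      integral_exp_X[of t "V s f" "dirac x"] V_bpB[of s f] assms by simp
  moreover have "V (t + s) f \<in> bpB" "V t (V s f) \<in> bpB" using assms by (auto intro!: V_bpB)
  ultimately show ?thesis by (simp add: fmint_dirac_bpB del: meas_dirac)
qed

lemma integrable_exp_X:
  assumes "f \<in> bpB"
  shows "integrable (\<P> \<mu>) (\<lambda>\<omega>. exp (- fmint (X t \<omega>) f))"
proof -
  interpret prob_space "\<P> \<mu>" by (rule prob_space_law)
  show ?thesis using measurable_exp_X[OF assms] fmint_nonneg[OF assms]
    by (intro integrable_const_bound[where B = 1]) auto
qed

text \<open>Joint Laplace functionals at positive times after \<open>s\<close> are Laplace functionals at time \<open>s\<close>: the last
  time is absorbed into the one before it by the Markov property. The bound on \<open>w\<close> depends on the set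
  of times only (in fact on its least element), not on the functions \<open>f\<close>.\<close>

lemma cylinder_Laplace:
  fixes \<phi> :: "'e \<Rightarrow> real"
  assumes V: "\<And>t. 0 < t \<Longrightarrow> \<exists>K. \<forall>f\<in>bpB. \<forall>x. V t f x \<le> K * \<phi> x"
    and S: "finite S" "S \<noteq> {}" "S \<subseteq> {0<..}"
  shows "\<exists>K. \<forall>f. (\<forall>t\<in>S. f t \<in> bpB) \<longrightarrow> (\<exists>w\<in>bpB. (\<forall>x. w x \<le> K * \<phi> x) \<and>
    (\<forall>s\<ge>0. \<forall>\<mu>. (LINT \<omega>|\<P> \<mu>. cylinder S f s \<omega>) =
      Laplace_X \<mu> s w))"
  using S
proof (induction S rule: finite_linorder_max_induct)
  case empty then show ?case by simp
next
  case (insert T S)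
  show ?case
  proof (cases "S = {}")
    case True
    have T: "0 < T" using insert by simp
    obtain K where K: "\<forall>f\<in>bpB. \<forall>x. V T f x \<le> K * \<phi> x" using V[OF T] by blast
    have "\<exists>w\<in>bpB. (\<forall>x. w x \<le> K * \<phi> x) \<and>
      (\<forall>s\<ge>0. \<forall>\<mu>. (LINT \<omega>|\<P> \<mu>. cylinder {T} f s \<omega>) =
        Laplace_X \<mu> s w)" if "f T \<in> bpB" for f
      using that T K integral_exp_X_add[of T _ "f T"] by (intro bexI[of _ "V T (f T)"]) (auto intro!: V_bpB)
    then show ?thesis unfolding True by blast
  next
    case False
    obtain K where K0: "\<forall>f. (\<forall>t\<in>S. f t \<in> bpB) \<longrightarrow> (\<exists>w\<in>bpB. (\<forall>x. w x \<le> K * \<phi> x) \<and>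
      (\<forall>s\<ge>0. \<forall>\<mu>. (LINT \<omega>|\<P> \<mu>. cylinder S f s \<omega>) =
        Laplace_X \<mu> s w))"
      using insert.IH[OF False] insert.prems by auto
    note K = K0[rule_format]
    define m where "m = Max S"
    have m: "m \<in> S" "\<And>t. t \<in> S \<Longrightarrow> t \<le> m" using insert(1) False by (auto simp: m_def)
    have mT: "m < T" "0 < m" using m insert by auto
    have "\<exists>w\<in>bpB. (\<forall>x. w x \<le> K * \<phi> x) \<and>
      (\<forall>s\<ge>0. \<forall>\<mu>. (LINT \<omega>|\<P> \<mu>. cylinder (insert T S) f s \<omega>) =
        Laplace_X \<mu> s w)" if f: "\<And>t. t \<in> insert T S \<Longrightarrow> f t \<in> bpB" for f
    proof -
      define v where "v = V (T - m) (f T)"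
      have v: "v \<in> bpB" unfolding v_def using mT f by (intro V_bpB) auto
      define f' where "f' = f(m := \<lambda>x. f m x + v x)"
      have "f' t \<in> bpB" if "t \<in> S" for t using that f v m by (auto simp: f'_def intro!: bpB_add)
      from K[of f', OF this] obtain w where w: "w \<in> bpB" "\<forall>x. w x \<le> K * \<phi> x"
        "\<forall>s\<ge>0. \<forall>\<mu>. (LINT \<omega>|\<P> \<mu>. cylinder S f' s \<omega>) =
          Laplace_X \<mu> s w"
        by blast
      have sum: "(\<Sum>t\<in>S. fmint (X (s + t) \<omega>) (f' t)) = (\<Sum>t\<in>S. fmint (X (s + t) \<omega>) (f t)) + fmint (X (s + m) \<omega>) v"
        for s \<omega>
      proof -
        have "(\<Sum>t\<in>S. fmint (X (s + t) \<omega>) (f' t)) =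
          (\<Sum>t\<in>S. fmint (X (s + t) \<omega>) (f t) + (if t = m then fmint (X (s + m) \<omega>) v else 0))"
          using f v by (intro sum.cong) (auto simp: f'_def fmint_add)
        also have "\<dots> = (\<Sum>t\<in>S. fmint (X (s + t) \<omega>) (f t)) + fmint (X (s + m) \<omega>) v"
          using insert(1) m by (simp add: sum.distrib sum.delta)
        finally show ?thesis .
      qed
      have "(LINT \<omega>|\<P> \<mu>. cylinder (insert T S) f s \<omega>) =
        Laplace_X \<mu> s w" if s: "0 \<le> s" for s \<mu>
      proof -
        define Z where "Z = (\<lambda>\<omega>. cylinder S f s \<omega>)"
        have "(\<lambda>\<omega>. fmint (X (s + t) \<omega>) (f t)) \<in> borel_measurable (filtration (s + m))" if "t \<in> S" for t
          using that m(2)[OF that] s insert f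
          by (intro measurable_compose[OF measurable_X_filtration measurable_fmint]) auto
        then have Z: "Z \<in> borel_measurable (filtration (s + m))" unfolding Z_def by measurable
        have Z01: "0 \<le> Z \<omega>" "Z \<omega> \<le> 1" for \<omega>
          unfolding Z_def using f by (auto intro!: sum_nonneg fmint_nonneg)
        have "T \<notin> S" using insert by auto
        then have "(LINT \<omega>|\<P> \<mu>. cylinder (insert T S) f s \<omega>) =
          (LINT \<omega>|\<P> \<mu>. Z \<omega> * exp (- fmint (X (s + m + (T - m)) \<omega>) (f T)))"
          using insert(1) by (simp add: Z_def exp_add[symmetric] algebra_simps)
        also have "\<dots> = (LINT \<omega>|\<P> \<mu>. Z \<omega> * exp (- fmint (X (s + m) \<omega>) v))"
          unfolding v_def using s mT f Z Z01 by (intro Markov_exp_real) auto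
        also have "\<dots> = (LINT \<omega>|\<P> \<mu>. cylinder S f' s \<omega>)"
          unfolding sum by (simp add: Z_def exp_add[symmetric])
        also have "\<dots> = Laplace_X \<mu> s w" using w(3) s by blast
        finally show ?thesis .
      qed
      then show ?thesis using w by blast
    qed
    then show ?thesis by blast
  qed
qed

lemma measurable_cylinder:
  assumes "finite S" "\<And>t. t \<in> S \<Longrightarrow> f t \<in> bpB"
  shows "(\<lambda>\<omega>. cylinder S f s \<omega>) \<in> borel_measurable (\<P> \<mu>)"
proof -
  have "(\<lambda>\<omega>. fmint (X (s + t) \<omega>) (f t)) \<in> borel_measurable (\<P> \<mu>)" if "t \<in> S" for t
    using measurable_compose[OF measurable_X measurable_fmint[OF assms(2)[OF that]], of "s + t"]
    by (simp cong: measurable_cong_sets add: measurable_cong_sets[OF sets_law refl])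
  then show ?thesis by measurable
qed

text \<open>The same on the event of extinction at time \<open>s + r\<close>. Adding the constant \<open>n\<close> to \<open>f r\<close> multiplies
  the functional by \<open>exp (- n X\<^sub>s\<^sub>+\<^sub>r(1))\<close>, which tends to the indicator of \<open>X\<^sub>s\<^sub>+\<^sub>r = 0\<close>; the corresponding
  functions \<open>w\<^sub>n\<close> converge pointwise, as one sees by starting from unit masses, and they
  stay bounded because the bound in the previous lemma does not depend on \<open>n\<close>.\<close>

lemma killed_cylinder_Laplace:
  fixes \<phi> :: "'e \<Rightarrow> real"
  assumes V: "\<And>t. 0 < t \<Longrightarrow> \<exists>K. \<forall>f\<in>bpB. \<forall>x. V t f x \<le> K * \<phi> x"
    and \<phi>: "\<phi> \<in> bpB" and S: "finite S" "S \<subseteq> {0<..}" and r: "r \<in> S" and f: "\<And>t. t \<in> S \<Longrightarrow> f t \<in> bpB"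
  shows "\<exists>w\<in>bpB. (\<exists>K. \<forall>x. w x \<le> K * \<phi> x) \<and> (\<forall>s\<ge>0. \<forall>\<mu>.
    (LINT \<omega>|\<P> \<mu>. cylinder S f s \<omega> * indicator {0} (X (s + r) \<omega>)) =
      Laplace_X \<mu> s w)"
proof -
  obtain M where M: "\<forall>x. \<phi> x \<le> M" using bpBD(3)[OF \<phi>] by blast
  define F where "F = (\<lambda>n. f(r := \<lambda>x. f r x + real n))"
  have FB: "F n t \<in> bpB" if "t \<in> S" for n t using that f r by (auto simp: F_def intro!: bpB_add bpB_const)
  have "S \<noteq> {}" using r by blast
  from cylinder_Laplace[OF V S(1) this S(2)] obtain K where K0: "\<forall>f. (\<forall>t\<in>S. f t \<in> bpB) \<longrightarrow>
    (\<exists>w\<in>bpB. (\<forall>x. w x \<le> K * \<phi> x) \<and>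
      (\<forall>s\<ge>0. \<forall>\<mu>. (LINT \<omega>|\<P> \<mu>. cylinder S f s \<omega>) =
        Laplace_X \<mu> s w))" ..
  note K = K0[rule_format]
  have "\<forall>n. \<exists>w. w \<in> bpB \<and> (\<forall>x. w x \<le> K * \<phi> x) \<and>
      (\<forall>s\<ge>0. \<forall>\<mu>. (LINT \<omega>|\<P> \<mu>. cylinder S (F n) s \<omega>) =
        Laplace_X \<mu> s w)"
    using K[OF FB] unfolding Bex_def by (intro allI)
  from choice[OF this] obtain w where w0: "\<forall>n. w n \<in> bpB \<and> (\<forall>x. w n x \<le> K * \<phi> x) \<and>
      (\<forall>s\<ge>0. \<forall>\<mu>. (LINT \<omega>|\<P> \<mu>. cylinder S (F n) s \<omega>) =
        Laplace_X \<mu> s (w n))" ..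
  then have w: "\<And>n. w n \<in> bpB" "\<And>n x. w n x \<le> K * \<phi> x"
    "\<And>n s \<mu>. 0 \<le> s \<Longrightarrow> (LINT \<omega>|\<P> \<mu>. cylinder S (F n) s \<omega>) =
        Laplace_X \<mu> s (w n)"
    by simp_all
  have sum: "(\<Sum>t\<in>S. fmint (X (s + t) \<omega>) (F n t)) =
      (\<Sum>t\<in>S. fmint (X (s + t) \<omega>) (f t)) + real n * fmint (X (s + r) \<omega>) (\<lambda>_. 1)" for s \<omega> n
  proof -
    have "(\<Sum>t\<in>S. fmint (X (s + t) \<omega>) (F n t)) =
      (\<Sum>t\<in>S. fmint (X (s + t) \<omega>) (f t) + (if t = r then fmint (X (s + r) \<omega>) (\<lambda>_. real n) else 0))"
      using f by (intro sum.cong) (auto simp: F_def fmint_add bpB_const simp del: lebesgue_integral_const)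
    also have "\<dots> = (\<Sum>t\<in>S. fmint (X (s + t) \<omega>) (f t)) + fmint (X (s + r) \<omega>) (\<lambda>_. real n)"
      using S(1) r by (simp add: sum.distrib sum.delta)
    finally show ?thesis by simp
  qed
  define L where "L = (\<lambda>s \<mu>. LINT \<omega>|\<P> \<mu>. cylinder S f s \<omega> * indicator {0} (X (s + r) \<omega>))"
  have lim: "(\<lambda>n. LINT \<omega>|\<P> \<mu>. cylinder S (F n) s \<omega>) \<longlonglongrightarrow> L s \<mu>" for s \<mu>
  proof -
    interpret prob_space "\<P> \<mu>" by (rule prob_space_law)
    show ?thesis unfolding L_def
    proof (rule integral_dominated_convergence[where w = "\<lambda>_. 1"])
      show "(\<lambda>\<omega>. cylinder S f s \<omega> * indicator {0} (X (s + r) \<omega>)) \<in> borel_measurable (\<P> \<mu>)"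
      proof -
        have "(indicator {0} :: 'e fmeas \<Rightarrow> real) \<in> borel_measurable borel"
          by (intro borel_measurable_indicator sets_zero_fmeas)
        from measurable_compose[OF measurable_X this]
        have "(\<lambda>\<omega>. indicator {0} (X (s + r) \<omega>) :: real) \<in> borel_measurable (\<P> \<mu>)"
          by (simp add: measurable_cong_sets[OF sets_law refl])
        then show ?thesis using measurable_cylinder[OF S(1) f] by (intro borel_measurable_times)
      qed
      show "(\<lambda>\<omega>. cylinder S (F n) s \<omega>) \<in> borel_measurable (\<P> \<mu>)" for n
        by (intro measurable_cylinder S(1) FB)
      show "AE \<omega> in \<P> \<mu>. norm (cylinder S (F n) s \<omega>) \<le> 1" for n
        by (intro AE_I2) (auto intro!: sum_nonneg fmint_nonneg FB)
      show "AE \<omega> in \<P> \<mu>. (\<lambda>n. cylinder S (F n) s \<omega>) \<longlonglongrightarrow>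
        cylinder S f s \<omega> * indicator {0} (X (s + r) \<omega>)"
      proof (rule AE_I2)
        fix \<omega>
        define a where "a = (\<Sum>t\<in>S. fmint (X (s + t) \<omega>) (f t))"
        define b where "b = fmint (X (s + r) \<omega>) (\<lambda>_. 1)"
        have b: "0 \<le> b" unfolding b_def by (intro fmint_nonneg bpB_const) simp
        have ind: "indicator {0} (X (s + r) \<omega>) = (if b = 0 then 1 else 0 :: real)"
          using fmeas_eq_0_iff[of "X (s + r) \<omega>"] by (simp add: b_def indicator_def)
        have "(\<lambda>n. exp (- a) * exp (- b) ^ n) \<longlonglongrightarrow> exp (- a) * (if b = 0 then 1 else 0)"
        proof (cases "b = 0")
          case False
          then have "exp (- b) < 1" using b by simp
          then have "(\<lambda>n. exp (- b) ^ n) \<longlonglongrightarrow> 0" by (intro LIMSEQ_realpow_zero) auto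
          then show ?thesis using False by (auto intro!: tendsto_eq_intros)
        qed simp
        moreover have "exp (- (a + real n * b)) = exp (- a) * exp (- b) ^ n" for n
          by (simp add: exp_add[symmetric] exp_of_nat_mult[symmetric])
        ultimately show "(\<lambda>n. cylinder S (F n) s \<omega>) \<longlonglongrightarrow>
            cylinder S f s \<omega> * indicator {0} (X (s + r) \<omega>)"
          unfolding sum ind a_def[symmetric] b_def[symmetric] by (simp only:)
      qed
    qed simp
  qed
  have pt: "(\<lambda>n. exp (- w n x)) \<longlonglongrightarrow> L 0 (dirac x)" for x
    using lim[of "dirac x" 0] w(3)[of 0 "dirac x"] integral_exp_X_0[OF w(1)]
    by (simp add: fmint_dirac_bpB[OF w(1)] del: meas_dirac)
  have Lpos: "exp (- (K * \<phi> x)) \<le> L 0 (dirac x)" "L 0 (dirac x) \<le> 1" for x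
    using w(2)[of _ x] bpBD(2)[OF w(1), of _ x]
    by (auto intro!: LIMSEQ_le_const[OF pt[of x]] LIMSEQ_le_const2[OF pt[of x]])
  define u where "u = (\<lambda>x. - ln (L 0 (dirac x)))"
  have ulim: "(\<lambda>n. w n x) \<longlonglongrightarrow> u x" for x
  proof -
    have "L 0 (dirac x) > 0" using Lpos(1)[of x] by (meson exp_gt_zero less_le_trans)
    then have "(\<lambda>n. - ln (exp (- w n x))) \<longlonglongrightarrow> - ln (L 0 (dirac x))"
      using pt[of x] by (intro tendsto_intros) auto
    then show ?thesis by (simp add: u_def)
  qed
  have u: "0 \<le> u x" "u x \<le> K * \<phi> x" for x
    using w(2)[of _ x] bpBD(2)[OF w(1), of _ x]
    by (auto intro!: LIMSEQ_le_const[OF ulim[of x]] LIMSEQ_le_const2[OF ulim[of x]])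
  have bound: "K * \<phi> x \<le> \<bar>K\<bar> * M" for x
  proof -
    have "K * \<phi> x \<le> \<bar>K\<bar> * \<phi> x" using bpBD(2)[OF \<phi>] by (intro mult_right_mono) auto
    also have "\<dots> \<le> \<bar>K\<bar> * M" using M by (intro mult_left_mono) auto
    finally show ?thesis .
  qed
  have uB: "u \<in> bpB"
  proof (rule bpBI[where K = "\<bar>K\<bar> * M"])
    show "u \<in> borel_measurable borel"
      by (rule borel_measurable_LIMSEQ_metric[OF bpBD(1)[OF w(1)] ulim])
    show "0 \<le> u x" "u x \<le> \<bar>K\<bar> * M" for x using u[of x] bound[of x] by simp_all
  qed
  have "L s \<mu> = Laplace_X \<mu> s u" if s: "0 \<le> s" for s \<mu>
  proof (rule LIMSEQ_unique)
    interpret prob_space "\<P> \<mu>" by (rule prob_space_law)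
    show "(\<lambda>n. LINT \<omega>|\<P> \<mu>. exp (- fmint (X s \<omega>) (w n))) \<longlonglongrightarrow> L s \<mu>"
      using lim[of \<mu> s] w(3)[OF s] by simp
    show "(\<lambda>n. LINT \<omega>|\<P> \<mu>. exp (- fmint (X s \<omega>) (w n))) \<longlonglongrightarrow> Laplace_X \<mu> s u"
    proof (rule integral_dominated_convergence[where w = "\<lambda>_. 1"])
      show "AE \<omega> in \<P> \<mu>. (\<lambda>n. exp (- fmint (X s \<omega>) (w n))) \<longlonglongrightarrow> exp (- fmint (X s \<omega>) u)"
      proof (intro AE_I2 tendsto_intros)
        fix \<omega>
        show "(\<lambda>n. fmint (X s \<omega>) (w n)) \<longlonglongrightarrow> fmint (X s \<omega>) u"
        proof (rule integral_dominated_convergence[where w = "\<lambda>_. \<bar>K\<bar> * M"])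
          show "integrable (meas (X s \<omega>)) (\<lambda>_. \<bar>K\<bar> * M)"
            by (intro integrable_bounded_fmeas[where K = "\<bar>\<bar>K\<bar> * M\<bar>"]) auto
          show "AE x in meas (X s \<omega>). norm (w n x) \<le> \<bar>K\<bar> * M" for n
            using order_trans[OF w(2) bound] bpBD(2)[OF w(1)] by simp
        qed (use ulim in \<open>auto intro!: borel_measurable_integrable integrable_bpB uB w\<close>)
      qed
      show "AE \<omega> in \<P> \<mu>. norm (exp (- fmint (X s \<omega>) (w n))) \<le> 1" for n
        using fmint_nonneg[OF w(1)] by simp
    qed (auto intro: measurable_exp_X uB w)
  qed
  with uB u(2) show ?thesis unfolding L_def by blast
qed

end

section \<open>Survival probabilities and the conditional law\<close>

lemma exp_minus_scaling:
  fixes z c :: real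
  assumes "0 \<le> c" "c \<le> 1"
  shows "c * (1 - exp (- z)) \<le> 1 - exp (- (c * z))"
proof -
  have "exp ((1 - c) *\<^sub>R 0 + c *\<^sub>R (- z)) \<le> (1 - c) * exp 0 + c * exp (- z)"
    by (rule convex_onD[OF exp_convex]) (use assms in auto)
  then show ?thesis by (simp add: algebra_simps)
qed

lemma exp_minus_diff:
  fixes a b :: real
  assumes "0 \<le> a" "0 \<le> b"
  shows "\<bar>exp (- a) - exp (- b)\<bar> \<le> 1 - exp (- \<bar>a - b\<bar>)"
proof -
  have *: "exp (- a) - exp (- b) \<le> 1 - exp (- (b - a))" "0 \<le> exp (- a) - exp (- b)"
    if "0 \<le> a" "a \<le> b" for a b :: real
  proof -
    have "exp (- a) - exp (- b) = exp (- a) * (1 - exp (- (b - a)))"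
      by (simp add: right_diff_distrib exp_add[symmetric])
    also have "\<dots> \<le> 1 * (1 - exp (- (b - a)))" using that by (intro mult_right_mono) auto
    finally show "exp (- a) - exp (- b) \<le> 1 - exp (- (b - a))" by simp
    show "0 \<le> exp (- a) - exp (- b)" using that by simp
  qed
  show ?thesis
  proof (cases "a \<le> b")
    case True then show ?thesis using *[of a b] assms by (simp add: abs_if)
  next
    case False then show ?thesis using *[of b a] assms by (simp add: abs_if)
  qed
qed

lemma fmint_abs_diff:
  assumes "f \<in> bpB" "g \<in> bpB"
  shows "\<bar>fmint \<eta> f - fmint \<eta> g\<bar> \<le> fmint \<eta> (\<lambda>x. \<bar>f x - g x\<bar>)"
proof -
  have "fmint \<eta> f - fmint \<eta> g = fmint \<eta> (\<lambda>x. f x - g x)"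
    using assms by (intro Bochner_Integration.integral_diff[symmetric] integrable_bpB)
  then show ?thesis using integral_abs_bound[of "meas \<eta>" "\<lambda>x. f x - g x"] by simp
qed

lemma exp_fmint_diff:
  assumes "f \<in> bpB" "g \<in> bpB"
  shows "\<bar>exp (- fmint \<eta> f) - exp (- fmint \<eta> g)\<bar> \<le> 1 - exp (- fmint \<eta> (\<lambda>x. \<bar>f x - g x\<bar>))"
proof -
  have "\<bar>exp (- fmint \<eta> f) - exp (- fmint \<eta> g)\<bar> \<le> 1 - exp (- \<bar>fmint \<eta> f - fmint \<eta> g\<bar>)"
    by (intro exp_minus_diff fmint_nonneg assms)
  also have "\<dots> \<le> 1 - exp (- fmint \<eta> (\<lambda>x. \<bar>f x - g x\<bar>))" using fmint_abs_diff[OF assms] by simp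
  finally show ?thesis .
qed

lemma integral_uniform_measure:
  fixes g :: "'a \<Rightarrow> real"
  assumes M: "finite_measure M" and A: "A \<in> sets M" "0 < measure M A" and g: "g \<in> borel_measurable M"
  shows "(LINT x|uniform_measure M A. g x) = (LINT x|M. indicator A x * g x) / measure M A"
proof -
  interpret finite_measure M by fact
  have "uniform_measure M A = density M (\<lambda>x. ennreal (indicator A x / measure M A))"
    unfolding uniform_measure_def using A
    by (intro density_cong) (auto simp: emeasure_eq_measure divide_ennreal ennreal_indicator[symmetric] simp del: ennreal_indicator)
  then have "(LINT x|uniform_measure M A. g x) = (LINT x|M. (indicator A x / measure M A) *\<^sub>R g x)"
    using g A by (simp add: integral_density)
  also have "\<dots> = (LINT x|M. indicator A x * g x) / measure M A" by simp
  finally show ?thesis .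
qed

context superprocess_laws
begin

text \<open>The survival probability, and the Laplace functional of \<open>X\<^sub>s\<close> under the law conditioned on
  survival up to time \<open>s\<close>.\<close>

definition survival :: "'e fmeas \<Rightarrow> real \<Rightarrow> real" where
  "survival \<mu> s = measure (\<P> \<mu>) {\<omega> \<in> space (\<P> \<mu>). X s \<omega> \<noteq> 0}"

definition conditional_Laplace :: "'e fmeas \<Rightarrow> real \<Rightarrow> ('e \<Rightarrow> real) \<Rightarrow> real" where
  "conditional_Laplace \<mu> s f = (LINT \<omega>|given_alive (\<P> \<mu>) s. exp (- fmint (X s \<omega>) f))"

lemma sets_alive: "{\<omega> \<in> space (\<P> \<mu>). X s \<omega> \<noteq> 0} \<in> sets (\<P> \<mu>)"
proof -
  have "X s -` (- {0}) \<inter> space path_space \<in> sets (path_space :: (real \<Rightarrow> 'e fmeas) measure)"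
    by (intro measurable_sets[OF measurable_X] borel_comp sets_zero_fmeas)
  moreover have "{\<omega> \<in> space (\<P> \<mu>). X s \<omega> \<noteq> 0} = X s -` (- {0}) \<inter> space path_space"
    by (auto simp: space_law)
  ultimately show ?thesis by (simp add: sets_law)
qed

lemma measurable_X_law: "X s \<in> \<P> \<mu> \<rightarrow>\<^sub>M borel"
  using measurable_X by (simp add: measurable_cong_sets[OF sets_law refl])

lemma integrable_indicator_X: "integrable (\<P> \<mu>) (\<lambda>\<omega>. indicator {0} (X s \<omega>) :: real)"
proof -
  interpret prob_space "\<P> \<mu>" by (rule prob_space_law)
  have "(\<lambda>\<omega>. indicator {0} (X s \<omega>) :: real) \<in> borel_measurable (\<P> \<mu>)"
    by (rule measurable_compose[OF measurable_X_law]) (intro borel_measurable_indicator sets_zero_fmeas)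
  then show ?thesis by (intro integrable_const_bound[where B = 1]) auto
qed

lemma extinct_indicator:
  assumes "\<omega> \<in> space (\<P> \<mu>)"
  shows "indicator {\<omega> \<in> space (\<P> \<mu>). X s \<omega> \<noteq> 0} \<omega> = 1 - (indicator {0} (X s \<omega>) :: real)"
  using assms by (auto simp: indicator_def)

lemma survival_eq: "survival \<mu> s = 1 - (LINT \<omega>|\<P> \<mu>. indicator {0} (X s \<omega>))"
proof -
  interpret prob_space "\<P> \<mu>" by (rule prob_space_law)
  have "survival \<mu> s = (LINT \<omega>|\<P> \<mu>. indicator {\<omega> \<in> space (\<P> \<mu>). X s \<omega> \<noteq> 0} \<omega>)"
    unfolding survival_def using sets_alive by (simp add: Int_absorb1)
  also have "\<dots> = (LINT \<omega>|\<P> \<mu>. 1 - indicator {0} (X s \<omega>))"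
    by (intro Bochner_Integration.integral_cong extinct_indicator refl)
  also have "\<dots> = 1 - (LINT \<omega>|\<P> \<mu>. indicator {0} (X s \<omega>))"
    using integrable_indicator_X by (subst Bochner_Integration.integral_diff) (auto simp: prob_space)
  finally show ?thesis .
qed

lemma integral_given_alive:
  assumes "0 < survival \<mu> s" and g: "g \<in> borel_measurable (\<P> \<mu>)" "\<And>\<omega>. \<bar>g \<omega>\<bar> \<le> K"
  shows "(LINT \<omega>|given_alive (\<P> \<mu>) s. g \<omega>) =
    ((LINT \<omega>|\<P> \<mu>. g \<omega>) - (LINT \<omega>|\<P> \<mu>. g \<omega> * indicator {0} (X s \<omega>))) / survival \<mu> s"
proof -
  interpret prob_space "\<P> \<mu>" by (rule prob_space_law)
  have i: "integrable (\<P> \<mu>) g" using g by (intro integrable_const_bound[where B = K]) auto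
  have i': "integrable (\<P> \<mu>) (\<lambda>\<omega>. g \<omega> * indicator {0} (X s \<omega>))"
    using g(1) integrable_indicator_X[THEN borel_measurable_integrable] g(2)
    by (intro integrable_const_bound[where B = K] borel_measurable_times)
      (auto simp: indicator_def abs_mult intro: order_trans[OF abs_ge_zero])
  have "(LINT \<omega>|\<P> \<mu>. indicator {\<omega> \<in> space (\<P> \<mu>). X s \<omega> \<noteq> 0} \<omega> * g \<omega>) =
    (LINT \<omega>|\<P> \<mu>. g \<omega> - g \<omega> * indicator {0} (X s \<omega>))"
    by (intro Bochner_Integration.integral_cong refl) (simp add: extinct_indicator algebra_simps)
  also have "\<dots> = (LINT \<omega>|\<P> \<mu>. g \<omega>) - (LINT \<omega>|\<P> \<mu>. g \<omega> * indicator {0} (X s \<omega>))"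
    by (rule Bochner_Integration.integral_diff[OF i i'])
  finally show ?thesis
    using integral_uniform_measure[OF finite_measure_axioms sets_alive[of \<mu> s] _ g(1)] assms(1)
    by (simp add: given_alive_def survival_def)
qed

lemma conditional_Laplace_eq:
  assumes a: "0 < survival \<mu> s" and f: "f \<in> bpB"
  shows "1 - conditional_Laplace \<mu> s f = (1 - Laplace_X \<mu> s f) / survival \<mu> s"
proof -
  have "(LINT \<omega>|\<P> \<mu>. exp (- fmint (X s \<omega>) f) * indicator {0} (X s \<omega>)) = 1 - survival \<mu> s"
    unfolding survival_eq by (simp, intro Bochner_Integration.integral_cong refl) (auto simp: indicator_def)
  then have "conditional_Laplace \<mu> s f =
      (Laplace_X \<mu> s f - (1 - survival \<mu> s)) / survival \<mu> s"
    unfolding conditional_Laplace_def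
    using integral_given_alive[OF a measurable_exp_X[OF f], where K = 1] fmint_nonneg[OF f] by simp
  then show ?thesis using a by (simp add: field_simps)
qed

text \<open>If the survival probability vanished at \<open>t\<close>, then the conditional law would be the null measure, whose
  total mass is far from that of the limit.\<close>

lemma Yaglom_eventually_survival:
  assumes "Yaglom_limit \<P> R" "\<mu> \<noteq> 0"
  shows "\<forall>\<^sub>F s in at_top. 0 < survival \<mu> s"
proof -
  have R: "prob_space R" using assms(1) by (simp add: Yaglom_limit_def space_prob_algebra)
  have w: "weakly_converges euclidean (\<lambda>t. distr (given_alive (\<P> \<mu>) t) borel (X t)) R at_top"
    using assms by (simp add: Yaglom_limit_def)
  have "continuous_map euclidean euclideanreal (\<lambda>\<eta>::'e fmeas. 1 :: real) \<and> bounded ((\<lambda>\<eta>::'e fmeas. 1 :: real) ` topspace euclidean)"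
    by simp
  then have "((\<lambda>t. LINT \<eta>|distr (given_alive (\<P> \<mu>) t) borel (X t). 1 :: real) \<longlongrightarrow> (LINT \<eta>|R. 1)) at_top"
    using w unfolding weakly_converges_def by blast
  then have "((\<lambda>t. LINT \<eta>|distr (given_alive (\<P> \<mu>) t) borel (X t). 1 :: real) \<longlongrightarrow> 1) at_top"
    using prob_space.prob_space[OF R] by simp
  from order_tendstoD(1)[OF this, of 0]
  have "\<forall>\<^sub>F t in at_top. 0 < (LINT \<eta>|distr (given_alive (\<P> \<mu>) t) borel (X t). 1 :: real)" by simp
  then show ?thesis
  proof eventually_elim
    case (elim t)
    show ?case
    proof (rule ccontr)
      assume "\<not> 0 < survival \<mu> t"
      then have "measure (\<P> \<mu>) {\<omega> \<in> space (\<P> \<mu>). X t \<omega> \<noteq> 0} = 0"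
        unfolding survival_def using measure_nonneg[of "\<P> \<mu>"] by (metis less_eq_real_def)
      then have 0: "emeasure (\<P> \<mu>) {\<omega> \<in> space (\<P> \<mu>). X t \<omega> \<noteq> 0} = 0"
        using prob_space.finite_measure[OF prob_space_law[of \<mu>]]
        by (simp add: finite_measure.emeasure_eq_measure)
      have sp: "space (given_alive (\<P> \<mu>) t) = space (\<P> \<mu>)" by (simp add: given_alive_def uniform_measure_def)
      have "{\<omega> \<in> space (\<P> \<mu>). X t \<omega> \<noteq> 0} \<inter> space (\<P> \<mu>) = {\<omega> \<in> space (\<P> \<mu>). X t \<omega> \<noteq> 0}" by auto
      then have "emeasure (given_alive (\<P> \<mu>) t) (space (\<P> \<mu>)) = 0"
        unfolding given_alive_def space_law[symmetric] using sets_alive 0 by (simp add: given_alive_def space_law)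
      then have "measure (distr (given_alive (\<P> \<mu>) t) borel (X t)) (space borel) = 0"
        using measurable_X_law[of t \<mu>] sp
        by (subst measure_distr) (auto simp: measure_def given_alive_def uniform_measure_def)
      with elim show False by simp
    qed
  qed
qed

lemma Yaglom_continuous:
  assumes Y: "Yaglom_limit \<P> R" "\<mu> \<noteq> 0" and f: "f \<in> bpB" "continuous_on UNIV f"
  shows "((\<lambda>s. conditional_Laplace \<mu> s f) \<longlongrightarrow> (LINT \<eta>|R. exp (- fmint \<eta> f))) at_top"
proof -
  have "continuous_on UNIV (\<lambda>\<eta>. exp (- fmint \<eta> f))"
    by (intro continuous_intros continuous_fmint f bpB_bounded)
  moreover have "bounded (range (\<lambda>\<eta>. exp (- fmint \<eta> f)))"
    using fmint_nonneg[OF f(1)] by (auto simp: bounded_iff intro!: exI[of _ 1])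
  ultimately have "((\<lambda>t. LINT \<eta>|distr (given_alive (\<P> \<mu>) t) borel (X t). exp (- fmint \<eta> f)) \<longlongrightarrow>
      (LINT \<eta>|R. exp (- fmint \<eta> f))) at_top"
    using Y by (auto simp: Yaglom_limit_def weakly_converges_def)
  moreover have "(LINT \<eta>|distr (given_alive (\<P> \<mu>) t) borel (X t). exp (- fmint \<eta> f)) = conditional_Laplace \<mu> t f" for t
  proof -
    have "X t \<in> given_alive (\<P> \<mu>) t \<rightarrow>\<^sub>M borel"
      using measurable_X_law by (simp add: given_alive_def uniform_measure_def)
    moreover have "(\<lambda>\<eta>. exp (- fmint \<eta> f)) \<in> borel_measurable (borel :: 'e fmeas measure)"
      using measurable_fmint[OF f(1)] by measurable
    ultimately show ?thesis unfolding conditional_Laplace_def by (intro integral_distr)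
  qed
  ultimately show ?thesis by simp
qed

end

section \<open>Convergence of the Laplace functional at Borel functions\<close>

text \<open>The three estimates on the cumulant semigroup from which the limit theorem follows. By the first one,
  \<open>V\<^sub>t f\<close> is dominated by a multiple of \<open>\<phi>\<close> that does not depend on \<open>f\<close>, so a unit mass at \<open>x\<close> dies out
  before time \<open>t\<close> with probability at least \<open>exp (- K \<phi>(x))\<close>. The second one is a lower bound of the same
  order at a single time. The third one says that \<open>V\<^sub>1\<close> turns smallness in \<open>L\<^sup>1(\<nu>)\<close> into uniform smallness.\<close>

locale subcritical_superprocess = superprocess_laws +
  fixes \<phi> :: "'a \<Rightarrow> real" and \<nu> :: "'a fmeas"
  assumes phi_bpB: "\<phi> \<in> bpB"
    and V_upper: "\<And>t. 0 < t \<Longrightarrow> \<exists>K. \<forall>f\<in>bpB. \<forall>x. V t f x \<le> K * \<phi> x"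
    and V_lower: "\<exists>T\<ge>2. \<exists>c>0. \<forall>x. c * \<phi> x \<le> V T (\<lambda>_. 1) x"
    and V_smoothing: "\<exists>C\<ge>0. \<forall>h\<in>bpB. \<forall>x. V 1 h x \<le> C * fmint \<nu> h"
begin

text \<open>The function \<open>w\<close> is the cumulant of the extinction event: starting from \<open>\<mu>\<close>, the process is extinct at
  time \<open>t\<close> with probability \<open>exp (- \<mu>(w))\<close>.\<close>

lemma extinction_cumulant:
  assumes "0 < t"
  shows "\<exists>w\<in>bpB. (\<exists>K. \<forall>x. w x \<le> K * \<phi> x) \<and>
    (\<forall>s\<ge>0. \<forall>\<mu>. survival \<mu> (s + t) = 1 - Laplace_X \<mu> s w)"
proof -
  have "\<exists>w\<in>bpB. (\<exists>K. \<forall>x. w x \<le> K * \<phi> x) \<and> (\<forall>s\<ge>0. \<forall>\<mu>.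
    (LINT \<omega>|\<P> \<mu>. exp (- (\<Sum>t\<in>{t}. fmint (X (s + t) \<omega>) (\<lambda>_. 0))) * indicator {0} (X (s + t) \<omega>)) =
      Laplace_X \<mu> s w)"
    by (rule killed_cylinder_Laplace[OF V_upper phi_bpB]) (use assms in \<open>auto intro: bpB_const\<close>)
  then show ?thesis by (simp add: survival_eq)
qed

text \<open>The extinction cumulants at times \<open>T\<close> and \<open>T - 1\<close> are both comparable to \<open>\<phi>\<close>, the former from below
  and the latter from above. The Markov property and the concavity of \<open>1 - exp (- z)\<close> carry the comparison
  over to the survival probabilities.\<close>

lemma survival_ratio:
  "\<exists>C>0. \<exists>s0. \<forall>s\<ge>s0. survival \<mu> s \<le> C * survival \<mu> (s + 1)"
proof -
  obtain T c where T: "2 \<le> T" "0 < c" "\<And>x. c * \<phi> x \<le> V T (\<lambda>_. 1) x" using V_lower by blast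
  have one: "(\<lambda>_. 1 :: real) \<in> bpB" by (simp add: bpB_const)
  have T0: "0 < T" "0 < T - 1" using T(1) by auto
  obtain w where w: "w \<in> bpB"
    "\<And>s \<mu>. 0 \<le> s \<Longrightarrow> survival \<mu> (s + T) = 1 - Laplace_X \<mu> s w"
    using extinction_cumulant[OF T0(1)] by blast
  obtain u K where u: "u \<in> bpB" "\<And>x. u x \<le> K * \<phi> x"
    "\<And>s \<mu>. 0 \<le> s \<Longrightarrow> survival \<mu> (s + (T - 1)) = 1 - Laplace_X \<mu> s u"
    using extinction_cumulant[OF T0(2)] by blast
  have wT: "V T (\<lambda>_. 1) x \<le> w x" for x
  proof -
    have "1 - exp (- w x) = survival (dirac x) T"
      using w(2)[of 0 "dirac x"] integral_exp_X_0[OF w(1)] by (simp add: fmint_dirac_bpB[OF w(1)] del: meas_dirac)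
    moreover have "(LINT \<omega>|\<P> (dirac x). indicator {0} (X T \<omega>)) \<le> Laplace_X (dirac x) T (\<lambda>_. 1)"
      by (intro integral_mono integrable_indicator_X integrable_exp_X one) (auto simp: indicator_def)
    moreover have "\<dots> = exp (- V T (\<lambda>_. 1) x)"
      using integral_exp_X[of T "\<lambda>_. 1" "dirac x"] T one V_bpB[OF _ one, of T]
      by (simp add: fmint_dirac_bpB del: meas_dirac lebesgue_integral_const)
    ultimately have "exp (- w x) \<le> exp (- V T (\<lambda>_. 1) x)" by (simp add: survival_eq)
    then show ?thesis by simp
  qed
  define d where "d = min 1 (c / (\<bar>K\<bar> + 1))"
  have d: "0 < d" "d \<le> 1" using T(2) by (auto simp: d_def)
  have duw: "d * u x \<le> w x" for x
  proof -
    have "d * u x \<le> d * ((\<bar>K\<bar> + 1) * \<phi> x)"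
      using d order_trans[OF u(2)[of x] mult_right_mono[of K "\<bar>K\<bar> + 1" "\<phi> x"]] bpBD(2)[OF phi_bpB]
      by (intro mult_left_mono) auto
    also have "\<dots> \<le> c / (\<bar>K\<bar> + 1) * ((\<bar>K\<bar> + 1) * \<phi> x)"
      using bpBD(2)[OF phi_bpB, of x] by (intro mult_right_mono) (auto simp: d_def)
    also have "\<dots> = c * \<phi> x" by (simp add: add_nonneg_eq_0_iff)
    finally show ?thesis using T(3)[of x] wT[of x] by simp
  qed
  have du: "(\<lambda>x. d * u x) \<in> bpB" using d u by (intro bpB_cmult) auto
  have decay: "d * survival \<mu> s \<le> survival \<mu> (s + 1)" if s: "T - 1 \<le> s" for s
  proof -
    interpret prob_space "\<P> \<mu>" by (rule prob_space_law)
    define r where "r = s - (T - 1)"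
    have r: "0 \<le> r" "r + (T - 1) = s" "r + T = s + 1" using s by (auto simp: r_def)
    have "d * survival \<mu> s = (LINT \<omega>|\<P> \<mu>. d * (1 - exp (- fmint (X r \<omega>) u)))"
      using u(3)[OF r(1), of \<mu>] r(2) integrable_exp_X[OF u(1), of \<mu> r] by (simp add: prob_space)
    also have "\<dots> \<le> (LINT \<omega>|\<P> \<mu>. 1 - exp (- fmint (X r \<omega>) w))"
    proof (intro integral_mono)
      fix \<omega>
      have "d * (1 - exp (- fmint (X r \<omega>) u)) \<le> 1 - exp (- (d * fmint (X r \<omega>) u))"
        by (rule exp_minus_scaling) (use d in auto)
      also have "\<dots> \<le> 1 - exp (- fmint (X r \<omega>) w)"
        using fmint_mono[OF du w(1) duw, of "X r \<omega>"] by simp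
      finally show "d * (1 - exp (- fmint (X r \<omega>) u)) \<le> 1 - exp (- fmint (X r \<omega>) w)" .
    qed (use integrable_exp_X[OF u(1), of \<mu> r] integrable_exp_X[OF w(1), of \<mu> r] in simp_all)
    also have "\<dots> = survival \<mu> (s + 1)"
      using w(2)[OF r(1), of \<mu>] r(3) integrable_exp_X[OF w(1), of \<mu> r] by (simp add: prob_space)
    finally show ?thesis .
  qed
  have "survival \<mu> s \<le> inverse d * survival \<mu> (s + 1)" if "T - 1 \<le> s" for s
    using decay[OF that] d by (simp add: field_simps)
  then show ?thesis using d by (intro exI[of _ "inverse d"]) auto
qed

text \<open>Uniform smallness: under the conditional law, \<open>\<eta>(h)\<close> is controlled by \<open>\<epsilon> \<eta>(1)\<close> one unit of
  time earlier, where \<open>\<epsilon>\<close> is proportional to \<open>\<nu>(h)\<close>. The bound on the right only involves a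
  continuous function, so the weak Yaglom limit applies to it.\<close>

lemma conditional_Laplace_smoothing:
  assumes a: "0 < survival \<mu> s" "0 < survival \<mu> (s + 1)" and C: "survival \<mu> s \<le> C * survival \<mu> (s + 1)"
    and s: "0 \<le> s" and h: "h \<in> bpB" and e: "0 \<le> \<epsilon>" "\<And>x. V 1 h x \<le> \<epsilon>"
  shows "1 - conditional_Laplace \<mu> (s + 1) h \<le> C * (1 - conditional_Laplace \<mu> s (\<lambda>_. \<epsilon>))"
proof -
  interpret prob_space "\<P> \<mu>" by (rule prob_space_law)
  have eB: "(\<lambda>_. \<epsilon>) \<in> bpB" by (rule bpB_const[OF e(1)])
  have VB: "V 1 h \<in> bpB" by (rule V_bpB[OF _ h]) simp
  define A where "A = 1 - Laplace_X \<mu> s (\<lambda>_. \<epsilon>)"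
  have "Laplace_X \<mu> s (\<lambda>_. \<epsilon>) \<le> Laplace_X \<mu> s (V 1 h)"
    using fmint_mono[OF VB eB e(2)] by (intro integral_mono integrable_exp_X eB VB) simp
  also have "\<dots> = Laplace_X \<mu> (s + 1) h"
    using s h by (intro integral_exp_X_add[symmetric]) auto
  finally have 1: "1 - Laplace_X \<mu> (s + 1) h \<le> A" by (simp add: A_def)
  have "Laplace_X \<mu> s (\<lambda>_. \<epsilon>) \<le> (LINT \<omega>|\<P> \<mu>. 1)"
    using fmint_nonneg[OF eB] by (intro integral_mono integrable_exp_X eB) (auto simp: prob_space)
  then have A: "0 \<le> A" by (simp add: A_def prob_space)
  have "1 - conditional_Laplace \<mu> (s + 1) h \<le> A / survival \<mu> (s + 1)"
    unfolding conditional_Laplace_eq[OF a(2) h] using 1 a by (intro divide_right_mono) auto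
  also have "\<dots> = A / survival \<mu> s * (survival \<mu> s / survival \<mu> (s + 1))" using a by simp
  also have "\<dots> \<le> A / survival \<mu> s * C"
    using A a C by (intro mult_left_mono) (auto simp: field_simps)
  also have "A / survival \<mu> s = 1 - conditional_Laplace \<mu> s (\<lambda>_. \<epsilon>)"
    unfolding conditional_Laplace_eq[OF a(1) eB] A_def by simp
  finally show ?thesis by (simp add: mult.commute)
qed

end

text \<open>A kernel whose mixture under a probability measure \<open>R\<close> is the finite measure
  \<open>B \<mapsto> \<integral> \<eta>(B) / (1 + \<eta>(E)) R(d\<eta>)\<close>. Convergence in \<open>L\<^sup>1\<close> of this measure implies
  convergence of \<open>\<eta>(f)\<close> in \<open>R\<close>-probability; unlike the intensity of \<open>R\<close> it is always finite.\<close>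

definition intensity_kernel :: "'e::polish_space fmeas \<Rightarrow> 'e measure" where
  "intensity_kernel \<eta> = density (meas \<eta>) (\<lambda>_. ennreal (1 / (1 + fmint \<eta> (\<lambda>_. 1))))"

lemma nn_integral_intensity_kernel:
  assumes "h \<in> bpB"
  shows "(\<integral>\<^sup>+x. ennreal (h x) \<partial>intensity_kernel \<eta>) = ennreal (fmint \<eta> h / (1 + fmint \<eta> (\<lambda>_. 1)))"
proof -
  have hm: "h \<in> borel_measurable (meas \<eta>)" using bpBD(1)[OF assms] by simp
  have "(\<integral>\<^sup>+x. ennreal (h x) \<partial>intensity_kernel \<eta>) =
      (\<integral>\<^sup>+x. ennreal (1 / (1 + fmint \<eta> (\<lambda>_. 1))) * ennreal (h x) \<partial>meas \<eta>)"
    unfolding intensity_kernel_def using hm by (intro nn_integral_density) auto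
  also have "\<dots> = ennreal (1 / (1 + fmint \<eta> (\<lambda>_. 1))) * ennreal (fmint \<eta> h)"
    using hm nn_integral_bpB[OF assms] by (subst nn_integral_cmult) auto
  also have "\<dots> = ennreal (fmint \<eta> h / (1 + fmint \<eta> (\<lambda>_. 1)))"
    using fmint_nonneg[OF assms] by (simp flip: ennreal_mult)
  finally show ?thesis .
qed

lemma measurable_intensity_kernel: "intensity_kernel \<in> borel \<rightarrow>\<^sub>M subprob_algebra borel"
proof (rule measurable_subprob_algebra)
  have one: "(\<lambda>_. 1 :: real) \<in> (bpB :: ('a \<Rightarrow> real) set)" by (simp add: bpB_const)
  have ind: "indicator B \<in> (bpB :: ('a \<Rightarrow> real) set)" if "B \<in> sets borel" for B
    using that by (intro bpBI[where K = 1]) (auto simp: indicator_def)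
  have e: "emeasure (intensity_kernel \<eta>) B = ennreal (fmint \<eta> (indicator B) / (1 + fmint \<eta> (\<lambda>_. 1)))"
    if B: "B \<in> sets borel" for \<eta> :: "'a fmeas" and B
  proof -
    have "B \<in> sets (intensity_kernel \<eta>)" using B by (simp add: intensity_kernel_def)
    then have "emeasure (intensity_kernel \<eta>) B = (\<integral>\<^sup>+x. ennreal (indicator B x) \<partial>intensity_kernel \<eta>)"
      unfolding ennreal_indicator by (rule nn_integral_indicator[symmetric])
    then show ?thesis by (simp only: nn_integral_intensity_kernel[OF ind[OF B]])
  qed
  show "subprob_space (intensity_kernel \<eta>)" for \<eta> :: "'a fmeas"
  proof (rule subprob_spaceI)
    have sp: "space (intensity_kernel \<eta>) = UNIV" by (simp add: intensity_kernel_def)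
    have "m / (1 + m) \<le> 1" if "0 \<le> m" for m :: real using that by (simp add: divide_le_eq)
    from this[OF measure_nonneg[of "meas \<eta>" UNIV]]
    have "fmint \<eta> (indicator UNIV) / (1 + fmint \<eta> (\<lambda>_. 1)) \<le> 1" by simp
    then show "emeasure (intensity_kernel \<eta>) (space (intensity_kernel \<eta>)) \<le> 1"
      unfolding sp e[OF sets.top[of borel, unfolded space_borel]] by (simp only: ennreal_le_1)
    show "space (intensity_kernel \<eta>) \<noteq> {}" by (simp add: sp)
  qed
  show "sets (intensity_kernel \<eta>) = sets borel" for \<eta> :: "'a fmeas" by (simp add: intensity_kernel_def)
  fix B :: "'a set" assume B: "B \<in> sets borel"
  have "(\<lambda>\<eta>. ennreal (fmint \<eta> (indicator B) / (1 + fmint \<eta> (\<lambda>_. 1)))) \<in> borel_measurable borel"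
    using measurable_fmint[OF ind[OF B]] measurable_fmint[OF one] by measurable
  then show "(\<lambda>\<eta>. emeasure (intensity_kernel \<eta>) B) \<in> borel_measurable borel"
    by (simp only: e[OF B])
qed

text \<open>On \<open>{\<eta>. \<eta>(E) \<le> r}\<close> the integrand is at most \<open>\<eta>(h) \<le> (1 + r) \<eta>(h) / (1 + \<eta>(E))\<close>, elsewhere at most 1.\<close>

lemma Laplace_intensity_bound:
  fixes R :: "'e::polish_space fmeas measure"
  assumes R: "prob_space R" "sets R = sets borel" and r: "0 \<le> r" and h: "h \<in> bpB"
  shows "1 - (LINT \<eta>|R. exp (- fmint \<eta> h)) \<le>
    (1 + r) * (LINT x|(R \<bind> intensity_kernel). h x) + measure R {\<eta>. r < fmint \<eta> (\<lambda>_. 1)}"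
proof -
  interpret prob_space R by fact
  have spR: "space R = UNIV" using sets_eq_imp_space_eq[OF R(2)] by simp
  have one: "(\<lambda>_. 1 :: real) \<in> (bpB :: ('e \<Rightarrow> real) set)" by (simp add: bpB_const)
  note [measurable] = measurable_fmint[OF h] measurable_fmint[OF one]
  have mR: "g \<in> borel_measurable R \<longleftrightarrow> g \<in> borel_measurable borel" for g :: "'e fmeas \<Rightarrow> real"
    by (simp add: measurable_cong_sets[OF R(2) refl])
  define q where "q = (\<lambda>\<eta>. fmint \<eta> h / (1 + fmint \<eta> (\<lambda>_. 1)))"
  have q0: "0 \<le> q \<eta>" for \<eta> using fmint_nonneg[OF h] fmint_nonneg[OF one] by (simp add: q_def)
  obtain K where K: "0 \<le> K" "\<And>x. h x \<le> K" using bpBD(3)[OF h] by blast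
  have qK: "q \<eta> \<le> K" for \<eta>
  proof -
    have "fmint \<eta> h \<le> fmint \<eta> (\<lambda>_. K)" by (rule fmint_mono[OF h bpB_const[OF K(1)] K(2)])
    also have "\<dots> \<le> K * (1 + fmint \<eta> (\<lambda>_. 1))" using K by (simp add: algebra_simps)
    finally have *: "fmint \<eta> h \<le> K * (1 + fmint \<eta> (\<lambda>_. 1))" .
    have "0 < 1 + fmint \<eta> (\<lambda>_. 1)" using fmint_nonneg[OF one, of \<eta>] by linarith
    from pos_divide_le_eq[OF this] * show ?thesis unfolding q_def by blast
  qed
  have qm: "q \<in> borel_measurable R" unfolding q_def mR by measurable
  have qi: "integrable R q" using qm q0 qK by (intro integrable_const_bound[where B = K]) auto
  have m: "intensity_kernel \<in> R \<rightarrow>\<^sub>M subprob_algebra borel"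
    using measurable_intensity_kernel by (simp add: measurable_cong_sets[OF R(2) refl])
  have "(\<integral>\<^sup>+x. ennreal (h x) \<partial>(R \<bind> intensity_kernel)) = (\<integral>\<^sup>+\<eta>. \<integral>\<^sup>+x. ennreal (h x) \<partial>intensity_kernel \<eta> \<partial>R)"
    using bpBD(1)[OF h] by (intro nn_integral_bind[OF _ m]) simp
  also have "\<dots> = (\<integral>\<^sup>+\<eta>. ennreal (q \<eta>) \<partial>R)" by (simp add: nn_integral_intensity_kernel[OF h] q_def)
  also have "\<dots> = ennreal (LINT \<eta>|R. q \<eta>)" using qi q0 by (intro nn_integral_eq_integral) auto
  finally have k: "(\<integral>\<^sup>+x. ennreal (h x) \<partial>(R \<bind> intensity_kernel)) = ennreal (LINT \<eta>|R. q \<eta>)" .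
  have "(LINT x|(R \<bind> intensity_kernel). h x) = enn2real (\<integral>\<^sup>+x. ennreal (h x) \<partial>(R \<bind> intensity_kernel))"
  proof (rule integral_eq_nn_integral)
    have "sets (R \<bind> intensity_kernel) = sets borel"
      by (intro sets_bind) (auto simp: intensity_kernel_def spR)
    then show "h \<in> borel_measurable (R \<bind> intensity_kernel)"
      using bpBD(1)[OF h] by (simp cong: measurable_cong_sets)
  qed (auto simp: bpBD(2)[OF h])
  then have kq: "(LINT x|(R \<bind> intensity_kernel). h x) = (LINT \<eta>|R. q \<eta>)"
    unfolding k using q0 by (simp add: integral_nonneg_AE)
  have S: "{\<eta>. r < fmint \<eta> (\<lambda>_. 1)} \<in> sets R"
  proof -
    have "{\<eta> :: 'e fmeas. r < fmint \<eta> (\<lambda>_. 1)} = {\<eta> \<in> space borel. r < fmint \<eta> (\<lambda>_. 1)}" by simp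
    also have "\<dots> \<in> sets borel" by measurable
    finally show ?thesis by (simp add: R(2))
  qed
  have i1: "integrable R (\<lambda>\<eta>. exp (- fmint \<eta> h))"
    using fmint_nonneg[OF h] by (intro integrable_const_bound[where B = 1]) (auto simp: mR)
  have "1 - (LINT \<eta>|R. exp (- fmint \<eta> h)) = (LINT \<eta>|R. 1 - exp (- fmint \<eta> h))"
    using i1 by (simp add: prob_space)
  also have "\<dots> \<le> (LINT \<eta>|R. (1 + r) * q \<eta> + indicator {\<eta>. r < fmint \<eta> (\<lambda>_. 1)} \<eta>)"
  proof (intro integral_mono)
    fix \<eta> :: "'e fmeas"
    have p: "0 \<le> fmint \<eta> (\<lambda>_. 1)" by (rule fmint_nonneg[OF one])
    show "1 - exp (- fmint \<eta> h) \<le> (1 + r) * q \<eta> + indicator {\<eta>. r < fmint \<eta> (\<lambda>_. 1)} \<eta>"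
    proof (cases "r < fmint \<eta> (\<lambda>_. 1)")
      case True
      have "0 \<le> (1 + r) * q \<eta>" using r q0 by simp
      then show ?thesis using True by (simp add: add_increasing)
    next
      case False
      have "1 - exp (- fmint \<eta> h) \<le> fmint \<eta> h" using exp_ge_add_one_self[of "- fmint \<eta> h"] by simp
      also have "\<dots> = (1 + fmint \<eta> (\<lambda>_. 1)) * q \<eta>"
      proof -
        have "1 + fmint \<eta> (\<lambda>_. 1) \<noteq> 0" using p by linarith
        then show ?thesis unfolding q_def by (simp del: lebesgue_integral_const)
      qed
      also have "\<dots> \<le> (1 + r) * q \<eta>" using False q0 by (intro mult_right_mono) auto
      finally show ?thesis using False by simp
    qed
  qed (use i1 qi S in \<open>auto intro!: integrable_add integrable_indicator simp: emeasure_eq_measure\<close>)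
  also have "\<dots> = (1 + r) * (LINT \<eta>|R. q \<eta>) + measure R {\<eta>. r < fmint \<eta> (\<lambda>_. 1)}"
    using qi S by (subst Bochner_Integration.integral_add) (auto simp: spR emeasure_eq_measure)
  finally show ?thesis unfolding kq .
qed

context subcritical_superprocess
begin

text \<open>The Yaglom limit holds for the Laplace functional at every bounded Borel function \<open>f\<close>: approximate \<open>f\<close> by a
  continuous \<open>g\<close>, simultaneously in \<open>L\<^sup>1(\<nu>)\<close>, which controls the conditional laws, and in \<open>L\<^sup>1\<close> of the
  measure \<open>\<kappa>\<close> built from the kernel above, which controls the limit.\<close>

lemma Yaglom_Borel:
  assumes Y: "Yaglom_limit \<P> R" and mu: "\<mu> \<noteq> 0" and f: "f \<in> bpB"
  shows "((\<lambda>s. conditional_Laplace \<mu> s f) \<longlongrightarrow> (LINT \<eta>|R. exp (- fmint \<eta> f))) at_top"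
proof (rule tendstoI)
  fix e :: real assume e: "0 < e"
  have R: "prob_space R" "sets R = sets borel" using Y by (auto simp: Yaglom_limit_def space_prob_algebra)
  interpret R: prob_space R by fact
  have spR: "space R = UNIV" using sets_eq_imp_space_eq[OF R(2)] by simp
  define I where "I = (\<lambda>g. LINT \<eta>|R. exp (- fmint \<eta> g))"
  have exp_meas: "(\<lambda>\<eta>. exp (- fmint \<eta> g)) \<in> borel_measurable R" if "g \<in> bpB" for g :: "'a \<Rightarrow> real"
    using measurable_fmint[OF that] by (simp add: measurable_cong_sets[OF R(2) refl])
  have exp_int: "integrable R (\<lambda>\<eta>. exp (- fmint \<eta> g))" if "g \<in> bpB" for g :: "'a \<Rightarrow> real"
    using exp_meas[OF that] fmint_nonneg[OF that] by (intro R.integrable_const_bound[where B = 1]) auto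
  obtain C s0 where C: "0 < C" "\<And>s. s0 \<le> s \<Longrightarrow> survival \<mu> s \<le> C * survival \<mu> (s + 1)"
    using survival_ratio by blast
  obtain c where c: "0 \<le> c" "\<And>h x. h \<in> bpB \<Longrightarrow> V 1 h x \<le> c * fmint \<nu> h" using V_smoothing by blast
  \<comment> \<open>\<open>\<epsilon>\<close> makes the bound of the smoothing lemma small in the limit, \<open>r\<close> cuts off large total masses\<close>
  obtain \<epsilon> where \<epsilon>: "0 < \<epsilon>" "C * (1 - I (\<lambda>_. \<epsilon>)) < e / 8"
  proof -
    have "(\<lambda>n. I (\<lambda>_. inverse (real (Suc n)))) \<longlonglongrightarrow> (LINT \<eta>|R. 1)"
      unfolding I_def
    proof (rule integral_dominated_convergence[where w = "\<lambda>_. 1"])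
      show "AE \<eta> in R. (\<lambda>n. exp (- fmint \<eta> (\<lambda>_. inverse (real (Suc n))))) \<longlonglongrightarrow> 1"
      proof (rule AE_I2)
        fix \<eta> :: "'a fmeas"
        have "(\<lambda>n. exp (- (inverse (real (Suc n)) * measure (meas \<eta>) UNIV))) \<longlonglongrightarrow> exp (- (0 * measure (meas \<eta>) UNIV))"
          by (intro tendsto_intros LIMSEQ_inverse_real_of_nat)
        then show "(\<lambda>n. exp (- fmint \<eta> (\<lambda>_. inverse (real (Suc n))))) \<longlonglongrightarrow> 1"
          by (simp add: mult.commute)
      qed
      show "(\<lambda>\<eta>. exp (- fmint \<eta> (\<lambda>_. inverse (real (Suc n))))) \<in> borel_measurable R" for n
        by (intro exp_meas bpB_const) simp
      show "AE \<eta> in R. norm (exp (- fmint \<eta> (\<lambda>_. inverse (real (Suc n))))) \<le> 1" for n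
        using fmint_nonneg[OF bpB_const[of "inverse (real (Suc n))"]] by (intro AE_I2) simp
    qed auto
    then have "(\<lambda>n. C * (1 - I (\<lambda>_. inverse (real (Suc n))))) \<longlonglongrightarrow> C * (1 - 1)"
      by (intro tendsto_intros) (simp add: R.prob_space)
    then have "\<forall>\<^sub>F n in sequentially. C * (1 - I (\<lambda>_. inverse (real (Suc n)))) < e / 8"
      using e by (intro order_tendstoD) auto
    then obtain n where "C * (1 - I (\<lambda>_. inverse (real (Suc n)))) < e / 8"
      using eventually_happens by force
    then show thesis by (intro that[of "inverse (real (Suc n))"]) auto
  qed
  obtain r :: real where r: "0 \<le> r" "measure R {\<eta>. r < fmint \<eta> (\<lambda>_. 1)} < e / 8"
  proof -
    define S where "S = (\<lambda>n::nat. {\<eta> :: 'a fmeas. real n < fmint \<eta> (\<lambda>_. 1)})"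
    have "(\<lambda>\<eta> :: 'a fmeas. fmint \<eta> (\<lambda>_. 1)) \<in> borel_measurable borel"
      by (intro measurable_fmint bpB_const) simp
    then have "{\<eta> \<in> space borel. real n < fmint \<eta> (\<lambda>_. 1)} \<in> sets (borel :: 'a fmeas measure)" for n
      by measurable
    then have "range S \<subseteq> sets R" by (auto simp: S_def R(2))
    moreover have "decseq S" by (auto simp: S_def decseq_def)
    ultimately have "(\<lambda>n. measure R (S n)) \<longlonglongrightarrow> measure R (\<Inter>n. S n)"
      by (rule R.finite_Lim_measure_decseq)
    moreover have "(\<Inter>n. S n) = {}"
    proof -
      have "\<exists>n. \<eta> \<notin> S n" for \<eta>
        using reals_Archimedean2[of "fmint \<eta> (\<lambda>_. 1)"] unfolding S_def by (auto intro: less_imp_le simp: not_less)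
      then show ?thesis by blast
    qed
    ultimately have "\<forall>\<^sub>F n in sequentially. measure R (S n) < e / 8"
      using e by (intro order_tendstoD) auto
    then obtain n where "measure R (S n) < e / 8" using eventually_happens by force
    then show thesis by (intro that[of "real n"]) (auto simp: S_def)
  qed
  define \<kappa> where "\<kappa> = R \<bind> intensity_kernel"
  have m: "intensity_kernel \<in> R \<rightarrow>\<^sub>M subprob_algebra borel"
    using measurable_intensity_kernel by (simp add: measurable_cong_sets[OF R(2) refl])
  have \<kappa>: "finite_measure \<kappa>" "sets \<kappa> = sets borel"
  proof -
    show "finite_measure \<kappa>" unfolding \<kappa>_def
      using subprob_space_bind[OF prob_space_imp_subprob_space[OF R(1)] m]
      by (simp add: subprob_space_def)
    show "sets \<kappa> = sets borel" unfolding \<kappa>_def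
      by (intro sets_bind) (auto simp: intensity_kernel_def spR)
  qed
  define d where "d = min (\<epsilon> / (c + 1)) (e / (8 * (1 + r)))"
  have d: "0 < d" using \<epsilon> c e r by (simp add: d_def)
  obtain g where g: "continuous_on UNIV g" "g \<in> bpB"
    "(LINT x|meas \<nu>. \<bar>f x - g x\<bar>) < d" "(LINT x|\<kappa>. \<bar>f x - g x\<bar>) < d"
    using continuous_L1_approximation[OF finite_measure_meas sets_meas \<kappa> f d] by metis
  define h where "h = (\<lambda>x. \<bar>f x - g x\<bar>)"
  have hB: "h \<in> bpB" unfolding h_def by (rule bpB_abs_diff[OF f g(2)])
  have V1: "V 1 h x \<le> \<epsilon>" for x
  proof -
    have "V 1 h x \<le> c * fmint \<nu> h" by (rule c(2)[OF hB])
    also have "\<dots> \<le> (c + 1) * (\<epsilon> / (c + 1))"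
    proof (rule mult_mono)
      show "fmint \<nu> h \<le> \<epsilon> / (c + 1)" using g(3) by (simp add: h_def d_def)
    qed (use c fmint_nonneg[OF hB] in auto)
    also have "\<dots> = \<epsilon>" using c by simp
    finally show ?thesis .
  qed
  have Ih: "1 - I h < e / 4"
  proof -
    have "(1 + r) * (LINT x|\<kappa>. h x) \<le> (1 + r) * (e / (8 * (1 + r)))"
      using g(4) r by (intro mult_left_mono) (auto simp: h_def d_def)
    also have "\<dots> = e / 8"
    proof -
      have "1 + r \<noteq> 0" using r by simp
      then show ?thesis by (simp del: distrib_left_numeral)
    qed
    finally show ?thesis
      using Laplace_intensity_bound[OF R r(1) hB] r(2) unfolding I_def \<kappa>_def by linarith
  qed
  have "\<bar>I f - I g\<bar> \<le> 1 - I h"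
  proof -
    have "I f - I g = (LINT \<eta>|R. exp (- fmint \<eta> f) - exp (- fmint \<eta> g))"
      unfolding I_def using exp_int[OF f] exp_int[OF g(2)] by simp
    also have "\<bar>\<dots>\<bar> \<le> (LINT \<eta>|R. \<bar>exp (- fmint \<eta> f) - exp (- fmint \<eta> g)\<bar>)" by (rule integral_abs_bound)
    also have "\<dots> \<le> (LINT \<eta>|R. 1 - exp (- fmint \<eta> h))"
      using exp_fmint_diff[OF f g(2)] exp_int[OF f] exp_int[OF g(2)] exp_int[OF hB]
      unfolding h_def by (intro integral_mono) auto
    also have "\<dots> = 1 - I h" unfolding I_def using exp_int[OF hB] by (simp add: R.prob_space)
    finally show ?thesis .
  qed
  with Ih have Ifg: "\<bar>I f - I g\<bar> < e / 4" by simp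
  have ev_g: "\<forall>\<^sub>F s in at_top. \<bar>conditional_Laplace \<mu> s g - I g\<bar> < e / 4"
    using tendstoD[OF Yaglom_continuous[OF Y mu g(2,1)], of "e / 4"] e by (simp add: I_def dist_real_def)
  have "((\<lambda>s. C * (1 - conditional_Laplace \<mu> s (\<lambda>_. \<epsilon>))) \<longlongrightarrow> C * (1 - I (\<lambda>_. \<epsilon>))) at_top"
    unfolding I_def using \<epsilon> by (intro tendsto_intros Yaglom_continuous[OF Y mu] bpB_const) auto
  then have "\<forall>\<^sub>F s in at_top. C * (1 - conditional_Laplace \<mu> s (\<lambda>_. \<epsilon>)) < e / 8"
    using \<epsilon>(2) by (rule order_tendstoD)
  moreover have pos: "\<forall>\<^sub>F s in at_top. 0 < survival \<mu> s" by (rule Yaglom_eventually_survival[OF Y mu])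
  ultimately have "\<forall>\<^sub>F s in at_top. C * (1 - conditional_Laplace \<mu> (s - 1) (\<lambda>_. \<epsilon>)) < e / 8 \<and> 0 < survival \<mu> (s - 1)"
  proof -
    assume "\<forall>\<^sub>F s in at_top. C * (1 - conditional_Laplace \<mu> s (\<lambda>_. \<epsilon>)) < e / 8"
      "\<forall>\<^sub>F s in at_top. 0 < survival \<mu> s"
    then have "\<forall>\<^sub>F s in at_top. C * (1 - conditional_Laplace \<mu> s (\<lambda>_. \<epsilon>)) < e / 8 \<and> 0 < survival \<mu> s"
      by (rule eventually_conj)
    then obtain N where "\<And>s. N \<le> s \<Longrightarrow> C * (1 - conditional_Laplace \<mu> s (\<lambda>_. \<epsilon>)) < e / 8 \<and> 0 < survival \<mu> s"
      by (auto simp: eventually_at_top_linorder)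
    then show ?thesis unfolding eventually_at_top_linorder by (intro exI[of _ "N + 1"]) auto
  qed
  with ev_g pos eventually_ge_at_top[of "max 1 (s0 + 1)"]
  show "\<forall>\<^sub>F s in at_top. dist (conditional_Laplace \<mu> s f) (LINT \<eta>|R. exp (- fmint \<eta> f)) < e"
  proof eventually_elim
    case (elim s)
    interpret prob_space "\<P> \<mu>" by (rule prob_space_law)
    define L where "L = (\<lambda>g. LINT \<omega>|\<P> \<mu>. exp (- fmint (X s \<omega>) g))"
    have "1 - conditional_Laplace \<mu> (s - 1 + 1) h \<le> C * (1 - conditional_Laplace \<mu> (s - 1) (\<lambda>_. \<epsilon>))"
      using elim C(2)[of "s - 1"] \<epsilon>(1) V1 by (intro conditional_Laplace_smoothing[OF _ _ _ _ hB]) auto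
    then have h8: "1 - conditional_Laplace \<mu> s h < e / 8" using elim by simp
    have eq: "conditional_Laplace \<mu> s u = 1 - (1 - L u) / survival \<mu> s" if "u \<in> bpB" for u
      using conditional_Laplace_eq[OF elim(2) that] by (simp add: L_def)
    have "\<bar>L f - L g\<bar> \<le> 1 - L h"
    proof -
      have "L f - L g = (LINT \<omega>|\<P> \<mu>. exp (- fmint (X s \<omega>) f) - exp (- fmint (X s \<omega>) g))"
        unfolding L_def using integrable_exp_X[OF f] integrable_exp_X[OF g(2)] by simp
      also have "\<bar>\<dots>\<bar> \<le> (LINT \<omega>|\<P> \<mu>. \<bar>exp (- fmint (X s \<omega>) f) - exp (- fmint (X s \<omega>) g)\<bar>)"
        by (rule integral_abs_bound)
      also have "\<dots> \<le> (LINT \<omega>|\<P> \<mu>. 1 - exp (- fmint (X s \<omega>) h))"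
        using exp_fmint_diff[OF f g(2)] integrable_exp_X[OF f] integrable_exp_X[OF g(2)] integrable_exp_X[OF hB]
        unfolding h_def by (intro integral_mono) auto
      also have "\<dots> = 1 - L h" unfolding L_def using integrable_exp_X[OF hB] by (simp add: prob_space)
      finally show ?thesis .
    qed
    then have "\<bar>L f - L g\<bar> / survival \<mu> s \<le> (1 - L h) / survival \<mu> s"
      using elim by (intro divide_right_mono) auto
    moreover have "conditional_Laplace \<mu> s f - conditional_Laplace \<mu> s g = (L f - L g) / survival \<mu> s"
      unfolding eq[OF f] eq[OF g(2)] by (simp add: diff_divide_distrib)
    ultimately have "\<bar>conditional_Laplace \<mu> s f - conditional_Laplace \<mu> s g\<bar> \<le> 1 - conditional_Laplace \<mu> s h"
      unfolding eq[OF hB] using elim by (simp add: abs_divide)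
    then show ?case using elim(1) Ifg h8 e unfolding I_def dist_real_def by linarith
  qed
qed

end

section \<open>Estimates on the cumulant semigroup\<close>

lemma bpB_L1_plus: "prob_space (meas \<nu>) \<Longrightarrow> f \<in> bpB \<Longrightarrow> f \<in> L1_plus (meas \<nu>)"
  unfolding L1_plus_def by (auto simp: bpBD nn_integral_bpB)

text \<open>Up to constants depending on \<open>t\<close>, the mean semigroup \<open>T\<^sub>t f\<close> is comparable to \<open>P\<^sub>t f\<close>, \<open>V\<^sub>t f\<close> is at most
  \<open>P\<^sub>t f\<close>, and \<open>V\<^sub>t 1\<close> is at least \<open>P\<^sub>t 1\<close>. Hence the asymptotics of \<open>T\<^sub>t\<close> yield \<open>V\<^sub>t f \<le> C \<phi> \<nu>(f)\<close> for all \<open>t > 0\<close>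
  and \<open>V\<^sub>T 1 \<ge> c \<phi>\<close> for some large \<open>T\<close>. The first bound becomes uniform in \<open>f\<close> by the semigroup property, because
  \<open>\<nu>(V\<^sub>t f)\<close> is at most \<open>- ln P\<^sub>\<nu>(X\<^sub>t = 0)\<close>.\<close>

lemma cumulant_bounds:
  fixes P :: "real \<Rightarrow> 'e::polish_space \<Rightarrow> 'e measure"
    and W :: "'w measure" and \<P>\<^sub>\<xi> :: "'e \<Rightarrow> 'w measure"
    and \<nu> :: "'e fmeas"
  assumes motion: "right_process P W \<P>\<^sub>\<xi> \<xi> \<zeta>"
    and branching: "branching_data \<beta> \<sigma> \<pi>"
    and cumulant: "cumulant_semigroup P (branching_mechanism \<beta> \<sigma> \<pi>) V"
    and laws: "superprocess_laws V Q \<P>"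
    and phi: "\<phi> \<in> bpB" and nu: "prob_space (meas \<nu>)"
    and H: "\<And>t x f. 0 < t \<Longrightarrow> f \<in> L1_plus (meas \<nu>) \<Longrightarrow>
      mean_semigroup \<P>\<^sub>\<xi> \<xi> \<zeta> \<beta> t f x < \<infinity> \<and>
      enn2real (mean_semigroup \<P>\<^sub>\<xi> \<xi> \<zeta> \<beta> t f x) = exp (lam * t) * \<phi> x * fmint \<nu> f * (1 + H t f x)"
    and H_bounded: "\<And>t. 0 < t \<Longrightarrow>
      bdd_above ((\<lambda>(x, f). \<bar>H t f x\<bar>) ` (UNIV \<times> L1_plus (meas \<nu>)))"
    and H_limit: "((\<lambda>t. SUP (x, f)\<in>UNIV \<times> L1_plus (meas \<nu>). \<bar>H t f x\<bar>) \<longlongrightarrow> 0) at_top"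
    and extinction: "\<And>t. 0 < t \<Longrightarrow> 0 < measure (\<P> \<nu>) {\<omega> \<in> space (\<P> \<nu>). X t \<omega> = 0}"
  shows "subcritical_superprocess V Q \<P> \<phi> \<nu>"
proof -
  interpret superprocess_laws V Q \<P> by fact
  let ?\<psi> = "branching_mechanism \<beta> \<sigma> \<pi>"
  have P: "transition_semigroup P" using motion by (rule right_process.semigroup)
  obtain b where b: "\<And>x. \<bar>\<beta> x\<bar> \<le> b" using branching by (auto simp: branching_data_def bounded_iff)
  then have b0: "0 \<le> b" by (meson abs_ge_zero order_trans)
  have sol: "cumulant_solution P ?\<psi> f (\<lambda>t. V t f)" if "f \<in> bpB" for f
    using cumulant that by (simp add: cumulant_semigroup_def)
  have \<psi>: "- b * z \<le> ?\<psi> x z" if "0 \<le> z" for x z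
    by (rule branching_mechanism_lower[OF b _ that]) (use branching in \<open>simp add: branching_data_def\<close>)
  have mean: "\<exists>M\<ge>0. \<forall>f\<in>bpB. \<forall>x. exp (- b * t) * kernel_int P t f x \<le> M * \<phi> x * fmint \<nu> f" if t: "0 < t" for t
  proof -
    obtain M where M: "\<And>x f. f \<in> L1_plus (meas \<nu>) \<Longrightarrow> \<bar>H t f x\<bar> \<le> M"
      using H_bounded[OF t] by (auto simp: bdd_above_def)
    have M0: "0 \<le> M" using M[OF bpB_L1_plus[OF nu phi], of undefined] by linarith
    have "exp (- b * t) * kernel_int P t f x \<le> exp (lam * t) * (1 + M) * \<phi> x * fmint \<nu> f" if f: "f \<in> bpB" for f x
    proof -
      have fL: "f \<in> L1_plus (meas \<nu>)" by (rule bpB_L1_plus[OF nu f])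
      have "exp (- b * t) * kernel_int P t f x = enn2real (ennreal (exp (- b * t) * kernel_int P t f x))"
        using kernel_int_bounds(1)[OF P _ f, of t x] t by simp
      also have "\<dots> \<le> enn2real (mean_semigroup \<P>\<^sub>\<xi> \<xi> \<zeta> \<beta> t f x)"
        using H[OF t fL, of x] by (intro enn2real_mono mean_semigroup_bounds(1)[OF motion _ f b] less_imp_le[OF t]) simp
      also have "\<dots> = exp (lam * t) * \<phi> x * fmint \<nu> f * (1 + H t f x)" using H[OF t fL] by blast
      also have "\<dots> \<le> exp (lam * t) * \<phi> x * fmint \<nu> f * (1 + M)"
        using M[OF fL, of x] fmint_nonneg[OF f] bpBD(2)[OF phi] by (intro mult_left_mono) auto
      finally show ?thesis by (simp add: algebra_simps)
    qed
    then show ?thesis using M0 by (intro exI[of _ "exp (lam * t) * (1 + M)"]) auto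
  qed
  have smoothing: "\<exists>M\<ge>0. \<forall>f\<in>bpB. \<forall>x. V t f x \<le> M * \<phi> x * fmint \<nu> f" if t: "0 < t" for t
  proof -
    obtain M where M: "0 \<le> M" "\<And>f x. f \<in> bpB \<Longrightarrow> exp (- b * t) * kernel_int P t f x \<le> M * \<phi> x * fmint \<nu> f"
      using mean[OF t] by blast
    have "V t f x \<le> exp (b * t) * exp (b * t) * M * \<phi> x * fmint \<nu> f" if f: "f \<in> bpB" for f x
    proof -
      have "V t f x \<le> exp (b * t) * kernel_int P t f x"
        using t by (intro cumulant_upper_bound[OF P sol[OF f] f \<psi> b0]) auto
      also have "\<dots> = exp (b * t) * exp (b * t) * (exp (- b * t) * kernel_int P t f x)"
        by (simp add: exp_minus field_simps)
      also have "\<dots> \<le> exp (b * t) * exp (b * t) * (M * \<phi> x * fmint \<nu> f)"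
        using M(2)[OF f] by (intro mult_left_mono) auto
      finally show ?thesis by (simp add: algebra_simps)
    qed
    then show ?thesis using M(1) by (intro exI[of _ "exp (b * t) * exp (b * t) * M"]) auto
  qed
  have upper: "\<exists>K. \<forall>f\<in>bpB. \<forall>x. V t f x \<le> K * \<phi> x" if t: "0 < t" for t
  proof -
    obtain M where M: "0 \<le> M" "\<And>f x. f \<in> bpB \<Longrightarrow> V (t / 2) f x \<le> M * \<phi> x * fmint \<nu> f"
      using smoothing[of "t / 2"] t by auto
    define p where "p = measure (\<P> \<nu>) {\<omega> \<in> space (\<P> \<nu>). X (t / 2) \<omega> = 0}"
    have p: "0 < p" unfolding p_def using t by (intro extinction) simp
    have nuV: "fmint \<nu> (V (t / 2) f) \<le> - ln p" if f: "f \<in> bpB" for f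
    proof -
      have "p = (LINT \<omega>|\<P> \<nu>. indicator {\<omega> \<in> space (\<P> \<nu>). X (t / 2) \<omega> = 0} \<omega>)"
        by (simp add: p_def Int_absorb1)
      also have "\<dots> = (LINT \<omega>|\<P> \<nu>. indicator {0} (X (t / 2) \<omega>))"
        by (intro Bochner_Integration.integral_cong) (auto simp: indicator_def)
      also have "\<dots> \<le> Laplace_X \<nu> (t / 2) f"
        by (intro integral_mono integrable_indicator_X integrable_exp_X f) (auto simp: indicator_def)
      also have "\<dots> = exp (- fmint \<nu> (V (t / 2) f))" using t by (intro integral_exp_X f) simp
      finally have "ln p \<le> ln (exp (- fmint \<nu> (V (t / 2) f)))" using p by (subst ln_le_cancel_iff) auto
      then show ?thesis by simp
    qed
    have "V t f x \<le> (M * - ln p) * \<phi> x" if f: "f \<in> bpB" for f x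
    proof -
      have B: "V (t / 2) f \<in> bpB" using t f by (intro V_bpB) auto
      have "V t f x = V (t / 2) (V (t / 2) f) x" using V_semigroup[of "t / 2" "t / 2" f x] t f by simp
      also have "\<dots> \<le> M * \<phi> x * fmint \<nu> (V (t / 2) f)" by (rule M(2)[OF B])
      also have "\<dots> \<le> M * \<phi> x * - ln p"
        using nuV[OF f] M(1) bpBD(2)[OF phi] by (intro mult_left_mono) auto
      finally show ?thesis by (simp add: algebra_simps)
    qed
    then show ?thesis by blast
  qed
  have lower: "\<exists>T\<ge>2. \<exists>c>0. \<forall>x. c * \<phi> x \<le> V T (\<lambda>_. 1) x"
  proof -
    have one: "(\<lambda>_. 1 :: real) \<in> bpB" by (simp add: bpB_const)
    have "\<forall>\<^sub>F t in at_top. (SUP (x, f)\<in>UNIV \<times> L1_plus (meas \<nu>). \<bar>H t f x\<bar>) < 1 / 2"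
      using H_limit by (rule order_tendstoD) simp
    with eventually_ge_at_top[of "2 :: real"]
    have "\<forall>\<^sub>F t in at_top. 2 \<le> t \<and> (SUP (x, f)\<in>UNIV \<times> L1_plus (meas \<nu>). \<bar>H t f x\<bar>) < 1 / 2"
      by (rule eventually_conj)
    then obtain T where T: "2 \<le> T" "(SUP (x, f)\<in>UNIV \<times> L1_plus (meas \<nu>). \<bar>H T f x\<bar>) < 1 / 2"
      by (auto dest!: eventually_happens)
    have T0: "0 < T" "0 \<le> T" using T by auto
    have H12: "\<bar>H T (\<lambda>_. 1) x\<bar> < 1 / 2" for x
    proof -
      have "\<bar>H T (\<lambda>_. 1) x\<bar> \<le> (SUP (x, f)\<in>UNIV \<times> L1_plus (meas \<nu>). \<bar>H T f x\<bar>)"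
        using cSUP_upper[OF _ H_bounded[OF T0(1)], of "(x, \<lambda>_. 1)"] bpB_L1_plus[OF nu one] by simp
      then show ?thesis using T by simp
    qed
    have kernel_lower: "exp (- b * T) * (exp (lam * T) / 2) * \<phi> x \<le> kernel_int P T (\<lambda>_. 1) x" for x
    proof -
      have oneL: "(\<lambda>_. 1) \<in> L1_plus (meas \<nu>)" by (rule bpB_L1_plus[OF nu one])
      have n1: "fmint \<nu> (\<lambda>_. 1) = 1" using prob_space.prob_space[OF nu] by simp
      have "exp (lam * T) / 2 * \<phi> x \<le> exp (lam * T) * \<phi> x * fmint \<nu> (\<lambda>_. 1) * (1 + H T (\<lambda>_. 1) x)"
      proof -
        have "exp (lam * T) * \<phi> x * (1 / 2) \<le> exp (lam * T) * \<phi> x * (1 + H T (\<lambda>_. 1) x)"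
          using H12[of x] bpBD(2)[OF phi, of x] by (intro mult_left_mono) auto
        then show ?thesis unfolding n1 by simp
      qed
      also have "\<dots> = enn2real (mean_semigroup \<P>\<^sub>\<xi> \<xi> \<zeta> \<beta> T (\<lambda>_. 1) x)" using H[OF T0(1) oneL] by simp
      also have "\<dots> \<le> enn2real (ennreal (exp (b * T) * kernel_int P T (\<lambda>_. 1) x))"
        by (intro enn2real_mono mean_semigroup_bounds(2)[OF motion T0(2) one b]) simp
      also have "\<dots> = exp (b * T) * kernel_int P T (\<lambda>_. 1) x"
        using kernel_int_bounds(1)[OF P T0(2) one] by simp
      finally have "exp (- b * T) * (exp (lam * T) / 2 * \<phi> x) \<le> exp (- b * T) * (exp (b * T) * kernel_int P T (\<lambda>_. 1) x)"
        by (intro mult_left_mono) auto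
      also have "\<dots> = kernel_int P T (\<lambda>_. 1) x" by (simp add: exp_minus)
      finally show ?thesis by (simp add: algebra_simps)
    qed
    define K where "K = exp (b * T)"
    have VK: "V t (\<lambda>_. 1) x \<le> K" if "0 \<le> t" "t \<le> T" for t x
    proof -
      have "V t (\<lambda>_. 1) x \<le> exp (b * t) * kernel_int P t (\<lambda>_. 1) x"
        by (rule cumulant_upper_bound[OF P sol[OF one] one \<psi> b0 that(1)])
      also have "\<dots> \<le> exp (b * T) * 1"
        using kernel_int_bounds(1)[OF P that(1) one, of x] kernel_int_bounds(2)[OF P that(1) one, of 1 x] that b0 by (intro mult_mono) (auto intro: mult_left_mono)
      finally show ?thesis by (simp add: K_def)
    qed
    obtain C where C: "0 \<le> C" "\<And>x z. 0 \<le> z \<Longrightarrow> z \<le> K \<Longrightarrow> ?\<psi> x z \<le> C * z"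
      using branching_mechanism_upper[OF branching, of K] by (auto simp: K_def)
    obtain n :: nat where n: "2 * C * exp (b * T) * T < real n" using reals_Archimedean2 by blast
    have "0 \<le> 2 * C * exp (b * T) * T" using C(1) T0 by simp
    then have n0: "0 < n" using n by (cases n) auto
    \<comment> \<open>the lower bound for \<open>V\<close> is valid for short times only, so \<open>[0, T]\<close> is cut into \<open>n\<close> steps of length \<open>\<delta>\<close>\<close>
    define \<delta> where "\<delta> = T / real n"
    have \<delta>: "0 < \<delta>" "\<delta> \<le> T" "real n * \<delta> = T"
      using n0 T0 by (auto simp: \<delta>_def field_simps)
    have "C * exp (b * \<delta>) * \<delta> \<le> C * exp (b * T) * \<delta>"
      using C(1) \<delta> b0 by (intro mult_right_mono mult_left_mono) (auto intro: mult_left_mono)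
    also have "\<dots> \<le> 1 / 2" using n n0 by (simp add: \<delta>_def field_simps)
    finally have half: "1 / 2 \<le> 1 - C * exp (b * \<delta>) * \<delta>" by simp
    have step: "(1 / 2) ^ k * kernel_int P (real k * \<delta>) (\<lambda>_. 1) x \<le> V (real k * \<delta>) (\<lambda>_. 1) x" if "k \<le> n" for k x
      using that
    proof (induction k arbitrary: x)
      case 0
      have "V 0 (\<lambda>_. 1) x = 1"
      proof -
        have "exp (- fmint (dirac x) (V 0 (\<lambda>_. 1))) = exp (- fmint (dirac x) (\<lambda>_. 1))"
          using integral_exp_X[OF order_refl one, where \<mu> = "dirac x"] integral_exp_X_0[OF one, where \<mu> = "dirac x"] by simp
        then show ?thesis
          unfolding fmint_dirac_bpB[OF one] fmint_dirac_bpB[OF V_bpB[OF order_refl one]] by simp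
      qed
      then show ?case using kernel_int_bounds(2)[OF P order_refl one, of 1 x] by simp
    next
      case (Suc k)
      define t where "t = real k * \<delta>"
      have t: "0 \<le> t" "t + \<delta> = real (Suc k) * \<delta>" "t + \<delta> \<le> T"
      proof -
        show "0 \<le> t" using \<delta> by (simp add: t_def)
        show s: "t + \<delta> = real (Suc k) * \<delta>" by (simp add: t_def algebra_simps)
        have "real (Suc k) * \<delta> \<le> real n * \<delta>" using Suc(2) \<delta> by (intro mult_right_mono) auto
        then show "t + \<delta> \<le> T" using s \<delta> by simp
      qed
      have \<delta>0: "0 \<le> \<delta>" using \<delta> by simp
      define f where "f = V t (\<lambda>_. 1)"
      have f: "f \<in> bpB" unfolding f_def by (rule V_bpB[OF t(1) one])
      have kB: "kernel_int P t (\<lambda>_. 1) \<in> bpB" by (rule kernel_int_bpB[OF P t(1) one])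
      have fK: "V s f x \<le> K" if "0 \<le> s" "s \<le> \<delta>" for s x
      proof -
        have "V s f x = V (s + t) (\<lambda>_. 1) x" unfolding f_def by (rule V_semigroup[OF t(1) that(1) one, symmetric])
        then show ?thesis using VK[of "s + t" x] that t by simp
      qed
      have "(1 / 2) ^ Suc k * kernel_int P (real (Suc k) * \<delta>) (\<lambda>_. 1) x =
          1 / 2 * kernel_int P \<delta> (\<lambda>y. (1 / 2) ^ k * kernel_int P t (\<lambda>_. 1) y) x"
        using kernel_int_kernel_int[OF P \<delta>0 t(1) one, of x]
        unfolding t(2)[symmetric] by (simp add: add.commute)
      also have "\<dots> \<le> 1 / 2 * kernel_int P \<delta> f x"
        using Suc.IH Suc.prems unfolding f_def t_def[symmetric]
        by (intro mult_left_mono kernel_int_mono[OF P \<delta>0 bpB_cmult[OF kB]] V_bpB[OF t(1) one]) auto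
      also have "\<dots> \<le> (1 - C * exp (b * \<delta>) * \<delta>) * kernel_int P \<delta> f x"
        by (intro mult_right_mono half kernel_int_bounds(1)[OF P \<delta>0 f])
      also have "\<dots> \<le> V \<delta> f x"
        by (rule cumulant_lower_bound[OF P sol[OF f] f \<psi> b0 \<delta>0 C fK])
      also have "\<dots> = V (real (Suc k) * \<delta>) (\<lambda>_. 1) x"
        unfolding f_def t(2)[symmetric] using V_semigroup[OF t(1) \<delta>0 one, of x] by (simp add: add.commute)
      finally show ?case .
    qed
    define c where "c = (1 / 2) ^ n * (exp (- b * T) * (exp (lam * T) / 2))"
    have "c * \<phi> x \<le> V T (\<lambda>_. 1) x" for x
    proof -
      have "c * \<phi> x \<le> (1 / 2) ^ n * kernel_int P T (\<lambda>_. 1) x"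
        unfolding c_def using mult_left_mono[OF kernel_lower[of x], of "(1 / 2) ^ n"] by (simp add: mult.assoc)
      also have "\<dots> \<le> V T (\<lambda>_. 1) x" using step[OF order_refl, of x] \<delta>(3) by simp
      finally show ?thesis .
    qed
    moreover have "0 < c" by (simp add: c_def)
    ultimately show ?thesis using T(1) by blast
  qed
  have smooth1: "\<exists>C\<ge>0. \<forall>h\<in>bpB. \<forall>x. V 1 h x \<le> C * fmint \<nu> h"
  proof -
    obtain M where M: "0 \<le> M" "\<And>f x. f \<in> bpB \<Longrightarrow> V 1 f x \<le> M * \<phi> x * fmint \<nu> f"
      using smoothing[of 1] by auto
    obtain L where L: "0 \<le> L" "\<And>x. \<phi> x \<le> L" using bpBD(3)[OF phi] by blast
    have "V 1 h x \<le> M * L * fmint \<nu> h" if h: "h \<in> bpB" for h x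
    proof -
      have "M * \<phi> x * fmint \<nu> h \<le> M * L * fmint \<nu> h"
        using L M(1) fmint_nonneg[OF h] by (intro mult_right_mono mult_left_mono) auto
      with M(2)[OF h, of x] show ?thesis by linarith
    qed
    then show ?thesis using M L by (intro exI[of _ "M * L"]) auto
  qed
  show ?thesis by unfold_locales (fact phi upper lower smooth1)+
qed

section \<open>Finite-dimensional distributions\<close>

lemma measurable_exp_sum:
  fixes f :: "'i \<Rightarrow> 'e::polish_space \<Rightarrow> real"
  assumes "\<And>u. u \<in> J \<Longrightarrow> Z u \<in> M \<rightarrow>\<^sub>M borel" "\<And>u. u \<in> J \<Longrightarrow> f u \<in> bpB"
  shows "(\<lambda>\<omega>. exp (- (\<Sum>u\<in>J. fmint (Z u \<omega>) (f u)))) \<in> borel_measurable M"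
proof -
  have "(\<lambda>\<omega>. fmint (Z u \<omega>) (f u)) \<in> borel_measurable M" if "u \<in> J" for u
    by (rule measurable_compose[OF assms(1)[OF that] measurable_fmint[OF assms(2)[OF that]]])
  then show ?thesis by measurable
qed

lemma measurable_fdd_map:
  assumes "\<And>u. u \<in> J \<Longrightarrow> Z u \<in> M \<rightarrow>\<^sub>M borel"
  shows "(\<lambda>\<omega>. \<lambda>u\<in>J. Z u \<omega>) \<in> M \<rightarrow>\<^sub>M PiM J (\<lambda>_. borel)"
  using assms by (intro measurable_restrict)

lemma integral_fdd_exp:
  fixes f :: "'i \<Rightarrow> 'e::polish_space \<Rightarrow> real"
  assumes "\<And>u. u \<in> J \<Longrightarrow> Z u \<in> M \<rightarrow>\<^sub>M borel" "\<And>u. u \<in> J \<Longrightarrow> f u \<in> bpB"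
  shows "(LINT x|fdd M Z J. exp (- (\<Sum>u\<in>J. fmint (x u) (f u)))) = (LINT \<omega>|M. exp (- (\<Sum>u\<in>J. fmint (Z u \<omega>) (f u))))"
proof -
  have "(LINT x|fdd M Z J. exp (- (\<Sum>u\<in>J. fmint (x u) (f u)))) =
      (LINT \<omega>|M. exp (- (\<Sum>u\<in>J. fmint ((\<lambda>u\<in>J. Z u \<omega>) u) (f u))))"
    unfolding fdd_def using assms
    by (intro integral_distr measurable_fdd_map measurable_exp_sum measurable_component_singleton) auto
  also have "\<dots> = (LINT \<omega>|M. exp (- (\<Sum>u\<in>J. fmint (Z u \<omega>) (f u))))"
    by (intro Bochner_Integration.integral_cong refl arg_cong[where f = "\<lambda>a. exp (- a)"] sum.cong) simp
  finally show ?thesis .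
qed

lemma prob_space_fdd:
  assumes "prob_space M" "\<And>u. u \<in> J \<Longrightarrow> Z u \<in> M \<rightarrow>\<^sub>M borel"
  shows "prob_space (fdd M Z J)"
  unfolding fdd_def using assms by (intro prob_space.prob_space_distr measurable_fdd_map)

context superprocess_laws
begin

text \<open>Functionals of the process started from a random initial measure with law \<open>R\<close>.\<close>

lemma integral_mixture_exp:
  assumes R: "prob_space R" "sets R = sets borel"
    and h: "h \<in> borel_measurable path_space" "\<And>\<omega>. 0 \<le> h \<omega>" "\<And>\<omega>. h \<omega> \<le> 1"
    and w: "w \<in> bpB" "\<And>\<eta>. (LINT \<omega>|\<P> \<eta>. h \<omega>) = exp (- fmint \<eta> w)"
  shows "(LINT \<omega>|(R \<bind> \<P>). h \<omega>) = (LINT \<eta>|R. exp (- fmint \<eta> w))"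
proof -
  have m: "\<P> \<in> R \<rightarrow>\<^sub>M subprob_algebra path_space"
    using measurable_prob_algebraD[OF laws] by (simp add: measurable_cong_sets[OF R(2) refl])
  have "space R \<noteq> {}" using sets_eq_imp_space_eq[OF R(2)] by simp
  then have s: "sets (R \<bind> \<P>) = sets path_space" using sets_law by (intro sets_bind) auto
  have i: "(\<integral>\<^sup>+\<omega>. ennreal (h \<omega>) \<partial>\<P> \<eta>) = ennreal (exp (- fmint \<eta> w))" for \<eta>
  proof -
    interpret prob_space "\<P> \<eta>" by (rule prob_space_law)
    have "integrable (\<P> \<eta>) h"
      using h by (intro integrable_const_bound[where B = 1]) (auto simp: measurable_cong_sets[OF sets_law refl])
    then show ?thesis using h(2) w(2)[of \<eta>] by (simp add: nn_integral_eq_integral)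
  qed
  have "(\<integral>\<^sup>+\<omega>. ennreal (h \<omega>) \<partial>(R \<bind> \<P>)) = (\<integral>\<^sup>+\<eta>. \<integral>\<^sup>+\<omega>. ennreal (h \<omega>) \<partial>\<P> \<eta> \<partial>R)"
    using h(1) by (intro nn_integral_bind[OF _ m]) simp
  then have "(\<integral>\<^sup>+\<omega>. ennreal (h \<omega>) \<partial>(R \<bind> \<P>)) = (\<integral>\<^sup>+\<eta>. ennreal (exp (- fmint \<eta> w)) \<partial>R)" by (simp only: i)
  moreover have "h \<in> borel_measurable (R \<bind> \<P>)" using h(1) by (simp add: measurable_cong_sets[OF s refl])
  moreover have "(\<lambda>\<eta>. exp (- fmint \<eta> w)) \<in> borel_measurable R"
    using measurable_fmint[OF w(1)] by (simp add: measurable_cong_sets[OF R(2) refl])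
  ultimately show ?thesis using h(2) by (simp add: integral_eq_nn_integral)
qed

end

context subcritical_superprocess
begin

text \<open>The three functionals that make up the conditional Laplace functional at the times \<open>s + r + u\<close> given
  survival at time \<open>s + r\<close>. The time \<open>r\<close> need not be among the times \<open>r + u\<close> and is added with weight 0.\<close>

lemma conditional_fdd_Laplace:
  assumes J: "finite J" and r: "\<forall>u\<in>J. 0 < r + u" "0 < r" and f: "\<forall>u\<in>J. f u \<in> bpB"
  shows "\<exists>w\<in>bpB. \<exists>w'\<in>bpB. \<exists>v\<in>bpB. \<forall>s\<ge>0. \<forall>\<mu>.
    (LINT \<omega>|\<P> \<mu>. exp (- (\<Sum>u\<in>J. fmint (X (s + r + u) \<omega>) (f u)))) = Laplace_X \<mu> s w \<and>
    (LINT \<omega>|\<P> \<mu>. exp (- (\<Sum>u\<in>J. fmint (X (s + r + u) \<omega>) (f u))) * indicator {0} (X (s + r) \<omega>)) =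
      Laplace_X \<mu> s w' \<and>
    (LINT \<omega>|\<P> \<mu>. indicator {0} (X (s + r) \<omega>)) = Laplace_X \<mu> s v"
proof -
  define I where "I = (\<lambda>u. r + u) ` J"
  define S where "S = insert r I"
  define g where "g = (\<lambda>t. if t \<in> I then f (t - r) else (\<lambda>_. 0))"
  have S: "finite S" "S \<noteq> {}" "S \<subseteq> {0<..}" "r \<in> S" using J r by (auto simp: S_def I_def)
  have gB: "g t \<in> bpB" for t using f by (auto simp: g_def I_def intro: bpB_const)
  have sum: "(\<Sum>t\<in>S. fmint (X (s + t) \<omega>) (g t)) = (\<Sum>u\<in>J. fmint (X (s + r + u) \<omega>) (f u))" for s \<omega>
  proof -
    have "(\<Sum>t\<in>S. fmint (X (s + t) \<omega>) (g t)) = (\<Sum>t\<in>I. fmint (X (s + t) \<omega>) (g t))"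
      using S(1) by (intro sum.mono_neutral_right) (auto simp: S_def g_def)
    also have "\<dots> = (\<Sum>u\<in>J. fmint (X (s + (r + u)) \<omega>) (g (r + u)))"
      unfolding I_def by (subst sum.reindex) (auto simp: inj_on_def)
    also have "\<dots> = (\<Sum>u\<in>J. fmint (X (s + r + u) \<omega>) (f u))"
      by (intro sum.cong) (auto simp: g_def I_def add.assoc)
    finally show ?thesis .
  qed
  obtain K w where w: "w \<in> bpB"
    "\<forall>s\<ge>0. \<forall>\<mu>. (LINT \<omega>|\<P> \<mu>. cylinder S g s \<omega>) = Laplace_X \<mu> s w"
    using cylinder_Laplace[OF V_upper S(1-3)] gB by blast
  have "\<exists>w\<in>bpB. (\<exists>K. \<forall>x. w x \<le> K * \<phi> x) \<and> (\<forall>s\<ge>0. \<forall>\<mu>.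
    (LINT \<omega>|\<P> \<mu>. cylinder S g s \<omega> * indicator {0} (X (s + r) \<omega>)) =
      Laplace_X \<mu> s w)"
    by (rule killed_cylinder_Laplace[OF V_upper phi_bpB S(1,3,4)]) (auto intro: gB)
  then obtain w' where w': "w' \<in> bpB"
    "\<forall>s\<ge>0. \<forall>\<mu>. (LINT \<omega>|\<P> \<mu>. cylinder S g s \<omega> * indicator {0} (X (s + r) \<omega>)) =
      Laplace_X \<mu> s w'"
    by blast
  obtain v where v: "v \<in> bpB"
    "\<forall>s\<ge>0. \<forall>\<mu>. survival \<mu> (s + r) = 1 - Laplace_X \<mu> s v"
    using extinction_cumulant[OF r(2)] by blast
  show ?thesis
    using w(2) w'(2) v(2) unfolding sum survival_eq
    by (intro bexI[OF _ w(1)] bexI[OF _ w'(1)] bexI[OF _ v(1)]) simp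
qed

end

theorem proposition2p4:
  fixes P :: "real \<Rightarrow> 'e::polish_space \<Rightarrow> 'e measure"
    and W :: "'w measure" and \<P>\<^sub>\<xi> :: "'e \<Rightarrow> 'w measure"
    and \<xi> :: "real \<Rightarrow> 'w \<Rightarrow> 'e" and \<zeta> :: "'w \<Rightarrow> ereal"
    and \<beta> \<sigma> :: "'e \<Rightarrow> real" and \<pi> :: "'e \<Rightarrow> real measure"
    and V :: "real \<Rightarrow> ('e \<Rightarrow> real) \<Rightarrow> 'e \<Rightarrow> real"
    and Q :: "real \<Rightarrow> 'e fmeas \<Rightarrow> 'e fmeas measure"
    and \<P> :: "'e fmeas \<Rightarrow> (real \<Rightarrow> 'e fmeas) measure"
    and lam :: real and \<phi> :: "'e \<Rightarrow> real" and \<nu> :: "'e fmeas"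
    and H :: "real \<Rightarrow> ('e \<Rightarrow> real) \<Rightarrow> 'e \<Rightarrow> real"
    and Qinf :: "'e fmeas measure"
    and N :: "'y measure" and Y :: "real \<Rightarrow> 'y \<Rightarrow> 'e fmeas"
    and \<mu> :: "'e fmeas"
  assumes spatial_motion: "right_process P W \<P>\<^sub>\<xi> \<xi> \<zeta>"
    and branching: "branching_data \<beta> \<sigma> \<pi>"
    and cumulant: "cumulant_semigroup P (branching_mechanism \<beta> \<sigma> \<pi>) V"
    and superprocess: "superprocess V Q \<P>"
    \<comment> \<open>(i)\<close>
    and phi: "\<phi> \<in> borel_measurable borel" "bounded (range \<phi>)" "\<And>x. 0 < \<phi> x"
    and nu: "prob_space (meas \<nu>)" "\<And>U. open U \<Longrightarrow> U \<noteq> {} \<Longrightarrow> 0 < emeasure (meas \<nu>) U"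
    and nu_phi: "fmint \<nu> \<phi> = 1"
    and eigenfunction: "\<And>t x. 0 \<le> t \<Longrightarrow>
      mean_semigroup \<P>\<^sub>\<xi> \<xi> \<zeta> \<beta> t \<phi> x = ennreal (exp (lam * t) * \<phi> x)"
    and eigenmeasure: "\<And>t B. 0 \<le> t \<Longrightarrow> B \<in> sets borel \<Longrightarrow>
      (\<integral>\<^sup>+x. mean_semigroup \<P>\<^sub>\<xi> \<xi> \<zeta> \<beta> t (indicator B) x \<partial>meas \<nu>) =
        ennreal (exp (lam * t)) * emeasure (meas \<nu>) B"
    \<comment> \<open>(ii)\<close>
    and H: "\<And>t x f. 0 < t \<Longrightarrow> f \<in> L1_plus (meas \<nu>) \<Longrightarrow>
      mean_semigroup \<P>\<^sub>\<xi> \<xi> \<zeta> \<beta> t f x < \<infinity> \<and>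
      enn2real (mean_semigroup \<P>\<^sub>\<xi> \<xi> \<zeta> \<beta> t f x) = exp (lam * t) * \<phi> x * fmint \<nu> f * (1 + H t f x)"
    and H_bounded: "\<And>t. 0 < t \<Longrightarrow>
      bdd_above ((\<lambda>(x, f). \<bar>H t f x\<bar>) ` (UNIV \<times> L1_plus (meas \<nu>)))"
    and H_limit: "((\<lambda>t. SUP (x, f)\<in>UNIV \<times> L1_plus (meas \<nu>). \<bar>H t f x\<bar>) \<longlongrightarrow> 0) at_top"
    \<comment> \<open>(iii)\<close>
    and subcritical: "lam < 0"
    \<comment> \<open>(iv)\<close>
    and extinction: "\<And>t. 0 < t \<Longrightarrow> 0 < measure (\<P> \<nu>) {\<omega> \<in> space (\<P> \<nu>). X t \<omega> = 0}"
    and Yaglom: "Yaglom_limit \<P> Qinf"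
    and Y_space: "prob_space N" and Y_measurable: "\<And>u. Y u \<in> N \<rightarrow>\<^sub>M borel"
    and Y_fdd: "\<And>t J. 0 < t \<Longrightarrow> finite J \<Longrightarrow> J \<subseteq> {- t..} \<Longrightarrow>
      fdd N Y J = fdd (given_alive (Qinf \<bind> \<P>) t) (\<lambda>u. X (t + u)) J"
    and mu: "\<mu> \<noteq> 0"
  shows "fdd_converges (\<lambda>t. given_alive (\<P> \<mu>) t) (\<lambda>t u. X (t + u)) N Y at_top"
proof -
  have laws: "superprocess_laws V Q \<P>"
  proof
    fix t :: real and f :: "'e \<Rightarrow> real" assume "0 \<le> t" "f \<in> bpB"
    then have "cumulant_solution P (branching_mechanism \<beta> \<sigma> \<pi>) f (\<lambda>t. V t f)"
      using cumulant by (simp add: cumulant_semigroup_def)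
    from cumulant_solutionD(1)[OF this \<open>0 \<le> t\<close>] show "V t f \<in> bpB" .
  qed (rule superprocess)
  have phi_bpB: "\<phi> \<in> bpB"
    using phi by (auto simp: bpB_def intro: less_imp_le)
  interpret subcritical_superprocess V Q \<P> \<phi> \<nu>
    by (rule cumulant_bounds[OF spatial_motion branching cumulant laws phi_bpB nu(1) H H_bounded H_limit extinction])
  have Qinf: "prob_space Qinf" "sets Qinf = sets borel"
    using Yaglom by (auto simp: Yaglom_limit_def space_prob_algebra)
  have XM: "X t \<in> given_alive M s \<rightarrow>\<^sub>M borel" if "sets M = sets path_space" for M :: "(real \<Rightarrow> 'e fmeas) measure" and s t
    using measurable_X[of t] that by (simp add: given_alive_def uniform_measure_def cong: measurable_cong_sets)
  note XP = XM[OF sets_law]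
  define M where "M = Qinf \<bind> \<P>"
  have "space Qinf \<noteq> {}" using sets_eq_imp_space_eq[OF Qinf(2)] by simp
  then have sM: "sets M = sets path_space" unfolding M_def using sets_law by (intro sets_bind) auto
  have M: "prob_space M"
  proof -
    have "Qinf \<in> space (prob_algebra borel)" using Yaglom by (simp add: Yaglom_limit_def)
    then show ?thesis unfolding M_def
      using laws by (intro prob_space_bind'[of _ borel]) auto
  qed
  interpret M: prob_space M by fact
  show ?thesis
    unfolding fdd_converges_def
  proof (intro allI impI)
    fix J :: "real set" assume J: "finite J"
    \<comment> \<open>any positive \<open>r\<close> exceeding \<open>- u\<close> for all \<open>u \<in> J\<close> would do\<close>
    define r where "r = 1 + (\<Sum>u\<in>J. \<bar>u\<bar>)"
    have r: "0 < r" "\<And>u. u \<in> J \<Longrightarrow> 0 < r + u"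
    proof -
      show "0 < r" unfolding r_def by (intro add_pos_nonneg sum_nonneg) auto
      fix u assume "u \<in> J"
      then have "\<bar>u\<bar> \<le> (\<Sum>u\<in>J. \<bar>u\<bar>)" using J by (intro member_le_sum) auto
      then show "0 < r + u" by (simp add: r_def)
    qed
    show "weakly_converges (product_topology (\<lambda>_. euclidean) J)
        (\<lambda>t. fdd (given_alive (\<P> \<mu>) t) (\<lambda>u. X (t + u)) J) (fdd N Y J) at_top"
    proof (rule Laplace_weak_convergence[OF J])
      show "\<forall>\<^sub>F t in at_top. prob_space (fdd (given_alive (\<P> \<mu>) t) (\<lambda>u. X (t + u)) J)"
        using Yaglom_eventually_survival[OF Yaglom mu]
      proof eventually_elim
        case (elim t)
        interpret prob_space "\<P> \<mu>" by (rule prob_space_law)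
        have "prob_space (given_alive (\<P> \<mu>) t)"
          unfolding given_alive_def space_law[of \<mu>, symmetric]
          using elim by (intro prob_space_uniform_measure) (auto simp: survival_def emeasure_eq_measure space_law)
        then show ?case by (intro prob_space_fdd XP)
      qed
      show "prob_space (fdd N Y J)" by (intro prob_space_fdd Y_space Y_measurable)
      show "sets (fdd (given_alive (\<P> \<mu>) t) (\<lambda>u. X (t + u)) J) = sets (PiM J (\<lambda>_. borel))" for t
        by (simp add: fdd_def)
      show "sets (fdd N Y J) = sets (PiM J (\<lambda>_. borel))" by (simp add: fdd_def)
      fix f :: "real \<Rightarrow> 'e \<Rightarrow> real" assume f: "\<And>u. u \<in> J \<Longrightarrow> f u \<in> bpB"
      obtain w w' v where B: "w \<in> bpB" "w' \<in> bpB" "v \<in> bpB" and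
        w: "\<And>s \<mu>. 0 \<le> s \<Longrightarrow> (LINT \<omega>|\<P> \<mu>. exp (- (\<Sum>u\<in>J. fmint (X (s + r + u) \<omega>) (f u)))) = Laplace_X \<mu> s w" and
        w': "\<And>s \<mu>. 0 \<le> s \<Longrightarrow> (LINT \<omega>|\<P> \<mu>. exp (- (\<Sum>u\<in>J. fmint (X (s + r + u) \<omega>) (f u))) * indicator {0} (X (s + r) \<omega>)) =
          Laplace_X \<mu> s w'" and
        v: "\<And>s \<mu>. 0 \<le> s \<Longrightarrow> (LINT \<omega>|\<P> \<mu>. indicator {0} (X (s + r) \<omega>)) = Laplace_X \<mu> s v"
      proof -
        have "\<forall>u\<in>J. 0 < r + u" "\<forall>u\<in>J. f u \<in> bpB" using r f by auto
        from conditional_fdd_Laplace[OF J this(1) r(1) this(2)] show thesis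
          by (elim bexE) (rule that, auto)
      qed
      define I where "I = (\<lambda>g. LINT \<eta>|Qinf. exp (- fmint \<eta> g))"
      define E where "E = (\<lambda>t \<omega>. exp (- (\<Sum>u\<in>J. fmint (X (t + u) \<omega>) (f u))))"
      have E01: "0 \<le> E t \<omega>" "E t \<omega> \<le> 1" for t \<omega>
        using f by (auto simp: E_def intro!: sum_nonneg fmint_nonneg)
      have Em: "E t \<in> borel_measurable path_space" for t
        unfolding E_def using f by (intro measurable_exp_sum measurable_X)
      have im: "(\<lambda>\<omega>. indicator {0} (X t \<omega>) :: real) \<in> borel_measurable (path_space :: (real \<Rightarrow> 'e fmeas) measure)" for t
        by (rule measurable_compose[OF measurable_X]) (intro borel_measurable_indicator sets_zero_fmeas)
      \<comment> \<open>the Laplace functional of \<open>Y\<close>, computed by starting the process from the Yaglom limit at time \<open>- r\<close>\<close>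
      have IE: "(LINT \<omega>|M. E r \<omega>) = I w"
        unfolding M_def I_def
        by (rule integral_mixture_exp[OF Qinf Em E01 B(1)])
          (use w[of 0] integral_exp_X_0[OF B(1)] in \<open>simp add: E_def\<close>)
      have IE0: "(LINT \<omega>|M. E r \<omega> * indicator {0} (X r \<omega>)) = I w'"
        unfolding M_def I_def
      proof (rule integral_mixture_exp[OF Qinf _ _ _ B(2)])
        show "(\<lambda>\<omega>. E r \<omega> * indicator {0} (X r \<omega>)) \<in> borel_measurable path_space"
          using Em im by (intro borel_measurable_times)
        show "(LINT \<omega>|\<P> \<eta>. E r \<omega> * indicator {0} (X r \<omega>)) = exp (- fmint \<eta> w')" for \<eta>
          using w'[of 0 \<eta>] integral_exp_X_0[OF B(2)] by (simp add: E_def)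
      qed (use E01 in \<open>auto simp: indicator_def\<close>)
      have I0: "(LINT \<omega>|M. indicator {0} (X r \<omega>)) = I v"
        unfolding M_def I_def
        by (rule integral_mixture_exp[OF Qinf im _ _ B(3)])
          (use v[of 0] integral_exp_X_0[OF B(3)] in \<open>auto simp: indicator_def\<close>)
      define A where "A = {\<omega> \<in> space M. X r \<omega> \<noteq> 0}"
      have sp: "space M = space path_space" by (rule sets_eq_imp_space_eq[OF sM])
      have A: "A \<in> sets M" using sets_alive[of 0 r] by (simp add: A_def sp sM space_law sets_law)
      have Mm: "h \<in> borel_measurable M" if "h \<in> borel_measurable path_space" for h :: "_ \<Rightarrow> real"
        using that by (simp add: measurable_cong_sets[OF sM refl])
      have intM: "integrable M (E r)" "integrable M (\<lambda>\<omega>. indicator {0} (X r \<omega>) :: real)"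
        "integrable M (\<lambda>\<omega>. E r \<omega> * indicator {0} (X r \<omega>))"
        using Mm[OF Em] Mm[OF im] E01[of r]
        by (auto intro!: M.integrable_const_bound[where B = 1] simp: indicator_def)
      have indA: "indicator A \<omega> = 1 - (indicator {0} (X r \<omega>) :: real)" if "\<omega> \<in> space M" for \<omega>
        using that by (auto simp: A_def indicator_def)
      have measA: "measure M A = 1 - I v"
      proof -
        have "measure M A = (LINT \<omega>|M. indicator A \<omega>)" using A by (simp add: Int_absorb1 A_def)
        also have "\<dots> = (LINT \<omega>|M. 1 - indicator {0} (X r \<omega>))"
          by (intro Bochner_Integration.integral_cong indA refl)
        also have "\<dots> = 1 - I v" using intM I0 by (simp add: M.prob_space)
        finally show ?thesis .
      qed
      have Yr: "fdd N Y J = fdd (given_alive M r) (\<lambda>u. X (r + u)) J"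
        unfolding M_def
      proof (intro Y_fdd J r(1) subsetI)
        fix u assume "u \<in> J"
        then show "u \<in> {- r..}" using r(2)[of u] by simp
      qed
      \<comment> \<open>conditioning on a null event would give the null measure, but \<open>Y\<close> has probability laws\<close>
      have Apos: "0 < measure M A"
      proof (rule ccontr)
        assume "\<not> 0 < measure M A"
        then have 0: "emeasure M A = 0" using measure_nonneg[of M A] by (simp add: M.emeasure_eq_measure)
        have ga: "given_alive M r = uniform_measure M A" by (simp add: given_alive_def A_def)
        interpret F: prob_space "fdd N Y J" by (intro prob_space_fdd Y_space Y_measurable)
        have null: "emeasure (given_alive M r) B = 0" if B: "B \<in> sets (given_alive M r)" for B
        proof -
          have BM: "B \<in> sets M" using B by (simp add: ga uniform_measure_def)
          have "emeasure M (A \<inter> B) \<le> emeasure M A" using A BM by (intro emeasure_mono) auto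
          then show ?thesis unfolding ga using 0 A BM by simp
        qed
        define Z where "Z = (\<lambda>\<omega>. \<lambda>u\<in>J. X (r + u) \<omega> :: 'e fmeas)"
        have Z: "Z \<in> given_alive M r \<rightarrow>\<^sub>M PiM J (\<lambda>_. borel)"
          unfolding Z_def by (rule measurable_fdd_map[OF XM[OF sM]])
        have "emeasure (fdd N Y J) (space (fdd N Y J)) =
            emeasure (distr (given_alive M r) (PiM J (\<lambda>_. borel)) Z) (space (PiM J (\<lambda>_. borel)))"
          unfolding Yr by (simp add: fdd_def Z_def)
        also have "\<dots> = emeasure (given_alive M r) (Z -` space (PiM J (\<lambda>_. borel)) \<inter> space (given_alive M r))"
          by (rule emeasure_distr[OF Z sets.top])
        also have "\<dots> = 0" by (rule null[OF measurable_sets[OF Z sets.top]])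
        finally show False using F.emeasure_space_1 by simp
      qed
      have limit: "(LINT x|fdd N Y J. exp (- (\<Sum>u\<in>J. fmint (x u) (f u)))) = (I w - I w') / (1 - I v)"
      proof -
        have "(LINT x|fdd N Y J. exp (- (\<Sum>u\<in>J. fmint (x u) (f u)))) = (LINT \<omega>|given_alive M r. E r \<omega>)"
          unfolding Yr E_def by (rule integral_fdd_exp[OF XM[OF sM] f])
        also have "\<dots> = (LINT \<omega>|M. indicator A \<omega> * E r \<omega>) / measure M A"
          unfolding given_alive_def A_def[symmetric]
          by (rule integral_uniform_measure[OF M.finite_measure_axioms A Apos Mm[OF Em]])
        also have "(LINT \<omega>|M. indicator A \<omega> * E r \<omega>) = (LINT \<omega>|M. E r \<omega> - E r \<omega> * indicator {0} (X r \<omega>))"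
          by (intro Bochner_Integration.integral_cong refl) (simp add: indA algebra_simps)
        also have "\<dots> = I w - I w'" using intM IE IE0 by simp
        finally show ?thesis unfolding measA .
      qed
      have Iv: "1 - I v \<noteq> 0" using Apos measA by simp
      define c where "c = conditional_Laplace \<mu>"
      \<comment> \<open>the pre-limit law, expressed through the conditional law at time \<open>t - r\<close>\<close>
      have prelimit: "(LINT x|fdd (given_alive (\<P> \<mu>) t) (\<lambda>u. X (t + u)) J. exp (- (\<Sum>u\<in>J. fmint (x u) (f u)))) =
          (c (t - r) w - c (t - r) w') / (1 - c (t - r) v)"
        if t: "r \<le> t" "0 < survival \<mu> t" "0 < survival \<mu> (t - r)" for t
      proof -
        define s where "s = t - r"
        have s: "0 \<le> s" "s + r = t" using t(1) by (auto simp: s_def)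
        have a: "0 < survival \<mu> s" using t(3) by (simp add: s_def)
        have L: "Laplace_X \<mu> s g = 1 - survival \<mu> s * (1 - c s g)" if "g \<in> bpB" for g
          using conditional_Laplace_eq[OF a that] a by (simp add: c_def)
        have "(LINT x|fdd (given_alive (\<P> \<mu>) t) (\<lambda>u. X (t + u)) J. exp (- (\<Sum>u\<in>J. fmint (x u) (f u)))) =
            (LINT \<omega>|given_alive (\<P> \<mu>) t. E t \<omega>)"
          unfolding E_def by (rule integral_fdd_exp[OF XP f])
        also have "\<dots> = ((LINT \<omega>|\<P> \<mu>. E t \<omega>) - (LINT \<omega>|\<P> \<mu>. E t \<omega> * indicator {0} (X t \<omega>))) / survival \<mu> t"
          using E01[of t] Em[of t]
          by (intro integral_given_alive[OF t(2), where K = 1]) (auto simp: measurable_cong_sets[OF sets_law refl])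
        also have "(LINT \<omega>|\<P> \<mu>. E t \<omega>) = 1 - survival \<mu> s * (1 - c s w)"
          using w[OF s(1), of \<mu>] L[OF B(1)] by (simp add: s(2) E_def)
        also have "(LINT \<omega>|\<P> \<mu>. E t \<omega> * indicator {0} (X t \<omega>)) = 1 - survival \<mu> s * (1 - c s w')"
          using w'[OF s(1), of \<mu>] L[OF B(2)] by (simp add: s(2) E_def)
        also have "survival \<mu> t = survival \<mu> s * (1 - c s v)"
          using v[OF s(1), of \<mu>] L[OF B(3)] by (simp add: s(2) survival_eq)
        also have "(1 - survival \<mu> s * (1 - c s w) - (1 - survival \<mu> s * (1 - c s w'))) / (survival \<mu> s * (1 - c s v)) =
            survival \<mu> s * (c s w - c s w') / (survival \<mu> s * (1 - c s v))"
          by (simp add: algebra_simps)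
        also have "\<dots> = (c s w - c s w') / (1 - c s v)" using a by simp
        finally show ?thesis by (simp add: s_def)
      qed
      have shift: "filterlim (\<lambda>t. t - r) at_top at_top"
        using filterlim_tendsto_add_at_top[OF tendsto_const[of "- r"] filterlim_ident] by simp
      have conv: "((\<lambda>t. c (t - r) g) \<longlongrightarrow> I g) at_top" if "g \<in> bpB" for g
        using filterlim_compose[OF Yaglom_Borel[OF Yaglom mu that] shift] by (simp add: c_def I_def)
      have "((\<lambda>t. (c (t - r) w - c (t - r) w') / (1 - c (t - r) v)) \<longlongrightarrow> (I w - I w') / (1 - I v)) at_top"
        by (intro tendsto_intros conv B Iv)
      moreover have "\<forall>\<^sub>F t in at_top. (c (t - r) w - c (t - r) w') / (1 - c (t - r) v) =
          (LINT x|fdd (given_alive (\<P> \<mu>) t) (\<lambda>u. X (t + u)) J. exp (- (\<Sum>u\<in>J. fmint (x u) (f u))))"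
      proof -
        note pos = Yaglom_eventually_survival[OF Yaglom mu]
        have "\<forall>\<^sub>F t in at_top. 0 < survival \<mu> (t - r)"
          using eventually_compose_filterlim[OF pos shift] .
        with pos eventually_ge_at_top[of r] show ?thesis
          by eventually_elim (simp add: prelimit)
      qed
      ultimately show "((\<lambda>t. LINT x|fdd (given_alive (\<P> \<mu>) t) (\<lambda>u. X (t + u)) J.
            exp (- (\<Sum>u\<in>J. fmint (x u) (f u)))) \<longlongrightarrow> (LINT x|fdd N Y J. exp (- (\<Sum>u\<in>J. fmint (x u) (f u))))) at_top"
        unfolding limit by (rule Lim_transform_eventually)
    qed
  qed
qed

end
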